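(* Let $\alpha>1$, $\beta>\alpha/2+1$, $\gamma>1/2$ and $C_1>1$ be constants such that (i) $\mathrm{E}(\|Y\|^2)<\infty$, $\mathrm{E}(\|X\|^2)<\infty$, and $\mathrm{E}(\|\mathcal{E}\|^2\mid X)\le C_1$ almost surely; (ii) $\mathrm{E}(\xi_k^4)\le C_1\kappa_k^2$ for all $k\ge 1$; (iii) $\kappa_k\le C_1k^{-\alpha}$ and $\kappa_k-\kappa_{k+1}\ge C_1^{-1}k^{-\alpha-1}$ for all $k\ge 1$; (iv) $|b_{j,k}|\le C_1 j^{-\gamma}k^{-\beta}$ for all $j,k\ge 1$. Suppose furthermore that $\gamma>\alpha/2+1$. Let $\tilde b$ be the double-truncation estimator $$\tilde b(s,t)=\sum_{j=1}^{m_{n,1}}\sum_{k=1}^{m_{n,2}}\tilde b_{j,k}\,\hat\phi_j(s)\hat\phi_k(t),\qquad \tilde b_{j,k}=\frac{n^{-1}\sum_{i=1}^n\hat\eta_{i,j}\hat\xi_{i,k}}{\hat\kappa_k},$$ where the positive integers $m_{n,1},m_{n,2}$ satisfy $m_{n,1}\to\infty$ and $m_{n,2}\to\infty$ as $n\to\infty$. Then, provided that $\max\{m_{n,1},m_{n,2}\}=o\{n^{1/(2\alpha+2)}\}$, $$|||\tilde b-b|||^2=O_{\mathrm{P}}\left\{n^{-1}(m_{n,1}+m_{n,2}^{\alpha+1})+m_{n,1}^{-2\gamma+1}+m_{n,2}^{-2\beta+1}\right\}\quad(n\to\infty).$$ Therefore, by choosing $m_{n,1}\sim\min\{n^{1/(2\gamma)},(n/\log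 n)^{1/(2\alpha+2)}\}$ and $m_{n,2}\sim n^{1/(\alpha+2\beta)}$, $$|||\tilde b-b|||^2=O_{\mathrm{P}}\left[\max\{(n/\log n)^{-(2\gamma-1)/(2\alpha+2)},\,n^{-(2\gamma-1)/(2\gamma)},\,n^{-(2\beta-1)/(\alpha+2\beta)}\}\right].$$
   Context: Let $I=[0,1]$, $\|f\|=\{\int_I f^2(t)\,dt\}^{1/2}$ for $f\in L^2(I)$, $|||R|||=\{\iint_{I^2}R^2(s,t)\,ds\,dt\}^{1/2}$ for $R\in L^2(I^2)$, and $(f\otimes g)(s,t)=f(s)g(t)$. For positive sequences, $a_n\sim c_n$ means that $a_n/c_n$ is bounded and bounded away from zero. $X$ and $Y$ are $L^2(I)$-valued random variables on a probability space, with $\mathrm{E}(\|X\|^2)<\infty$, $\mathrm{E}(\|Y\|^2)<\infty$, satisfying the functional linear model $$\mathrm{E}(Y\mid X)(s)=\mathrm{E}\{Y(s)\}+\int_I b(s,t)[X(t)-\mathrm{E}\{X(t)\}]\,dt$$ (equality as $L^2(I)$-valued random variables), where $b\in L^2(I^2)$ is the unknown coefficient function. Put $\mathcal{E}=Y-\mathrm{E}(Y\mid X)$. Let $K(s,t)=\mathrm{Cov}\{X(s),X(t)\}$. The integral operator on $L^2(I)$ with kernel $K$ is assumed injective. Let $K(s,t)=\sum_{k=1}^\infty\kappa_k\phi_k(s)\phi_k(t)$ be its spectral expansion in $L^2(I^2)$, where $\kappa_1\ge\kappa_2\ge\cdots>0$ are the eigenvalues and $\{\phi_k\}_{k\ge1}$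 is an orthonormal basis of $L^2(I)$ of corresponding eigenfunctions. Let $\xi_k=\int_I[X(t)-\mathrm{E}\{X(t)\}]\phi_k(t)\,dt$ and $b_{j,k}=\iint_{I^2}b(s,t)\phi_j(s)\phi_k(t)\,ds\,dt$, so that $b=\sum_{j,k}b_{j,k}\,\phi_j\otimes\phi_k$ in $L^2(I^2)$. Let $(X_1,Y_1),\dots,(X_n,Y_n)$ be independent copies of $(X,Y)$, $\overline X=n^{-1}\sum_{i=1}^nX_i$, and $$\hat K(s,t)=\frac1n\sum_{i=1}^n\{X_i(s)-\overline X(s)\}\{X_i(t)-\overline X(t)\}.$$ Let $\hat K(s,t)=\sum_{k=1}^\infty\hat\kappa_k\hat\phi_k(s)\hat\phi_k(t)$ be its spectral expansion, where $\hat\kappa_1\ge\hat\kappa_2\ge\cdots\ge0$ are the eigenvalues of the integral operator with kernel $\hat K$ and $\{\hat\phi_k\}_{k\ge1}$ is an orthonormal basis of $L^2(I)$ of corresponding eigenfunctions. Let $\hat\xi_{i,k}=\int_I\{X_i(t)-\overline X(t)\}\hat\phi_k(t)\,dt$ and $\hat\eta_{i,j}=\int_I Y_i(s)\hat\phi_j(s)\,ds$. If some $\hat\kappa_k$ in a denominator is zero, the corresponding term is given an arbitrary fixed value, e.g. $0$. *)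

theory Defs
  imports "HOL-Probability.Probability" "HOL-Library.Landau_Symbols"
begin

section \<open>Square-integrable functions\<close>

abbreviation unit_I :: "real measure" where
  "unit_I \<equiv> restrict_space lborel {0..1}"

abbreviation unit_I2 :: "(real \<times> real) measure" where
  "unit_I2 \<equiv> unit_I \<Otimes>\<^sub>M unit_I"

text \<open>Elements of \<open>L2\<close> are represented by functions; two functions represent the same element
  iff they agree almost everywhere, and equality in \<open>L2\<close> is always stated with AE or through
  \<open>l2norm\<close>.\<close>

definition L2 :: "'a measure \<Rightarrow> ('a \<Rightarrow> real) set" where
  "L2 \<mu> = {f \<in> borel_measurable \<mu>. integrable \<mu> (\<lambda>x. (f x)\<^sup>2)}"

definition l2inner :: "'a measure \<Rightarrow> ('a \<Rightarrow> real) \<Rightarrow> ('a \<Rightarrow> real) \<Rightarrow> real" where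
  "l2inner \<mu> f g = (\<integral>x. f x * g x \<partial>\<mu>)"

definition l2norm :: "'a measure \<Rightarrow> ('a \<Rightarrow> real) \<Rightarrow> real" where
  "l2norm \<mu> f = sqrt (\<integral>x. (f x)\<^sup>2 \<partial>\<mu>)"

definition tensor :: "('a \<Rightarrow> real) \<Rightarrow> ('b \<Rightarrow> real) \<Rightarrow> 'a \<times> 'b \<Rightarrow> real" where
  "tensor f g = (\<lambda>(s, t). f s * g t)"

text \<open>Orthonormal bases are indexed by \<open>k \<ge> 1\<close>; the value at index 0 is irrelevant.\<close>

definition L2_onb :: "'a measure \<Rightarrow> (nat \<Rightarrow> 'a \<Rightarrow> real) \<Rightarrow> bool" where
  "L2_onb \<mu> \<phi> \<longleftrightarrow>
     (\<forall>k\<ge>1. \<phi> k \<in> L2 \<mu>) \<and>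
     (\<forall>j\<ge>1. \<forall>k\<ge>1. l2inner \<mu> (\<phi> j) (\<phi> k) = (if j = k then 1 else 0)) \<and>
     (\<forall>f\<in>L2 \<mu>. (\<lambda>N. l2norm \<mu> (\<lambda>x. f x - (\<Sum>k=1..N. l2inner \<mu> f (\<phi> k) * \<phi> k x)))
        \<longlonglongrightarrow> 0)"

definition int_op :: "'a measure \<Rightarrow> ('a \<times> 'a \<Rightarrow> real) \<Rightarrow> ('a \<Rightarrow> real) \<Rightarrow> 'a \<Rightarrow> real" where
  "int_op \<mu> K f = (\<lambda>s. \<integral>t. K (s, t) * f t \<partial>\<mu>)"

definition int_op_injective :: "'a measure \<Rightarrow> ('a \<times> 'a \<Rightarrow> real) \<Rightarrow> bool" where
  "int_op_injective \<mu> K \<longleftrightarrow>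
     (\<forall>f\<in>L2 \<mu>. (AE s in \<mu>. int_op \<mu> K f s = 0) \<longrightarrow> (AE t in \<mu>. f t = 0))"

definition spectral_expansion ::
  "'a measure \<Rightarrow> ('a \<times> 'a \<Rightarrow> real) \<Rightarrow> (nat \<Rightarrow> real) \<Rightarrow> (nat \<Rightarrow> 'a \<Rightarrow> real) \<Rightarrow> bool" where
  "spectral_expansion \<mu> K \<kappa> \<phi> \<longleftrightarrow>
     L2_onb \<mu> \<phi> \<and>
     (\<forall>k\<ge>1. AE s in \<mu>. int_op \<mu> K (\<phi> k) s = \<kappa> k * \<phi> k s) \<and>
     (\<forall>k\<ge>1. \<kappa> (Suc k) \<le> \<kappa> k) \<and>
     (\<lambda>N. l2norm (\<mu> \<Otimes>\<^sub>M \<mu>) (\<lambda>p. K p - (\<Sum>k=1..N. \<kappa> k * tensor (\<phi> k) (\<phi> k) p)))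
        \<longlonglongrightarrow> 0"

section \<open>Random elements of \<open>L2\<close>\<close>

text \<open>The Borel sigma-algebra of the norm topology; since \<open>l2norm\<close> is only a seminorm on
  functions, its sets are unions of AE-equivalence classes.\<close>

definition L2_borel :: "'a measure \<Rightarrow> ('a \<Rightarrow> real) measure" where
  "L2_borel \<mu> = sigma (L2 \<mu>)
     {U. U \<subseteq> L2 \<mu> \<and>
         (\<forall>f\<in>U. \<exists>e>0. \<forall>g\<in>L2 \<mu>. l2norm \<mu> (\<lambda>x. g x - f x) < e \<longrightarrow> g \<in> U)}"

text \<open>An \<open>L2\<close>-valued random variable is represented by a jointly measurable process (every
  random element of the separable space \<open>L2\<close> over \<open>[0,1]\<close> has such a representative), so that
  pointwise expectations such as \<open>E X(t)\<close> and \<open>Cov (X(s), X(t))\<close> make sense for almost all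
  \<open>s\<close>, \<open>t\<close>.\<close>

definition L2_random_variable :: "'w measure \<Rightarrow> ('w \<Rightarrow> real \<Rightarrow> real) \<Rightarrow> bool" where
  "L2_random_variable M X \<longleftrightarrow>
     X \<in> measurable M (L2_borel unit_I) \<and>
     (\<lambda>(\<omega>, t). X \<omega> t) \<in> borel_measurable (M \<Otimes>\<^sub>M unit_I)"

definition mean_fun :: "'w measure \<Rightarrow> ('w \<Rightarrow> real \<Rightarrow> real) \<Rightarrow> real \<Rightarrow> real" where
  "mean_fun M X = (\<lambda>t. \<integral>\<omega>. X \<omega> t \<partial>M)"

definition cov_kernel :: "'w measure \<Rightarrow> ('w \<Rightarrow> real \<Rightarrow> real) \<Rightarrow> real \<times> real \<Rightarrow> real" where
  "cov_kernel M X =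
     (\<lambda>(s, t). \<integral>\<omega>. (X \<omega> s - mean_fun M X s) * (X \<omega> t - mean_fun M X t) \<partial>M)"

definition score :: "'w measure \<Rightarrow> ('w \<Rightarrow> real \<Rightarrow> real) \<Rightarrow> (real \<Rightarrow> real) \<Rightarrow> 'w \<Rightarrow> real" where
  "score M X f = (\<lambda>\<omega>. l2inner unit_I (\<lambda>t. X \<omega> t - mean_fun M X t) f)"

abbreviation sigma_gen :: "'w measure \<Rightarrow> ('w \<Rightarrow> real \<Rightarrow> real) \<Rightarrow> 'w measure" where
  "sigma_gen M X \<equiv> vimage_algebra (space M) X (L2_borel unit_I)"

text \<open>\<open>Z\<close> is a version of the \<open>L2\<close>-valued conditional expectation of \<open>Y\<close> given \<open>F\<close>: it is
  \<open>F\<close>-measurable, Bochner integrable, and \<open>E (1\<^sub>A Z) = E (1\<^sub>A Y)\<close> in \<open>L2\<close> for all \<open>A\<close> in \<open>F\<close>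
  (the Bochner integral of a jointly measurable representative being the pointwise one).\<close>

definition is_L2_cond_exp ::
  "'w measure \<Rightarrow> 'w measure \<Rightarrow> ('w \<Rightarrow> real \<Rightarrow> real) \<Rightarrow> ('w \<Rightarrow> real \<Rightarrow> real) \<Rightarrow> bool" where
  "is_L2_cond_exp M F Y Z \<longleftrightarrow>
     L2_random_variable M Z \<and>
     Z \<in> measurable F (L2_borel unit_I) \<and>
     integrable M (\<lambda>\<omega>. l2norm unit_I (Z \<omega>)) \<and>
     (\<forall>A\<in>sets F. AE s in unit_I. (LINT \<omega>:A|M. Z \<omega> s) = (LINT \<omega>:A|M. Y \<omega> s))"

section \<open>The estimator\<close>

text \<open>\<open>x\<close> and \<open>y\<close> are the observed curves \<open>x 1, \<dots>, x n\<close> and \<open>y 1, \<dots>, y n\<close>.\<close>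

definition sample_mean :: "nat \<Rightarrow> (nat \<Rightarrow> real \<Rightarrow> real) \<Rightarrow> real \<Rightarrow> real" where
  "sample_mean n x = (\<lambda>t. (\<Sum>i=1..n. x i t) / real n)"

definition sample_cov :: "nat \<Rightarrow> (nat \<Rightarrow> real \<Rightarrow> real) \<Rightarrow> real \<times> real \<Rightarrow> real" where
  "sample_cov n x =
     (\<lambda>(s, t). (\<Sum>i=1..n. (x i s - sample_mean n x s) * (x i t - sample_mean n x t)) / real n)"

text \<open>\<open>hkap\<close> and \<open>hphi\<close> are the empirical eigenvalues and eigenfunctions; \<open>d\<close> is the arbitrary
  value given to a coefficient with a zero denominator.\<close>

definition b_tilde_coeff ::
  "nat \<Rightarrow> (nat \<Rightarrow> real \<Rightarrow> real) \<Rightarrow> (nat \<Rightarrow> real \<Rightarrow> real) \<Rightarrow> (nat \<Rightarrow> real) \<Rightarrow>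
   (nat \<Rightarrow> real \<Rightarrow> real) \<Rightarrow> real \<Rightarrow> nat \<Rightarrow> nat \<Rightarrow> real" where
  "b_tilde_coeff n x y hkap hphi d j k =
     (if hkap k = 0 then d
      else ((\<Sum>i=1..n. l2inner unit_I (y i) (hphi j)
                     * l2inner unit_I (\<lambda>t. x i t - sample_mean n x t) (hphi k)) / real n) / hkap k)"

definition b_tilde ::
  "nat \<Rightarrow> nat \<Rightarrow> nat \<Rightarrow> (nat \<Rightarrow> real \<Rightarrow> real) \<Rightarrow> (nat \<Rightarrow> real \<Rightarrow> real) \<Rightarrow> (nat \<Rightarrow> real) \<Rightarrow>
   (nat \<Rightarrow> real \<Rightarrow> real) \<Rightarrow> real \<Rightarrow> real \<times> real \<Rightarrow> real" where
  "b_tilde n m1 m2 x y hkap hphi d =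
     (\<lambda>p. \<Sum>j=1..m1. \<Sum>k=1..m2. b_tilde_coeff n x y hkap hphi d j k * tensor (hphi j) (hphi k) p)"

section \<open>Stochastic order\<close>

text \<open>The exceptional set is bounded by an event instead of being required to be one, i.e. the
  outer probability is used: the empirical eigenfunctions come from an arbitrary choice for each
  sample point.  For random variables this is the usual notion, see \<open>bigO_P_iff\<close> below.\<close>

definition bigO_P :: "'w measure \<Rightarrow> (nat \<Rightarrow> 'w \<Rightarrow> real) \<Rightarrow> (nat \<Rightarrow> real) \<Rightarrow> bool" where
  "bigO_P M Z a \<longleftrightarrow>
     (\<forall>\<epsilon>>0. \<exists>C. eventually (\<lambda>n. \<exists>A\<in>sets M.
        {\<omega> \<in> space M. \<bar>Z n \<omega>\<bar> > C * a n} \<subseteq> A \<and> measure M A \<le> \<epsilon>) sequentially)"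

lemma bigO_P_iff:
  assumes "prob_space M" and [measurable]: "\<And>n. Z n \<in> borel_measurable M"
  shows "bigO_P M Z a \<longleftrightarrow>
     (\<forall>\<epsilon>>0. \<exists>C. eventually (\<lambda>n. measure M {\<omega> \<in> space M. \<bar>Z n \<omega>\<bar> > C * a n} \<le> \<epsilon>) sequentially)"
proof -
  interpret prob_space M by fact
  have "(\<exists>A\<in>sets M. {\<omega> \<in> space M. \<bar>Z n \<omega>\<bar> > c} \<subseteq> A \<and> measure M A \<le> \<epsilon>) \<longleftrightarrow>
        measure M {\<omega> \<in> space M. \<bar>Z n \<omega>\<bar> > c} \<le> \<epsilon>" for n c \<epsilon>
  proof
    assume "\<exists>A\<in>sets M. {\<omega> \<in> space M. \<bar>Z n \<omega>\<bar> > c} \<subseteq> A \<and> measure M A \<le> \<epsilon>"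
    then obtain A where "A \<in> sets M" "{\<omega> \<in> space M. \<bar>Z n \<omega>\<bar> > c} \<subseteq> A" "measure M A \<le> \<epsilon>"
      by blast
    then show "measure M {\<omega> \<in> space M. \<bar>Z n \<omega>\<bar> > c} \<le> \<epsilon>"
      by (meson finite_measure_mono order_trans)
  next
    assume le: "measure M {\<omega> \<in> space M. \<bar>Z n \<omega>\<bar> > c} \<le> \<epsilon>"
    have "{\<omega> \<in> space M. \<bar>Z n \<omega>\<bar> > c} \<in> sets M" by measurable
    with le show "\<exists>A\<in>sets M. {\<omega> \<in> space M. \<bar>Z n \<omega>\<bar> > c} \<subseteq> A \<and> measure M A \<le> \<epsilon>"
      by blast
  qed
  then show ?thesis by (simp add: bigO_P_def)
qed

end

theory Submission
  imports Defs "HOL-Real_Asymp.Real_Asymp"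
begin

text \<open>Write \<open>\<Delta>\<close> for the difference of the empirical and the exact covariance kernel.  Because the
  centred predictors sum to zero and the empirical eigenfunctions diagonalize the empirical
  covariance, the estimated coefficients are exactly the coefficients of \<open>b\<close> in the empirical basis
  plus \<open>S (\<phi>' j, \<phi>' k) / \<kappa>' k\<close>, where \<open>S\<close> is the empirical cross-covariance of the regression errors
  and the predictors (\<open>empirical_coefficient\<close>).  The risk is therefore the error of projecting \<open>b\<close> onto
  empirical eigenfunctions plus a noise term.

  Both are compared with their analogues in the exact eigenbasis.  The comparison rests on one
  perturbation bound (\<open>eigenfunction_perturbation\<close>): if \<open>\<Delta>\<close> is small compared with the gap around
  \<open>\<kappa> j\<close>, then the squared sine of the angle between the \<open>j\<close>-th eigenfunctions is at most a constant
  times the sum over \<open>l \<noteq> j\<close> of \<open>\<Delta> (\<phi> l, \<phi> j)\<^sup>2 / (\<kappa> l - \<kappa> j)\<^sup>2\<close>.  The restriction on the truncation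
  levels says precisely that the gaps in question are large compared with \<open>1 / sqrt n\<close>.  Since
  \<open>\<Delta> (\<phi> l, \<phi> j)\<close> has second moment of order \<open>\<kappa> l * \<kappa> j / n\<close>, up to the centring at the sample mean,
  which is of smaller order, the expectation of the sum is of order \<open>j\<^sup>2 / n\<close> (\<open>weight_sum_le\<close>).

  For the projection error, \<open>b\<close> is split into the part with indices within the truncation levels and
  the rest.  The rest is not increased by projecting and gives the two pure powers of the levels
  (\<open>truncation_error\<close>).  On the leading part the error is at most the sum of \<open>\<bar>b j k\<bar>\<close> times the sum
  of the two sines (\<open>projection_error\<close>); as both decay exponents exceed \<open>3 / 2\<close>, the Cauchy-Schwarz
  inequality bounds its square by a constant times \<open>(m1 + m2) / n\<close>.

  In the noise term \<open>\<phi>' k\<close> is replaced by its component along \<open>\<phi> k\<close>, up to a remainder of the size of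
  the sine (\<open>noise_bound\<close>).  The errors have conditional mean zero and bounded conditional variance,
  so the squared norm of \<open>S (\<cdot>, \<phi> k)\<close> has expectation of order \<open>\<kappa> k / n\<close>, and the main part is of order
  \<open>1 / n\<close> times the sum of \<open>1 / \<kappa> k\<close> over \<open>k \<le> m2\<close>, that is, \<open>m2 powr (\<alpha> + 1) / n\<close>; the remainder
  is smaller.

  All of this is deterministic once finitely many scalar statistics of the sample are under control
  (\<open>risk_bound\<close>).  Those statistics involve the exact eigenfunctions only, hence are measurable; their
  scaled expectations are bounded (\<open>nn_V\<close>), and Markov's inequality finishes the proof
  (\<open>risk_bigO_P\<close>).  On the measurable event where they are small the bound holds for every choice of
  the empirical eigenfunctions, as the outer probability in \<open>bigO_P\<close> demands.  For the particular
  truncation levels the bound is evaluated in \<open>rate_at_levels\<close>.\<close>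

section \<open>The space L2 as a semi-inner product space\<close>

lemma L2_measurable: "f \<in> L2 \<mu> \<Longrightarrow> f \<in> borel_measurable \<mu>"
  by (simp add: L2_def)

lemma L2_square_integrable: "f \<in> L2 \<mu> \<Longrightarrow> integrable \<mu> (\<lambda>x. (f x)\<^sup>2)"
  by (simp add: L2_def)

lemma L2_mult_integrable:
  assumes "f \<in> L2 \<mu>" "g \<in> L2 \<mu>"
  shows "integrable \<mu> (\<lambda>x. f x * g x)"
proof (rule Bochner_Integration.integrable_bound)
  show "integrable \<mu> (\<lambda>x. (f x)\<^sup>2 + (g x)\<^sup>2)"
    using assms by (intro Bochner_Integration.integrable_add L2_square_integrable)
  show "(\<lambda>x. f x * g x) \<in> borel_measurable \<mu>"
    using assms[THEN L2_measurable] by measurable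
  have "\<bar>a * b\<bar> \<le> \<bar>a\<^sup>2 + b\<^sup>2\<bar>" for a b :: real
  proof -
    have "2 * \<bar>a\<bar> * \<bar>b\<bar> \<le> a\<^sup>2 + b\<^sup>2" using sum_squares_bound[of "\<bar>a\<bar>" "\<bar>b\<bar>"] by simp
    moreover have "0 \<le> \<bar>a\<bar> * \<bar>b\<bar>" by simp
    ultimately show ?thesis unfolding abs_mult by linarith
  qed
  then show "AE x in \<mu>. norm (f x * g x) \<le> norm ((f x)\<^sup>2 + (g x)\<^sup>2)" by simp
qed

lemma L2_add: "f \<in> L2 \<mu> \<Longrightarrow> g \<in> L2 \<mu> \<Longrightarrow> (\<lambda>x. f x + g x) \<in> L2 \<mu>"
  using L2_mult_integrable[of f \<mu> g]
  by (auto simp: L2_def power2_sum mult.assoc intro!: Bochner_Integration.integrable_add)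

lemma L2_scale: "f \<in> L2 \<mu> \<Longrightarrow> (\<lambda>x. c * f x) \<in> L2 \<mu>"
  by (auto simp: L2_def power_mult_distrib)

lemma L2_diff: "f \<in> L2 \<mu> \<Longrightarrow> g \<in> L2 \<mu> \<Longrightarrow> (\<lambda>x. f x - g x) \<in> L2 \<mu>"
  using L2_add[of f \<mu> "\<lambda>x. (-1) * g x"] L2_scale[of g \<mu> "-1"] by simp

lemma L2_divide: "f \<in> L2 \<mu> \<Longrightarrow> (\<lambda>x. f x / c) \<in> L2 \<mu>"
  using L2_scale[of f \<mu> "1 / c"] by simp

lemma L2_zero: "(\<lambda>x. 0) \<in> L2 \<mu>"
  by (simp add: L2_def)

lemma L2_abs: "f \<in> L2 \<mu> \<Longrightarrow> (\<lambda>x. \<bar>f x\<bar>) \<in> L2 \<mu>"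
  by (auto simp: L2_def)

lemma L2_sum: "(\<And>i. i \<in> A \<Longrightarrow> f i \<in> L2 \<mu>) \<Longrightarrow> (\<lambda>x. \<Sum>i\<in>A. f i x) \<in> L2 \<mu>"
  by (induction A rule: infinite_finite_induct) (auto intro: L2_add L2_zero)

lemma (in finite_measure) L2_const: "(\<lambda>x. c) \<in> L2 M"
  by (simp add: L2_def)

lemma (in finite_measure) L2_integrable: "f \<in> L2 M \<Longrightarrow> integrable M f"
  using L2_mult_integrable[OF _ L2_const[of 1]] by simp

lemmas L2_intros = L2_add L2_scale L2_diff L2_divide L2_sum L2_zero

lemma l2inner_commute: "l2inner \<mu> f g = l2inner \<mu> g f"
  by (simp add: l2inner_def mult.commute)

lemma l2inner_add_left:
  "f \<in> L2 \<mu> \<Longrightarrow> g \<in> L2 \<mu> \<Longrightarrow> h \<in> L2 \<mu> \<Longrightarrow>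
    l2inner \<mu> (\<lambda>x. f x + g x) h = l2inner \<mu> f h + l2inner \<mu> g h"
  by (simp add: l2inner_def distrib_right L2_mult_integrable)

lemma l2inner_scale_left: "l2inner \<mu> (\<lambda>x. c * f x) h = c * l2inner \<mu> f h"
  by (simp add: l2inner_def mult.assoc)

lemma l2inner_diff_left:
  "f \<in> L2 \<mu> \<Longrightarrow> g \<in> L2 \<mu> \<Longrightarrow> h \<in> L2 \<mu> \<Longrightarrow>
    l2inner \<mu> (\<lambda>x. f x - g x) h = l2inner \<mu> f h - l2inner \<mu> g h"
  by (simp add: l2inner_def left_diff_distrib L2_mult_integrable)

lemma l2inner_sum_left:
  "(\<And>i. i \<in> A \<Longrightarrow> f i \<in> L2 \<mu>) \<Longrightarrow> h \<in> L2 \<mu> \<Longrightarrow>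
    l2inner \<mu> (\<lambda>x. \<Sum>i\<in>A. f i x) h = (\<Sum>i\<in>A. l2inner \<mu> (f i) h)"
  by (simp add: l2inner_def sum_distrib_right L2_mult_integrable)

lemma l2inner_lincomb_left:
  "(\<And>i. i \<in> A \<Longrightarrow> f i \<in> L2 \<mu>) \<Longrightarrow> h \<in> L2 \<mu> \<Longrightarrow>
    l2inner \<mu> (\<lambda>x. \<Sum>i\<in>A. c i * f i x) h = (\<Sum>i\<in>A. c i * l2inner \<mu> (f i) h)"
  by (subst l2inner_sum_left) (auto simp: L2_scale l2inner_scale_left)

lemma l2inner_add_right:
  "f \<in> L2 \<mu> \<Longrightarrow> g \<in> L2 \<mu> \<Longrightarrow> h \<in> L2 \<mu> \<Longrightarrow>
    l2inner \<mu> h (\<lambda>x. f x + g x) = l2inner \<mu> h f + l2inner \<mu> h g"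
  by (simp add: l2inner_commute[of \<mu> h] l2inner_add_left)

lemma l2inner_scale_right: "l2inner \<mu> h (\<lambda>x. c * f x) = c * l2inner \<mu> h f"
  by (simp add: l2inner_commute[of \<mu> h] l2inner_scale_left)

lemma l2inner_diff_right:
  "f \<in> L2 \<mu> \<Longrightarrow> g \<in> L2 \<mu> \<Longrightarrow> h \<in> L2 \<mu> \<Longrightarrow>
    l2inner \<mu> h (\<lambda>x. f x - g x) = l2inner \<mu> h f - l2inner \<mu> h g"
  by (simp add: l2inner_commute[of \<mu> h] l2inner_diff_left)

lemma l2inner_lincomb_right:
  "(\<And>i. i \<in> A \<Longrightarrow> f i \<in> L2 \<mu>) \<Longrightarrow> h \<in> L2 \<mu> \<Longrightarrow>
    l2inner \<mu> h (\<lambda>x. \<Sum>i\<in>A. c i * f i x) = (\<Sum>i\<in>A. c i * l2inner \<mu> h (f i))"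
  by (simp add: l2inner_commute[of \<mu> h] l2inner_lincomb_left)

lemma l2inner_divide_left: "l2inner \<mu> (\<lambda>x. f x / c) h = l2inner \<mu> f h / c"
  using l2inner_scale_left[of \<mu> "1 / c" f h] by simp

lemma l2inner_self_nonneg: "0 \<le> l2inner \<mu> f f"
  by (simp add: l2inner_def)

lemma l2norm_nonneg [simp]: "0 \<le> l2norm \<mu> f"
  by (simp add: l2norm_def)

lemma l2norm_power2: "(l2norm \<mu> f)\<^sup>2 = l2inner \<mu> f f"
  by (simp add: l2norm_def l2inner_def power2_eq_square)

lemma l2norm_power2_integral: "(l2norm \<mu> f)\<^sup>2 = (\<integral>x. (f x)\<^sup>2 \<partial>\<mu>)"
  by (simp add: l2norm_def)

lemma l2inner_cong_AE:
  assumes "AE x in \<mu>. f x = f' x" "f \<in> borel_measurable \<mu>" "f' \<in> borel_measurable \<mu>"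
    "g \<in> borel_measurable \<mu>"
  shows "l2inner \<mu> f g = l2inner \<mu> f' g"
  unfolding l2inner_def using assms by (intro integral_cong_AE) auto

lemma l2norm_cong_AE:
  assumes "AE x in \<mu>. f x = f' x" "f \<in> borel_measurable \<mu>" "f' \<in> borel_measurable \<mu>"
  shows "l2norm \<mu> f = l2norm \<mu> f'"
  unfolding l2norm_def using assms by (intro arg_cong[where f=sqrt] integral_cong_AE) auto

lemma l2norm_scale: "l2norm \<mu> (\<lambda>x. c * f x) = \<bar>c\<bar> * l2norm \<mu> f"
  by (simp add: l2norm_def power_mult_distrib real_sqrt_mult)

lemma l2norm_diff_commute: "l2norm \<mu> (\<lambda>x. f x - g x) = l2norm \<mu> (\<lambda>x. g x - f x)"
  by (simp add: l2norm_def power2_commute)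

text \<open>Since \<open>l2norm\<close> is only a seminorm, the discriminant argument needs the degenerate case
  in which the second function has norm zero separately.\<close>
lemma Cauchy_Schwarz_l2inner_power2:
  assumes f: "f \<in> L2 \<mu>" and g: "g \<in> L2 \<mu>"
  shows "(l2inner \<mu> f g)\<^sup>2 \<le> l2inner \<mu> f f * l2inner \<mu> g g"
proof -
  let ?F = "l2inner \<mu> f f" and ?G = "l2inner \<mu> g g" and ?I = "l2inner \<mu> f g"
  have quad: "0 \<le> x\<^sup>2 * ?F - 2 * x * y * ?I + y\<^sup>2 * ?G" for x y
  proof -
    let ?h = "\<lambda>t. x * f t - y * g t"
    have "l2inner \<mu> ?h ?h = x * l2inner \<mu> f ?h - y * l2inner \<mu> g ?h"
      using f g by (subst l2inner_diff_left) (auto intro: L2_intros simp: l2inner_scale_left)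
    also have "l2inner \<mu> f ?h = x * ?F - y * ?I"
      using f g by (subst l2inner_diff_right) (auto intro: L2_intros simp: l2inner_scale_right)
    also have "l2inner \<mu> g ?h = x * ?I - y * ?G"
      using f g by (subst l2inner_diff_right)
        (auto intro: L2_intros simp: l2inner_scale_right l2inner_commute[of \<mu> g f])
    finally show ?thesis
      using l2inner_self_nonneg[of \<mu> ?h] by (simp add: power2_eq_square algebra_simps)
  qed
  show ?thesis
  proof (cases "?G = 0")
    case True
    \<comment> \<open>the quadratic form is then affine in its second argument and bounded below, so the linear
       coefficient vanishes\<close>
    have "?I = 0"
    proof (rule ccontr)
      assume "?I \<noteq> 0"
      with quad[of 1 "(?F + 1) / (2 * ?I)"] True l2inner_self_nonneg[of \<mu> f] show False by simp
    qed
    then show ?thesis by (simp add: True)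
  next
    case False
    then have "0 < ?G" using l2inner_self_nonneg[of \<mu> g] by simp
    moreover have "0 \<le> ?G * (?F * ?G - ?I\<^sup>2)"
      using quad[of "?G" "?I"] by (simp add: power2_eq_square algebra_simps)
    ultimately show ?thesis by (simp add: zero_le_mult_iff)
  qed
qed

lemma Cauchy_Schwarz_l2inner:
  assumes "f \<in> L2 \<mu>" "g \<in> L2 \<mu>"
  shows "\<bar>l2inner \<mu> f g\<bar> \<le> l2norm \<mu> f * l2norm \<mu> g"
proof (rule power2_le_imp_le)
  show "\<bar>l2inner \<mu> f g\<bar>\<^sup>2 \<le> (l2norm \<mu> f * l2norm \<mu> g)\<^sup>2"
    using Cauchy_Schwarz_l2inner_power2[OF assms] by (simp add: power_mult_distrib l2norm_power2)
qed simp

lemma l2norm_add_power2: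
  assumes "f \<in> L2 \<mu>" "g \<in> L2 \<mu>"
  shows "(l2norm \<mu> (\<lambda>x. f x + g x))\<^sup>2 = (l2norm \<mu> f)\<^sup>2 + 2 * l2inner \<mu> f g + (l2norm \<mu> g)\<^sup>2"
  using assms unfolding l2norm_power2
  by (simp add: l2inner_add_left l2inner_add_right L2_add l2inner_commute[of \<mu> g f])

lemma l2norm_triangle:
  assumes f: "f \<in> L2 \<mu>" and g: "g \<in> L2 \<mu>"
  shows "l2norm \<mu> (\<lambda>x. f x + g x) \<le> l2norm \<mu> f + l2norm \<mu> g"
proof (rule power2_le_imp_le)
  show "(l2norm \<mu> (\<lambda>x. f x + g x))\<^sup>2 \<le> (l2norm \<mu> f + l2norm \<mu> g)\<^sup>2"
    using l2norm_add_power2[OF assms] Cauchy_Schwarz_l2inner[OF assms]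
    by (simp add: power2_sum)
qed simp

lemma l2norm_triangle_diff:
  assumes f: "f \<in> L2 \<mu>" and g: "g \<in> L2 \<mu>"
  shows "l2norm \<mu> (\<lambda>x. f x - g x) \<le> l2norm \<mu> f + l2norm \<mu> g"
  using l2norm_triangle[OF f L2_scale[OF g, of "-1"]] l2norm_scale[of \<mu> "-1" g] by simp

lemma sum_power2_le_twice: "((a::real) + b)\<^sup>2 \<le> 2 * a\<^sup>2 + 2 * b\<^sup>2"
  using sum_squares_bound[of a b] by (simp add: power2_sum)

lemma diff_power2_le_twice: "((a::real) - b)\<^sup>2 \<le> 2 * a\<^sup>2 + 2 * b\<^sup>2"
  using sum_power2_le_twice[of a "-b"] by simp

lemma l2norm_diff_power2_le_twice:
  assumes f: "f \<in> L2 \<mu>" and g: "g \<in> L2 \<mu>"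
  shows "(l2norm \<mu> (\<lambda>x. f x - g x))\<^sup>2 \<le> 2 * (l2norm \<mu> f)\<^sup>2 + 2 * (l2norm \<mu> g)\<^sup>2"
  using power_mono[OF l2norm_triangle_diff[OF assms] l2norm_nonneg, of 2]
    sum_power2_le_twice[of "l2norm \<mu> f" "l2norm \<mu> g"] by linarith

lemma l2norm_lincomb_le:
  assumes "finite A" "\<And>i. i \<in> A \<Longrightarrow> f i \<in> L2 \<mu>"
  shows "l2norm \<mu> (\<lambda>x. \<Sum>i\<in>A. c i * f i x) \<le> (\<Sum>i\<in>A. \<bar>c i\<bar> * l2norm \<mu> (f i))"
  using assms
proof (induction A rule: finite_induct)
  case empty
  then show ?case by (simp add: l2norm_def)
next
  case (insert a A)
  have "l2norm \<mu> (\<lambda>x. c a * f a x + (\<Sum>i\<in>A. c i * f i x))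
      \<le> l2norm \<mu> (\<lambda>x. c a * f a x) + l2norm \<mu> (\<lambda>x. \<Sum>i\<in>A. c i * f i x)"
    using insert.prems by (intro l2norm_triangle L2_intros) auto
  with insert show ?case by (simp add: l2norm_scale)
qed

section \<open>Orthonormal systems\<close>

text \<open>Bases are indexed from 1 and tensor bases by pairs, hence the explicit index set.\<close>
definition orthonormal_on :: "'a measure \<Rightarrow> 'i set \<Rightarrow> ('i \<Rightarrow> 'a \<Rightarrow> real) \<Rightarrow> bool" where
  "orthonormal_on \<mu> A e \<longleftrightarrow> (\<forall>i\<in>A. e i \<in> L2 \<mu>) \<and>
     (\<forall>i\<in>A. \<forall>j\<in>A. l2inner \<mu> (e i) (e j) = (if i = j then 1 else 0))"

lemma orthonormal_onD:
  assumes "orthonormal_on \<mu> A e"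
  shows "i \<in> A \<Longrightarrow> e i \<in> L2 \<mu>"
    and "i \<in> A \<Longrightarrow> j \<in> A \<Longrightarrow> l2inner \<mu> (e i) (e j) = (if i = j then 1 else 0)"
  using assms by (auto simp: orthonormal_on_def)

lemma orthonormal_on_subset: "orthonormal_on \<mu> A e \<Longrightarrow> B \<subseteq> A \<Longrightarrow> orthonormal_on \<mu> B e"
  unfolding orthonormal_on_def by blast

lemma l2norm_orthonormal_lincomb:
  assumes "finite A" "orthonormal_on \<mu> A e"
  shows "(l2norm \<mu> (\<lambda>x. \<Sum>i\<in>A. c i * e i x))\<^sup>2 = (\<Sum>i\<in>A. (c i)\<^sup>2)"
proof -
  note e = orthonormal_onD[OF assms(2)]
  have "l2inner \<mu> (e i) (\<lambda>x. \<Sum>j\<in>A. c j * e j x) = c i" if "i \<in> A" for i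
  proof -
    have "l2inner \<mu> (e i) (\<lambda>x. \<Sum>j\<in>A. c j * e j x) = (\<Sum>j\<in>A. c j * l2inner \<mu> (e i) (e j))"
      using that e(1) by (intro l2inner_lincomb_right)
    also have "\<dots> = (\<Sum>j\<in>A. if i = j then c j else 0)"
      using that e(2) by (intro sum.cong) auto
    finally show ?thesis using that assms(1) by simp
  qed
  then show ?thesis
    unfolding l2norm_power2
    by (subst l2inner_lincomb_left) (auto simp: e power2_eq_square intro!: L2_intros)
qed

text \<open>Pythagoras; Bessel's inequality and the contraction property of orthogonal projections
  are read off from it.\<close>

lemma l2norm_orthonormal_residual:
  assumes "finite A" "orthonormal_on \<mu> A e" and f: "f \<in> L2 \<mu>"
  shows "(l2norm \<mu> (\<lambda>x. f x - (\<Sum>i\<in>A. l2inner \<mu> f (e i) * e i x)))\<^sup>2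
       = (l2norm \<mu> f)\<^sup>2 - (\<Sum>i\<in>A. (l2inner \<mu> f (e i))\<^sup>2)"
proof -
  let ?p = "\<lambda>x. \<Sum>i\<in>A. l2inner \<mu> f (e i) * e i x"
  note e = orthonormal_onD[OF assms(2)]
  have p: "?p \<in> L2 \<mu>" using e by (intro L2_intros) auto
  have "l2inner \<mu> f ?p = (\<Sum>i\<in>A. (l2inner \<mu> f (e i))\<^sup>2)"
    using e f by (simp add: l2inner_lincomb_right power2_eq_square)
  moreover have "l2inner \<mu> ?p ?p = (\<Sum>i\<in>A. (l2inner \<mu> f (e i))\<^sup>2)"
    using l2norm_orthonormal_lincomb[OF assms(1,2)] by (simp add: l2norm_power2)
  ultimately show ?thesis
    using f p unfolding l2norm_power2
    by (simp add: l2inner_diff_left l2inner_diff_right L2_diff l2inner_commute[of \<mu> ?p f])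
qed

lemma Bessel_l2norm:
  assumes "finite A" "orthonormal_on \<mu> A e" "f \<in> L2 \<mu>"
  shows "(\<Sum>i\<in>A. (l2inner \<mu> f (e i))\<^sup>2) \<le> (l2norm \<mu> f)\<^sup>2"
  using l2norm_orthonormal_residual[OF assms]
    zero_le_power2[of "l2norm \<mu> (\<lambda>x. f x - (\<Sum>i\<in>A. l2inner \<mu> f (e i) * e i x))"] by linarith

lemma l2norm_orthonormal_residual_le:
  assumes "finite A" "orthonormal_on \<mu> A e" "f \<in> L2 \<mu>"
  shows "l2norm \<mu> (\<lambda>x. f x - (\<Sum>i\<in>A. l2inner \<mu> f (e i) * e i x)) \<le> l2norm \<mu> f"
proof (rule power2_le_imp_le)
  show "(l2norm \<mu> (\<lambda>x. f x - (\<Sum>i\<in>A. l2inner \<mu> f (e i) * e i x)))\<^sup>2 \<le> (l2norm \<mu> f)\<^sup>2"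
    using l2norm_orthonormal_residual[OF assms] by (simp add: sum_nonneg)
qed simp

lemma L2_onb_in_L2: "L2_onb \<mu> \<phi> \<Longrightarrow> 1 \<le> k \<Longrightarrow> \<phi> k \<in> L2 \<mu>"
  by (simp add: L2_onb_def)

lemma L2_onb_inner:
  "L2_onb \<mu> \<phi> \<Longrightarrow> 1 \<le> j \<Longrightarrow> 1 \<le> k \<Longrightarrow> l2inner \<mu> (\<phi> j) (\<phi> k) = (if j = k then 1 else 0)"
  by (simp add: L2_onb_def)

lemma L2_onb_orthonormal: "L2_onb \<mu> \<phi> \<Longrightarrow> orthonormal_on \<mu> {1..} \<phi>"
  by (auto simp: L2_onb_def orthonormal_on_def)

lemma L2_onb_orthonormal_atMost: "L2_onb \<mu> \<phi> \<Longrightarrow> orthonormal_on \<mu> {1..N} \<phi>"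
  by (rule orthonormal_on_subset[OF L2_onb_orthonormal]) auto

lemma L2_onb_l2norm: "L2_onb \<mu> \<phi> \<Longrightarrow> 1 \<le> k \<Longrightarrow> l2norm \<mu> (\<phi> k) = 1"
  by (simp add: l2norm_def l2inner_def[symmetric] power2_eq_square L2_onb_inner)

lemma L2_onb_Parseval_LIMSEQ:
  assumes "L2_onb \<mu> \<phi>" "f \<in> L2 \<mu>"
  shows "(\<lambda>N. \<Sum>k=1..N. (l2inner \<mu> f (\<phi> k))\<^sup>2) \<longlonglongrightarrow> (l2norm \<mu> f)\<^sup>2"
proof -
  have "(\<lambda>N. (l2norm \<mu> (\<lambda>x. f x - (\<Sum>k=1..N. l2inner \<mu> f (\<phi> k) * \<phi> k x)))\<^sup>2) \<longlonglongrightarrow> 0\<^sup>2"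
    using assms by (intro tendsto_power) (auto simp: L2_onb_def)
  then have "(\<lambda>N. (l2norm \<mu> f)\<^sup>2 - (\<Sum>k=1..N. (l2inner \<mu> f (\<phi> k))\<^sup>2)) \<longlonglongrightarrow> 0"
    by (subst (asm) l2norm_orthonormal_residual[OF _ L2_onb_orthonormal_atMost[OF assms(1)] assms(2)])
       simp_all
  from tendsto_diff[OF tendsto_const[of "(l2norm \<mu> f)\<^sup>2"] this] show ?thesis by simp
qed

lemma sums_Suc_iff_LIMSEQ:
  fixes a :: "nat \<Rightarrow> 'a :: real_normed_vector"
  shows "(\<lambda>k. a (Suc k)) sums s \<longleftrightarrow> (\<lambda>N. \<Sum>k=1..N. a k) \<longlonglongrightarrow> s"
  by (simp add: sums_def lessThan_atLeast0 atLeastLessThanSuc_atLeastAtMost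
      sum.atLeast_Suc_atMost_Suc_shift[symmetric] sum.shift_bounds_Suc_ivl[symmetric] del: sum.op_ivl_Suc)

lemma L2_onb_Parseval:
  assumes "L2_onb \<mu> \<phi>" "f \<in> L2 \<mu>"
  shows "(\<lambda>k. (l2inner \<mu> f (\<phi> (Suc k)))\<^sup>2) sums (l2norm \<mu> f)\<^sup>2"
  using L2_onb_Parseval_LIMSEQ[OF assms]
    sums_Suc_iff_LIMSEQ[of "\<lambda>k. (l2inner \<mu> f (\<phi> k))\<^sup>2"] by blast

text \<open>In this form Parseval's identity can be integrated term by term without checking
  summability.\<close>
lemma L2_onb_Parseval_ennreal:
  assumes "L2_onb \<mu> \<phi>" "f \<in> L2 \<mu>"
  shows "(\<Sum>k. ennreal ((l2inner \<mu> f (\<phi> (Suc k)))\<^sup>2)) = ennreal ((l2norm \<mu> f)\<^sup>2)"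
  using L2_onb_Parseval[OF assms] by (intro suminf_ennreal_eq) auto

section \<open>Kernels on product spaces\<close>

lemma tensor_in_L2:
  assumes "sigma_finite_measure \<mu>" "sigma_finite_measure \<nu>"
    and f: "f \<in> L2 \<mu>" and g: "g \<in> L2 \<nu>"
  shows "tensor f g \<in> L2 (\<mu> \<Otimes>\<^sub>M \<nu>)"
proof -
  interpret pair_sigma_finite \<mu> \<nu> using assms by (simp add: pair_sigma_finite_def)
  note [measurable] = L2_measurable[OF f] L2_measurable[OF g]
  have "integrable (\<mu> \<Otimes>\<^sub>M \<nu>) (\<lambda>p. (f (fst p))\<^sup>2 * (g (snd p))\<^sup>2)"
    using f g by (intro Fubini_integrable) (auto simp: L2_def)
  then show ?thesis
    by (simp add: L2_def tensor_def case_prod_beta power_mult_distrib)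
qed

lemma tensor_apply [simp]: "tensor f g (s, t) = f s * g t"
  by (simp add: tensor_def)

text \<open>The pairing of a kernel with one function in its second variable, the other variable
  staying free: the bridge between kernels and operators.\<close>

definition slice :: "'b measure \<Rightarrow> ('a \<times> 'b \<Rightarrow> real) \<Rightarrow> ('b \<Rightarrow> real) \<Rightarrow> 'a \<Rightarrow> real" where
  "slice \<nu> T g = (\<lambda>s. l2inner \<nu> (\<lambda>t. T (s, t)) g)"

lemma AE_slice_in_L2:
  assumes "sigma_finite_measure \<mu>" "sigma_finite_measure \<nu>" and T: "T \<in> L2 (\<mu> \<Otimes>\<^sub>M \<nu>)"
  shows "AE s in \<mu>. (\<lambda>t. T (s, t)) \<in> L2 \<nu>"
proof -
  interpret pair_sigma_finite \<mu> \<nu> using assms by (simp add: pair_sigma_finite_def)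
  note [measurable] = L2_measurable[OF T]
  have "AE s in \<mu>. integrable \<nu> (\<lambda>t. (T (s, t))\<^sup>2)"
    using AE_integrable_fst'[OF L2_square_integrable[OF T]] .
  moreover have "AE s in \<mu>. (\<lambda>t. T (s, t)) \<in> borel_measurable \<nu>"
    by (rule AE_I2) measurable
  ultimately show ?thesis by eventually_elim (simp add: L2_def)
qed

text \<open>Cauchy-Schwarz in almost every section: the Hilbert-Schmidt norm of a kernel dominates the
  operator norm.\<close>
lemma slice_in_L2:
  assumes sf: "sigma_finite_measure \<mu>" "sigma_finite_measure \<nu>"
    and T: "T \<in> L2 (\<mu> \<Otimes>\<^sub>M \<nu>)" and g: "g \<in> L2 \<nu>"
  shows "slice \<nu> T g \<in> L2 \<mu>"
    and "(l2norm \<mu> (slice \<nu> T g))\<^sup>2 \<le> (l2norm (\<mu> \<Otimes>\<^sub>M \<nu>) T)\<^sup>2 * (l2norm \<nu> g)\<^sup>2"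
proof -
  interpret pair_sigma_finite \<mu> \<nu> using assms by (simp add: pair_sigma_finite_def)
  note [measurable] = L2_measurable[OF T] L2_measurable[OF g]
  have meas [measurable]: "slice \<nu> T g \<in> borel_measurable \<mu>"
    unfolding slice_def l2inner_def by measurable
  have int: "integrable \<mu> (\<lambda>s. (\<integral>t. (T (s, t))\<^sup>2 \<partial>\<nu>) * (l2norm \<nu> g)\<^sup>2)"
    using integrable_fst'[OF L2_square_integrable[OF T]] by simp
  have le: "AE s in \<mu>. (slice \<nu> T g s)\<^sup>2 \<le> (\<integral>t. (T (s, t))\<^sup>2 \<partial>\<nu>) * (l2norm \<nu> g)\<^sup>2"
    using AE_slice_in_L2[OF sf T]
  proof eventually_elim
    case (elim s)
    from Cauchy_Schwarz_l2inner_power2[OF elim g] show ?case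
      by (simp add: slice_def l2norm_power2[symmetric]) (simp add: l2norm_power2_integral)
  qed
  have int2: "integrable \<mu> (\<lambda>s. (slice \<nu> T g s)\<^sup>2)"
    using int by (rule Bochner_Integration.integrable_bound) (use le in auto)
  then show "slice \<nu> T g \<in> L2 \<mu>" by (simp add: L2_def)
  have "(l2norm \<mu> (slice \<nu> T g))\<^sup>2 \<le> (\<integral>s. (\<integral>t. (T (s, t))\<^sup>2 \<partial>\<nu>) * (l2norm \<nu> g)\<^sup>2 \<partial>\<mu>)"
    unfolding l2norm_power2_integral[of \<mu>] by (rule integral_mono_AE[OF int2 int le])
  also have "\<dots> = (l2norm (\<mu> \<Otimes>\<^sub>M \<nu>) T)\<^sup>2 * (l2norm \<nu> g)\<^sup>2"
    using integral_fst'[OF L2_square_integrable[OF T]] by (simp add: l2norm_power2_integral)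
  finally show "(l2norm \<mu> (slice \<nu> T g))\<^sup>2 \<le> (l2norm (\<mu> \<Otimes>\<^sub>M \<nu>) T)\<^sup>2 * (l2norm \<nu> g)\<^sup>2" .
qed

lemma l2inner_slice:
  assumes sf: "sigma_finite_measure \<mu>" "sigma_finite_measure \<nu>"
    and T: "T \<in> L2 (\<mu> \<Otimes>\<^sub>M \<nu>)" and f: "f \<in> L2 \<mu>" and g: "g \<in> L2 \<nu>"
  shows "l2inner \<mu> (slice \<nu> T g) f = l2inner (\<mu> \<Otimes>\<^sub>M \<nu>) T (tensor f g)"
proof -
  interpret pair_sigma_finite \<mu> \<nu> using assms by (simp add: pair_sigma_finite_def)
  have "integrable (\<mu> \<Otimes>\<^sub>M \<nu>) (\<lambda>p. T p * tensor f g p)"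
    using assms by (intro L2_mult_integrable tensor_in_L2)
  from integral_fst'[OF this] show ?thesis
    by (simp add: l2inner_def slice_def ac_simps flip: integral_mult_right_zero)
qed

lemma swap_in_L2:
  assumes sf: "sigma_finite_measure \<mu>" "sigma_finite_measure \<nu>" and T: "T \<in> L2 (\<mu> \<Otimes>\<^sub>M \<nu>)"
  shows "(\<lambda>(t, s). T (s, t)) \<in> L2 (\<nu> \<Otimes>\<^sub>M \<mu>)"
proof -
  interpret pair_sigma_finite \<mu> \<nu> using assms by (simp add: pair_sigma_finite_def)
  note [measurable] = L2_measurable[OF T]
  show ?thesis
    using integrable_product_swap[OF L2_square_integrable[OF T]]
    by (simp add: L2_def case_prod_unfold)
qed

lemma l2inner_swap:
  assumes sf: "sigma_finite_measure \<mu>" "sigma_finite_measure \<nu>" and T: "T \<in> L2 (\<mu> \<Otimes>\<^sub>M \<nu>)"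
    and f: "f \<in> L2 \<mu>" and g: "g \<in> L2 \<nu>"
  shows "l2inner (\<nu> \<Otimes>\<^sub>M \<mu>) (\<lambda>(t, s). T (s, t)) (tensor g f) = l2inner (\<mu> \<Otimes>\<^sub>M \<nu>) T (tensor f g)"
proof -
  interpret pair_sigma_finite \<mu> \<nu> using assms by (simp add: pair_sigma_finite_def)
  have "(\<lambda>p. T p * tensor f g p) \<in> borel_measurable (\<mu> \<Otimes>\<^sub>M \<nu>)"
    using L2_measurable[OF T] L2_measurable[OF tensor_in_L2[OF sf f g]] by measurable
  from integral_product_swap[OF this] show ?thesis
    by (simp add: l2inner_def case_prod_unfold tensor_def mult.commute)
qed

lemma l2inner_tensor_tensor:
  assumes sf: "sigma_finite_measure \<mu>" "sigma_finite_measure \<nu>"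
    and "f \<in> L2 \<mu>" "g \<in> L2 \<nu>" "f' \<in> L2 \<mu>" "g' \<in> L2 \<nu>"
  shows "l2inner (\<mu> \<Otimes>\<^sub>M \<nu>) (tensor f g) (tensor f' g') = l2inner \<mu> f f' * l2inner \<nu> g g'"
proof -
  have "l2inner (\<mu> \<Otimes>\<^sub>M \<nu>) (tensor f g) (tensor f' g') = l2inner \<mu> (slice \<nu> (tensor f g) g') f'"
    using assms by (intro l2inner_slice[symmetric] tensor_in_L2)
  also have "slice \<nu> (tensor f g) g' = (\<lambda>s. l2inner \<nu> g g' * f s)"
    by (simp add: slice_def l2inner_scale_left mult.commute)
  finally show ?thesis by (simp add: l2inner_scale_left)
qed

lemma l2norm_tensor:
  assumes sf: "sigma_finite_measure \<mu>" "sigma_finite_measure \<nu>"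
    and "f \<in> L2 \<mu>" "g \<in> L2 \<nu>"
  shows "l2norm (\<mu> \<Otimes>\<^sub>M \<nu>) (tensor f g) = l2norm \<mu> f * l2norm \<nu> g"
proof (rule power2_eq_imp_eq)
  show "(l2norm (\<mu> \<Otimes>\<^sub>M \<nu>) (tensor f g))\<^sup>2 = (l2norm \<mu> f * l2norm \<nu> g)\<^sup>2"
    using l2inner_tensor_tensor[OF assms(1-4) assms(3,4)]
    by (simp add: l2norm_power2 power_mult_distrib)
qed simp_all

lemma l2inner_tensor_add_left:
  assumes "sigma_finite_measure \<mu>" "sigma_finite_measure \<nu>"
    "T \<in> L2 (\<mu> \<Otimes>\<^sub>M \<nu>)" "f \<in> L2 \<mu>" "f' \<in> L2 \<mu>" "g \<in> L2 \<nu>"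
  shows "l2inner (\<mu> \<Otimes>\<^sub>M \<nu>) T (tensor (\<lambda>x. c * f x + f' x) g)
    = c * l2inner (\<mu> \<Otimes>\<^sub>M \<nu>) T (tensor f g) + l2inner (\<mu> \<Otimes>\<^sub>M \<nu>) T (tensor f' g)"
  using assms
  by (simp add: l2inner_slice[symmetric] l2inner_add_right l2inner_scale_right L2_intros slice_in_L2)

lemma l2inner_tensor_add_right:
  assumes sf: "sigma_finite_measure \<mu>" "sigma_finite_measure \<nu>"
    and T: "T \<in> L2 (\<mu> \<Otimes>\<^sub>M \<nu>)" "f \<in> L2 \<mu>" "g \<in> L2 \<nu>" "g' \<in> L2 \<nu>"
  shows "l2inner (\<mu> \<Otimes>\<^sub>M \<nu>) T (tensor f (\<lambda>x. c * g x + g' x))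
    = c * l2inner (\<mu> \<Otimes>\<^sub>M \<nu>) T (tensor f g) + l2inner (\<mu> \<Otimes>\<^sub>M \<nu>) T (tensor f g')"
  using l2inner_tensor_add_left[OF sf(2,1) swap_in_L2[OF sf T(1)] T(3,4,2), of c] T sf
  by (simp add: l2inner_swap L2_intros)

lemma orthonormal_on_tensor:
  assumes "sigma_finite_measure \<mu>" "sigma_finite_measure \<nu>"
    "orthonormal_on \<mu> A e" "orthonormal_on \<nu> B e'"
  shows "orthonormal_on (\<mu> \<Otimes>\<^sub>M \<nu>) (A \<times> B) (\<lambda>(i, j). tensor (e i) (e' j))"
  using assms
  by (auto simp: orthonormal_on_def tensor_in_L2 l2inner_tensor_tensor)

text \<open>Parseval for the tensor basis, in iterated form: first expand almost every section of
  the kernel in one variable, then each coefficient function in the other.\<close>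

lemma L2_onb_tensor_Parseval_ennreal:
  assumes sf: "sigma_finite_measure \<mu>" "sigma_finite_measure \<nu>"
    and onb: "L2_onb \<mu> \<phi>" "L2_onb \<nu> \<psi>" and T: "T \<in> L2 (\<mu> \<Otimes>\<^sub>M \<nu>)"
  shows "(\<Sum>k. ennreal ((l2norm \<mu> (slice \<nu> T (\<psi> (Suc k))))\<^sup>2)) = ennreal ((l2norm (\<mu> \<Otimes>\<^sub>M \<nu>) T)\<^sup>2)"
    and "(\<Sum>k. \<Sum>j. ennreal ((l2inner (\<mu> \<Otimes>\<^sub>M \<nu>) T (tensor (\<phi> (Suc j)) (\<psi> (Suc k))))\<^sup>2))
      = ennreal ((l2norm (\<mu> \<Otimes>\<^sub>M \<nu>) T)\<^sup>2)"
proof -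
  interpret pair_sigma_finite \<mu> \<nu> using assms by (simp add: pair_sigma_finite_def)
  note [measurable] = L2_measurable[OF T]
  have L: "slice \<nu> T (\<psi> (Suc k)) \<in> L2 \<mu>" for k
    using onb(2) by (intro slice_in_L2[OF sf T]) (auto simp: L2_onb_def)
  note [measurable] = L2_measurable[OF L]
  have nn: "ennreal ((l2norm \<rho> f)\<^sup>2) = (\<integral>\<^sup>+x. ennreal ((f x)\<^sup>2) \<partial>\<rho>)"
    if "f \<in> L2 \<rho>" for f and \<rho> :: "'c measure"
    using L2_square_integrable[OF that] by (simp add: l2norm_power2_integral nn_integral_eq_integral)
  have "(\<Sum>k. ennreal ((l2norm \<mu> (slice \<nu> T (\<psi> (Suc k))))\<^sup>2))
      = (\<integral>\<^sup>+s. (\<Sum>k. ennreal ((slice \<nu> T (\<psi> (Suc k)) s)\<^sup>2)) \<partial>\<mu>)"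
    by (subst nn_integral_suminf) (auto simp: nn[OF L])
  also have "\<dots> = (\<integral>\<^sup>+s. (\<integral>\<^sup>+t. ennreal ((T (s, t))\<^sup>2) \<partial>\<nu>) \<partial>\<mu>)"
    using AE_slice_in_L2[OF sf T]
    by (intro nn_integral_cong_AE, eventually_elim)
       (simp add: slice_def L2_onb_Parseval_ennreal[OF onb(2)] nn)
  also have "\<dots> = (\<integral>\<^sup>+p. ennreal ((T p)\<^sup>2) \<partial>(\<mu> \<Otimes>\<^sub>M \<nu>))"
    using M2.nn_integral_fst[of "\<lambda>p. ennreal ((T p)\<^sup>2)" \<mu>] by simp
  also have "\<dots> = ennreal ((l2norm (\<mu> \<Otimes>\<^sub>M \<nu>) T)\<^sup>2)" by (simp add: nn[OF T])
  finally show *: "(\<Sum>k. ennreal ((l2norm \<mu> (slice \<nu> T (\<psi> (Suc k))))\<^sup>2)) = ennreal ((l2norm (\<mu> \<Otimes>\<^sub>M \<nu>) T)\<^sup>2)" .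
  have "(\<Sum>j. ennreal ((l2inner (\<mu> \<Otimes>\<^sub>M \<nu>) T (tensor (\<phi> (Suc j)) (\<psi> (Suc k))))\<^sup>2))
      = ennreal ((l2norm \<mu> (slice \<nu> T (\<psi> (Suc k))))\<^sup>2)" for k
    using L2_onb_Parseval_ennreal[OF onb(1) L[of k]] onb
    by (simp add: l2inner_slice[OF sf T] L2_onb_in_L2)
  then show "(\<Sum>k. \<Sum>j. ennreal ((l2inner (\<mu> \<Otimes>\<^sub>M \<nu>) T (tensor (\<phi> (Suc j)) (\<psi> (Suc k))))\<^sup>2))
      = ennreal ((l2norm (\<mu> \<Otimes>\<^sub>M \<nu>) T)\<^sup>2)"
    by (simp add: *)
qed

section \<open>Spectral perturbation\<close>

text \<open>Gaussian elimination, one equation at a time: an equation with a nonzero coefficient at \<open>p\<close>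
  is solved for the unknown \<open>p\<close>, which leaves one equation and one unknown less.\<close>
lemma underdetermined_linear_system:
  fixes A :: "'i \<Rightarrow> 'j \<Rightarrow> real"
  assumes "finite I" "finite J" "card I < card J"
  shows "\<exists>c. (\<exists>r\<in>J. c r \<noteq> 0) \<and> (\<forall>i\<in>I. (\<Sum>r\<in>J. c r * A i r) = 0)"
  using assms
proof (induction I arbitrary: J A rule: finite_induct)
  case empty
  then show ?case by (intro exI[of _ "\<lambda>_. 1"]) (auto simp: card_gt_0_iff)
next
  case (insert a I)
  show ?case
  proof (cases "\<forall>r\<in>J. A a r = 0")
    case True
    with insert.IH[of J A] insert.prems insert.hyps show ?thesis by auto
  next
    case False
    then obtain p where p: "p \<in> J" "A a p \<noteq> 0" by blast
    define J' where "J' = J - {p}"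
    have J: "J = insert p J'" "p \<notin> J'" "finite J'" using p insert.prems by (auto simp: J'_def)
    have "card I < card J'" using insert.prems insert.hyps p by (simp add: J'_def)
    from insert.IH[OF J(3) this, of "\<lambda>i r. A i r - A i p * A a r / A a p"] obtain c where
      c: "\<exists>r\<in>J'. c r \<noteq> 0" "\<And>i. i \<in> I \<Longrightarrow> (\<Sum>r\<in>J'. c r * (A i r - A i p * A a r / A a p)) = 0"
      by blast
    define c' where "c' = c(p := - (\<Sum>r\<in>J'. c r * A a r) / A a p)"
    have S: "(\<Sum>r\<in>J. c' r * A i r) = (\<Sum>r\<in>J'. c r * A i r) - (\<Sum>r\<in>J'. c r * A a r) / A a p * A i p" for i
    proof -
      have "(\<Sum>r\<in>J'. c' r * A i r) = (\<Sum>r\<in>J'. c r * A i r)"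
        using J by (intro sum.cong) (auto simp: c'_def)
      then show ?thesis using J by (simp add: c'_def)
    qed
    have "(\<Sum>r\<in>J. c' r * A i r) = 0" if "i \<in> insert a I" for i
    proof (cases "i = a")
      case True
      then show ?thesis using p by (simp add: S)
    next
      case False
      with that have "i \<in> I" by simp
      from c(2)[OF this] have "(\<Sum>r\<in>J'. c r * A i r) - (\<Sum>r\<in>J'. c r * (A i p * A a r / A a p)) = 0"
        by (simp add: right_diff_distrib sum_subtractf)
      also have "(\<Sum>r\<in>J'. c r * (A i p * A a r / A a p)) = (\<Sum>r\<in>J'. c r * A a r) / A a p * A i p"
        by (simp add: sum_distrib_left sum_divide_distrib ac_simps)
      finally show ?thesis by (simp add: S)
    qed
    moreover have "\<exists>r\<in>J. c' r \<noteq> 0" using c(1) J by (auto simp: c'_def)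
    ultimately show ?thesis by blast
  qed
qed

lemma spectral_expansion_onb: "spectral_expansion \<mu> K \<kappa> \<phi> \<Longrightarrow> L2_onb \<mu> \<phi>"
  by (simp add: spectral_expansion_def)

lemma spectral_expansion_antimono:
  assumes "spectral_expansion \<mu> K \<kappa> \<phi>" "1 \<le> j" "j \<le> k"
  shows "\<kappa> k \<le> \<kappa> j"
  using assms(3,2,1)
proof (induction k rule: dec_induct)
  case (step n)
  then have "\<kappa> (Suc n) \<le> \<kappa> n" by (simp add: spectral_expansion_def)
  with step show ?case by simp
qed simp

text \<open>The expansion converges in the Hilbert-Schmidt norm, hence weakly; from here on it is used only
  through the bilinear form of the kernel.\<close>
lemma spectral_expansion_form:
  assumes sf: "sigma_finite_measure \<mu>" and K: "K \<in> L2 (\<mu> \<Otimes>\<^sub>M \<mu>)"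
    and spec: "spectral_expansion \<mu> K \<kappa> \<phi>" and f: "f \<in> L2 \<mu>" and g: "g \<in> L2 \<mu>"
  shows "(\<lambda>N. \<Sum>k=1..N. \<kappa> k * (l2inner \<mu> f (\<phi> k) * l2inner \<mu> g (\<phi> k)))
    \<longlonglongrightarrow> l2inner (\<mu> \<Otimes>\<^sub>M \<mu>) K (tensor f g)"
proof -
  let ?\<mu>2 = "\<mu> \<Otimes>\<^sub>M \<mu>"
  define S where "S N p = (\<Sum>k=1..N. \<kappa> k * tensor (\<phi> k) (\<phi> k) p)" for N p
  note onb = spectral_expansion_onb[OF spec]
  have \<phi>: "\<phi> k \<in> L2 \<mu>" if "1 \<le> k" for k using onb that by (rule L2_onb_in_L2)
  have S: "S N \<in> L2 ?\<mu>2" for N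
    unfolding S_def by (intro L2_intros tensor_in_L2 sf \<phi>) auto
  have fg: "tensor f g \<in> L2 ?\<mu>2" by (intro tensor_in_L2 sf f g)
  have eq: "(\<Sum>k=1..N. \<kappa> k * (l2inner \<mu> f (\<phi> k) * l2inner \<mu> g (\<phi> k))) = l2inner ?\<mu>2 (S N) (tensor f g)" for N
    unfolding S_def using sf f g fg \<phi>
    by (subst l2inner_lincomb_left)
       (auto simp: tensor_in_L2 l2inner_tensor_tensor l2inner_commute[of \<mu> "\<phi> _"] intro!: sum.cong)
  have "(\<lambda>N. l2norm ?\<mu>2 (\<lambda>p. K p - S N p) * l2norm ?\<mu>2 (tensor f g)) \<longlonglongrightarrow> 0 * l2norm ?\<mu>2 (tensor f g)"
    using spec unfolding S_def by (intro tendsto_mult tendsto_const) (simp add: spectral_expansion_def)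
  then have "(\<lambda>N. l2norm ?\<mu>2 (\<lambda>p. K p - S N p) * l2norm ?\<mu>2 (tensor f g)) \<longlonglongrightarrow> 0" by simp
  then have "(\<lambda>N. l2inner ?\<mu>2 K (tensor f g) - l2inner ?\<mu>2 (S N) (tensor f g)) \<longlonglongrightarrow> 0"
  proof (rule Lim_null_comparison[rotated])
    show "\<forall>\<^sub>F N in sequentially. norm (l2inner ?\<mu>2 K (tensor f g) - l2inner ?\<mu>2 (S N) (tensor f g))
        \<le> l2norm ?\<mu>2 (\<lambda>p. K p - S N p) * l2norm ?\<mu>2 (tensor f g)"
      using Cauchy_Schwarz_l2inner[OF L2_diff[OF K S] fg] K S fg
      by (auto simp: l2inner_diff_left)
  qed
  from tendsto_diff[OF tendsto_const[of "l2inner ?\<mu>2 K (tensor f g)"] this]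
  show ?thesis unfolding eq by simp
qed

lemma spectral_expansion_eigen:
  assumes sf: "sigma_finite_measure \<mu>" and K: "K \<in> L2 (\<mu> \<Otimes>\<^sub>M \<mu>)"
    and spec: "spectral_expansion \<mu> K \<kappa> \<phi>" and g: "g \<in> L2 \<mu>" and "1 \<le> l"
  shows "l2inner (\<mu> \<Otimes>\<^sub>M \<mu>) K (tensor (\<phi> l) g) = \<kappa> l * l2inner \<mu> (\<phi> l) g"
    and "l2inner (\<mu> \<Otimes>\<^sub>M \<mu>) K (tensor g (\<phi> l)) = \<kappa> l * l2inner \<mu> (\<phi> l) g"
proof -
  note onb = spectral_expansion_onb[OF spec]
  have \<phi>: "\<phi> l \<in> L2 \<mu>" using onb \<open>1 \<le> l\<close> by (rule L2_onb_in_L2)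
  have sum: "(\<Sum>k=1..N. \<kappa> k * (l2inner \<mu> (\<phi> l) (\<phi> k) * l2inner \<mu> g (\<phi> k))) = \<kappa> l * l2inner \<mu> (\<phi> l) g"
    if "l \<le> N" for N
  proof -
    have "(\<Sum>k=1..N. \<kappa> k * (l2inner \<mu> (\<phi> l) (\<phi> k) * l2inner \<mu> g (\<phi> k)))
       = (\<Sum>k=1..N. if k = l then \<kappa> l * l2inner \<mu> g (\<phi> l) else 0)"
      using onb \<open>1 \<le> l\<close> by (intro sum.cong) (auto simp: L2_onb_inner)
    then show ?thesis using that \<open>1 \<le> l\<close> by (simp add: l2inner_commute)
  qed
  have "\<forall>\<^sub>F N in sequentially.
      (\<Sum>k=1..N. \<kappa> k * (l2inner \<mu> (\<phi> l) (\<phi> k) * l2inner \<mu> g (\<phi> k))) = \<kappa> l * l2inner \<mu> (\<phi> l) g"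
    using eventually_ge_at_top[of l] by eventually_elim (rule sum)
  then have lim: "(\<lambda>N. \<Sum>k=1..N. \<kappa> k * (l2inner \<mu> (\<phi> l) (\<phi> k) * l2inner \<mu> g (\<phi> k)))
      \<longlonglongrightarrow> \<kappa> l * l2inner \<mu> (\<phi> l) g" by (rule tendsto_eventually)
  from LIMSEQ_unique[OF spectral_expansion_form[OF sf K spec \<phi> g] lim]
  show "l2inner (\<mu> \<Otimes>\<^sub>M \<mu>) K (tensor (\<phi> l) g) = \<kappa> l * l2inner \<mu> (\<phi> l) g" .
  from LIMSEQ_unique[OF spectral_expansion_form[OF sf K spec g \<phi>]] lim
  show "l2inner (\<mu> \<Otimes>\<^sub>M \<mu>) K (tensor g (\<phi> l)) = \<kappa> l * l2inner \<mu> (\<phi> l) g"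
    by (simp add: mult.commute)
qed

text \<open>Weyl's inequality by the min-max argument.  On the span of the first \<open>j\<close> eigenfunctions of
  \<open>K'\<close> the quadratic form of \<open>K'\<close> is at least \<open>\<kappa>' j\<close>; orthogonally to the first \<open>j - 1\<close>
  eigenfunctions of \<open>K\<close> the form of \<open>K\<close> is at most \<open>\<kappa> j\<close>.  By dimension both hold at a common
  nonzero \<open>u\<close>, where the two forms differ by at most the norm of the difference of the kernels.\<close>
lemma eigenvalue_perturbation_le:
  assumes sf: "sigma_finite_measure \<mu>" and K: "K \<in> L2 (\<mu> \<Otimes>\<^sub>M \<mu>)" "K' \<in> L2 (\<mu> \<Otimes>\<^sub>M \<mu>)"
    and spec: "spectral_expansion \<mu> K \<kappa> \<phi>" and spec': "spectral_expansion \<mu> K' \<kappa>' \<phi>'"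
    and j: "1 \<le> j"
  shows "\<kappa>' j - \<kappa> j \<le> l2norm (\<mu> \<Otimes>\<^sub>M \<mu>) (\<lambda>p. K' p - K p)"
proof -
  let ?\<mu>2 = "\<mu> \<Otimes>\<^sub>M \<mu>"
  note onb = spectral_expansion_onb[OF spec] and onb' = spectral_expansion_onb[OF spec']
  have \<phi>: "\<phi> k \<in> L2 \<mu>" "\<phi>' k \<in> L2 \<mu>" if "1 \<le> k" for k
    using L2_onb_in_L2[OF onb that] L2_onb_in_L2[OF onb' that] .
  \<comment> \<open>a nonzero combination of the first j eigenfunctions of one kernel that is orthogonal to
     the first j - 1 eigenfunctions of the other\<close>
  have "\<exists>c. (\<exists>r\<in>{1..j}. c r \<noteq> 0) \<and>
      (\<forall>i\<in>{1..<j}. (\<Sum>r\<in>{1..j}. c r * l2inner \<mu> (\<phi>' r) (\<phi> i)) = 0)"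
    using j by (intro underdetermined_linear_system) auto
  then obtain c where c: "\<exists>r\<in>{1..j}. c r \<noteq> 0"
    "\<And>i. i \<in> {1..<j} \<Longrightarrow> (\<Sum>r\<in>{1..j}. c r * l2inner \<mu> (\<phi>' r) (\<phi> i)) = 0" by blast
  define u where "u = (\<lambda>x. \<Sum>r\<in>{1..j}. c r * \<phi>' r x)"
  have u: "u \<in> L2 \<mu>" unfolding u_def by (intro L2_intros \<phi>) auto
  have norm_u: "(l2norm \<mu> u)\<^sup>2 = (\<Sum>r=1..j. (c r)\<^sup>2)"
    unfolding u_def by (rule l2norm_orthonormal_lincomb[OF _ L2_onb_orthonormal_atMost[OF onb']]) simp
  have pos: "0 < (l2norm \<mu> u)\<^sup>2"
    unfolding norm_u using c(1) by (auto intro!: sum_pos2)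
  have perp: "l2inner \<mu> u (\<phi> i) = 0" if "i \<in> {1..<j}" for i
    using c(2)[OF that] that \<phi> unfolding u_def by (subst l2inner_lincomb_left) auto
  have coef: "l2inner \<mu> u (\<phi>' k) = (if k \<le> j then c k else 0)" if "1 \<le> k" for k
  proof -
    have "l2inner \<mu> u (\<phi>' k) = (\<Sum>r=1..j. c r * l2inner \<mu> (\<phi>' r) (\<phi>' k))"
      unfolding u_def using \<phi> that by (subst l2inner_lincomb_left) auto
    also have "\<dots> = (\<Sum>r=1..j. if r = k then c r else 0)"
      using onb' that by (intro sum.cong) (auto simp: L2_onb_inner)
    finally show ?thesis using that by simp
  qed
  have upper: "l2inner ?\<mu>2 K (tensor u u) \<le> \<kappa> j * (l2norm \<mu> u)\<^sup>2"
  proof (rule tendsto_le[OF sequentially_bot _ spectral_expansion_form[OF sf K(1) spec u u]])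
    show "(\<lambda>N. \<kappa> j * (\<Sum>k=1..N. (l2inner \<mu> u (\<phi> k))\<^sup>2)) \<longlonglongrightarrow> \<kappa> j * (l2norm \<mu> u)\<^sup>2"
      by (intro tendsto_intros L2_onb_Parseval_LIMSEQ onb u)
    have "\<kappa> k * (l2inner \<mu> u (\<phi> k) * l2inner \<mu> u (\<phi> k)) \<le> \<kappa> j * (l2inner \<mu> u (\<phi> k))\<^sup>2" if "1 \<le> k" for k
    proof (cases "k < j")
      case True
      then show ?thesis using perp[of k] that by simp
    next
      case False
      then show ?thesis using spectral_expansion_antimono[OF spec j, of k]
        by (auto simp: power2_eq_square intro!: mult_right_mono)
    qed
    then show "\<forall>\<^sub>F N in sequentially. (\<Sum>k=1..N. \<kappa> k * (l2inner \<mu> u (\<phi> k) * l2inner \<mu> u (\<phi> k)))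
        \<le> \<kappa> j * (\<Sum>k=1..N. (l2inner \<mu> u (\<phi> k))\<^sup>2)"
      unfolding sum_distrib_left by (intro always_eventually allI sum_mono) auto
  qed
  have lower: "\<kappa>' j * (l2norm \<mu> u)\<^sup>2 \<le> l2inner ?\<mu>2 K' (tensor u u)"
  proof (rule tendsto_le[OF sequentially_bot spectral_expansion_form[OF sf K(2) spec' u u]])
    show "(\<lambda>N. \<kappa>' j * (\<Sum>k=1..N. (l2inner \<mu> u (\<phi>' k))\<^sup>2)) \<longlonglongrightarrow> \<kappa>' j * (l2norm \<mu> u)\<^sup>2"
      by (intro tendsto_intros L2_onb_Parseval_LIMSEQ onb' u)
    have "\<kappa>' j * (l2inner \<mu> u (\<phi>' k))\<^sup>2 \<le> \<kappa>' k * (l2inner \<mu> u (\<phi>' k) * l2inner \<mu> u (\<phi>' k))" if "1 \<le> k" for k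
      using spectral_expansion_antimono[OF spec' that, of j]
      by (auto simp: coef[OF that] power2_eq_square intro!: mult_right_mono)
    then show "\<forall>\<^sub>F N in sequentially. \<kappa>' j * (\<Sum>k=1..N. (l2inner \<mu> u (\<phi>' k))\<^sup>2)
        \<le> (\<Sum>k=1..N. \<kappa>' k * (l2inner \<mu> u (\<phi>' k) * l2inner \<mu> u (\<phi>' k)))"
      unfolding sum_distrib_left by (intro always_eventually allI sum_mono) auto
  qed
  have "(\<kappa>' j - \<kappa> j) * (l2norm \<mu> u)\<^sup>2 \<le> l2inner ?\<mu>2 (\<lambda>p. K' p - K p) (tensor u u)"
    using upper lower sf u K by (simp add: l2inner_diff_left tensor_in_L2 left_diff_distrib)
  also have "\<dots> \<le> l2norm ?\<mu>2 (\<lambda>p. K' p - K p) * l2norm ?\<mu>2 (tensor u u)"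
    using Cauchy_Schwarz_l2inner[OF L2_diff[OF K(2,1)] tensor_in_L2[OF sf sf u u]] by simp
  also have "\<dots> = l2norm ?\<mu>2 (\<lambda>p. K' p - K p) * (l2norm \<mu> u)\<^sup>2"
    by (simp add: l2norm_tensor[OF sf sf u u] power2_eq_square)
  finally show ?thesis using pos by (rule mult_right_le_imp_le)
qed

lemma eigenvalue_perturbation:
  assumes sf: "sigma_finite_measure \<mu>" and K: "K \<in> L2 (\<mu> \<Otimes>\<^sub>M \<mu>)" "K' \<in> L2 (\<mu> \<Otimes>\<^sub>M \<mu>)"
    and spec: "spectral_expansion \<mu> K \<kappa> \<phi>" and spec': "spectral_expansion \<mu> K' \<kappa>' \<phi>'"
    and j: "1 \<le> j"
  shows "\<bar>\<kappa>' j - \<kappa> j\<bar> \<le> l2norm (\<mu> \<Otimes>\<^sub>M \<mu>) (\<lambda>p. K' p - K p)"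
  using eigenvalue_perturbation_le[OF sf K spec spec' j]
    eigenvalue_perturbation_le[OF sf K(2,1) spec' spec j]
    l2norm_diff_commute[of "\<mu> \<Otimes>\<^sub>M \<mu>" K K']
  by linarith

lemma Bessel_kernel_section:
  assumes sf: "sigma_finite_measure \<mu>" "sigma_finite_measure \<nu>" and "finite A" and e: "orthonormal_on \<mu> A e"
    and T: "T \<in> L2 (\<mu> \<Otimes>\<^sub>M \<nu>)" and w: "w \<in> L2 \<nu>"
  shows "(\<Sum>l\<in>A. (l2inner (\<mu> \<Otimes>\<^sub>M \<nu>) T (tensor (e l) w))\<^sup>2)
    \<le> (l2norm (\<mu> \<Otimes>\<^sub>M \<nu>) T)\<^sup>2 * (l2norm \<nu> w)\<^sup>2"
proof -
  have "(\<Sum>l\<in>A. (l2inner (\<mu> \<Otimes>\<^sub>M \<nu>) T (tensor (e l) w))\<^sup>2)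
      = (\<Sum>l\<in>A. (l2inner \<mu> (slice \<nu> T w) (e l))\<^sup>2)"
    using e by (intro sum.cong) (auto simp: l2inner_slice[OF sf T] w orthonormal_on_def)
  also have "\<dots> \<le> (l2norm \<mu> (slice \<nu> T w))\<^sup>2"
    by (intro Bessel_l2norm assms slice_in_L2)
  also have "\<dots> \<le> (l2norm (\<mu> \<Otimes>\<^sub>M \<nu>) T)\<^sup>2 * (l2norm \<nu> w)\<^sup>2"
    by (rule slice_in_L2(2)[OF sf T w])
  finally show ?thesis .
qed

text \<open>The eigenequations for the two kernels give
  \<open>(\<kappa>' j - \<kappa> l) * (coefficient of \<phi>' j at \<phi> l) = \<Delta> (\<phi> l, \<phi>' j)\<close>, where \<open>\<Delta>\<close> is the difference of
  the kernels.  Splitting \<open>\<phi>' j\<close> into its component along \<open>\<phi> j\<close> and the rest \<open>w\<close> turns this into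
  a bound for \<open>w\<close> by the \<open>j\<close>-th column of \<open>\<Delta>\<close> plus a multiple of \<open>w\<close> itself, and that multiple is
  less than one as soon as \<open>\<Delta>\<close> is small compared with the gap \<open>g\<close>; so it can be absorbed.\<close>

lemma eigenfunction_perturbation:
  assumes sf: "sigma_finite_measure \<mu>" and K: "K \<in> L2 (\<mu> \<Otimes>\<^sub>M \<mu>)" "K' \<in> L2 (\<mu> \<Otimes>\<^sub>M \<mu>)"
    and spec: "spectral_expansion \<mu> K \<kappa> \<phi>" and spec': "spectral_expansion \<mu> K' \<kappa>' \<phi>'"
    and j: "1 \<le> j" and "0 < g"
    and gap: "\<And>l. 1 \<le> l \<Longrightarrow> l \<noteq> j \<Longrightarrow> g \<le> \<bar>\<kappa> l - \<kappa> j\<bar>"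
    and small: "l2norm (\<mu> \<Otimes>\<^sub>M \<mu>) (\<lambda>p. K' p - K p) \<le> g / 4"
    and bound: "\<And>N. (\<Sum>l\<in>{1..N} - {j}.
        (l2inner (\<mu> \<Otimes>\<^sub>M \<mu>) (\<lambda>p. K' p - K p) (tensor (\<phi> l) (\<phi> j)))\<^sup>2 / (\<kappa> l - \<kappa> j)\<^sup>2) \<le> U"
  shows "(l2norm \<mu> (\<lambda>x. \<phi>' j x - l2inner \<mu> (\<phi>' j) (\<phi> j) * \<phi> j x))\<^sup>2 \<le> 16 * U"
proof -
  let ?\<mu>2 = "\<mu> \<Otimes>\<^sub>M \<mu>"
  note onb = spectral_expansion_onb[OF spec] and onb' = spectral_expansion_onb[OF spec']
  have \<phi>: "\<phi> k \<in> L2 \<mu>" "\<phi>' k \<in> L2 \<mu>" if "1 \<le> k" for k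
    using L2_onb_in_L2[OF onb that] L2_onb_in_L2[OF onb' that] .
  define \<Delta> where "\<Delta> = (\<lambda>p. K' p - K p)"
  define \<delta> where "\<delta> = l2norm ?\<mu>2 \<Delta>"
  define a where "a = l2inner \<mu> (\<phi>' j) (\<phi> j)"
  define w where "w = (\<lambda>x. \<phi>' j x - a * \<phi> j x)"
  have \<Delta>: "\<Delta> \<in> L2 ?\<mu>2" unfolding \<Delta>_def by (intro L2_diff K)
  have w: "w \<in> L2 \<mu>" unfolding w_def by (intro L2_intros \<phi> j)
  have \<delta>: "0 \<le> \<delta>" "\<delta> \<le> g / 4" using small by (simp_all add: \<delta>_def \<Delta>_def)
  have a: "a\<^sup>2 \<le> 1"
    using Cauchy_Schwarz_l2inner_power2[OF \<phi>(2)[OF j] \<phi>(1)[OF j]] onb onb' j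
    by (simp add: a_def L2_onb_inner)
  have close: "\<bar>\<kappa>' j - \<kappa> j\<bar> \<le> g / 4"
    using eigenvalue_perturbation[OF sf K spec spec' j] small by simp
  have w_inner: "l2inner \<mu> w (\<phi> l) = l2inner \<mu> (\<phi>' j) (\<phi> l) - a * (if l = j then 1 else 0)" if "1 \<le> l" for l
    unfolding w_def using \<phi> j that onb
    by (subst l2inner_diff_left) (auto simp: L2_scale l2inner_scale_left L2_onb_inner)
  have w_j: "l2inner \<mu> w (\<phi> j) = 0" using w_inner[OF j] by (simp add: a_def)
  have coef_le: "(l2inner \<mu> w (\<phi> l))\<^sup>2 \<le> 8 * ((l2inner ?\<mu>2 \<Delta> (tensor (\<phi> l) (\<phi> j)))\<^sup>2 / (\<kappa> l - \<kappa> j)\<^sup>2)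
        + 8 / g\<^sup>2 * (l2inner ?\<mu>2 \<Delta> (tensor (\<phi> l) w))\<^sup>2" if l: "1 \<le> l" "l \<noteq> j" for l
  proof -
    define D where "D = l2inner ?\<mu>2 \<Delta> (tensor (\<phi> l) (\<phi> j))"
    define E where "E = l2inner ?\<mu>2 \<Delta> (tensor (\<phi> l) w)"
    define q where "q = \<bar>\<kappa> l - \<kappa> j\<bar>"
    have q: "g \<le> q" "0 < q" using gap[OF l] \<open>0 < g\<close> by (simp_all add: q_def)
    have "\<phi>' j = (\<lambda>x. a * \<phi> j x + w x)" by (simp add: w_def)
    then have "a * D + E = l2inner ?\<mu>2 \<Delta> (tensor (\<phi> l) (\<phi>' j))"
      using l2inner_tensor_add_right[OF sf sf \<Delta> \<phi>(1)[OF l(1)] \<phi>(1)[OF j] w, of a]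
      by (simp add: D_def E_def)
    also have "\<dots> = (\<kappa>' j - \<kappa> l) * l2inner \<mu> (\<phi>' j) (\<phi> l)"
      unfolding \<Delta>_def using K \<phi> l j sf
      by (simp add: l2inner_diff_left tensor_in_L2 spectral_expansion_eigen[OF sf K(1) spec]
          spectral_expansion_eigen[OF sf K(2) spec'] l2inner_commute[of \<mu> "\<phi> l"] left_diff_distrib)
    also have "l2inner \<mu> (\<phi>' j) (\<phi> l) = l2inner \<mu> w (\<phi> l)" using w_inner[OF l(1)] l(2) by simp
    finally have eq: "a * D + E = (\<kappa>' j - \<kappa> l) * l2inner \<mu> w (\<phi> l)" .
    have "q / 2 \<le> \<bar>\<kappa>' j - \<kappa> l\<bar>"     proof -
      have "q \<le> \<bar>\<kappa>' j - \<kappa> j\<bar> + \<bar>\<kappa>' j - \<kappa> l\<bar>"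
        using abs_triangle_ineq4[of "\<kappa>' j - \<kappa> j" "\<kappa>' j - \<kappa> l"] by (simp add: q_def)
      with close q show ?thesis by linarith
    qed
    then have "(q / 2)\<^sup>2 * (l2inner \<mu> w (\<phi> l))\<^sup>2 \<le> \<bar>\<kappa>' j - \<kappa> l\<bar>\<^sup>2 * (l2inner \<mu> w (\<phi> l))\<^sup>2"
      using q by (intro mult_right_mono power_mono) auto
    also have "\<dots> = (a * D + E)\<^sup>2" by (simp add: eq power_mult_distrib)
    also have "\<dots> \<le> 2 * (a * D)\<^sup>2 + 2 * E\<^sup>2" by (rule sum_power2_le_twice)
    also have "(a * D)\<^sup>2 \<le> 1 * D\<^sup>2"
      unfolding power_mult_distrib using a by (intro mult_right_mono) auto
    finally have "q\<^sup>2 * (l2inner \<mu> w (\<phi> l))\<^sup>2 \<le> 8 * D\<^sup>2 + 8 * E\<^sup>2" by (simp add: power_divide)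
    then have "(l2inner \<mu> w (\<phi> l))\<^sup>2 \<le> 8 * (D\<^sup>2 / q\<^sup>2) + 8 / q\<^sup>2 * E\<^sup>2"
      using q(2) by (simp add: field_simps)
    also have "8 / q\<^sup>2 * E\<^sup>2 \<le> 8 / g\<^sup>2 * E\<^sup>2"
      using q \<open>0 < g\<close> by (intro mult_right_mono divide_left_mono power_mono) auto
    finally show ?thesis by (simp add: D_def E_def q_def)
  qed
  have "(\<Sum>l=1..N. (l2inner \<mu> w (\<phi> l))\<^sup>2) \<le> 8 * U + 1 / 2 * (l2norm \<mu> w)\<^sup>2" for N
  proof -
    have "(\<Sum>l=1..N. (l2inner \<mu> w (\<phi> l))\<^sup>2) = (\<Sum>l\<in>{1..N} - {j}. (l2inner \<mu> w (\<phi> l))\<^sup>2)"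
      by (intro sum.mono_neutral_right) (auto simp: w_j)
    also have "\<dots> \<le> (\<Sum>l\<in>{1..N} - {j}. 8 * ((l2inner ?\<mu>2 \<Delta> (tensor (\<phi> l) (\<phi> j)))\<^sup>2 / (\<kappa> l - \<kappa> j)\<^sup>2)
        + 8 / g\<^sup>2 * (l2inner ?\<mu>2 \<Delta> (tensor (\<phi> l) w))\<^sup>2)"
      by (intro sum_mono coef_le) auto
    also have "\<dots> = 8 * (\<Sum>l\<in>{1..N} - {j}. (l2inner ?\<mu>2 \<Delta> (tensor (\<phi> l) (\<phi> j)))\<^sup>2 / (\<kappa> l - \<kappa> j)\<^sup>2)
        + 8 / g\<^sup>2 * (\<Sum>l\<in>{1..N} - {j}. (l2inner ?\<mu>2 \<Delta> (tensor (\<phi> l) w))\<^sup>2)"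
      by (simp only: sum.distrib sum_distrib_left)
    also have "\<dots> \<le> 8 * U + 8 / g\<^sup>2 * (\<delta>\<^sup>2 * (l2norm \<mu> w)\<^sup>2)"
    proof (intro add_mono mult_left_mono)
      have "orthonormal_on \<mu> ({1..N} - {j}) \<phi>"
        by (rule orthonormal_on_subset[OF L2_onb_orthonormal[OF onb]]) auto
      then show "(\<Sum>l\<in>{1..N} - {j}. (l2inner ?\<mu>2 \<Delta> (tensor (\<phi> l) w))\<^sup>2) \<le> \<delta>\<^sup>2 * (l2norm \<mu> w)\<^sup>2"
        unfolding \<delta>_def using \<Delta> w by (intro Bessel_kernel_section sf) auto
    qed (use bound[of N] \<open>0 < g\<close> in \<open>auto simp: \<Delta>_def\<close>)
    also have "8 / g\<^sup>2 * (\<delta>\<^sup>2 * (l2norm \<mu> w)\<^sup>2) \<le> 8 / g\<^sup>2 * ((g / 4)\<^sup>2 * (l2norm \<mu> w)\<^sup>2)"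
      using \<delta> by (intro mult_left_mono mult_right_mono power_mono) auto
    also have "\<dots> = 1 / 2 * (l2norm \<mu> w)\<^sup>2" using \<open>0 < g\<close> by (simp add: power_divide)
    finally show ?thesis by simp
  qed
  then have "(l2norm \<mu> w)\<^sup>2 \<le> 8 * U + 1 / 2 * (l2norm \<mu> w)\<^sup>2"
    by (intro LIMSEQ_le_const2[OF L2_onb_Parseval_LIMSEQ[OF onb w]]) auto
  then show ?thesis by (simp add: w_def a_def)
qed

section \<open>Power sums\<close>

text \<open>The Riemann zeta function, as the common bound of all finite partial sums.\<close>
definition zeta_sum :: "real \<Rightarrow> real" where
  "zeta_sum p = (\<Sum>k. real (Suc k) powr (- p))"

lemma zeta_sum_summable: "1 < p \<Longrightarrow> summable (\<lambda>k. real (Suc k) powr (- p))"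
  using summable_real_powr_iff[of "-p"] summable_Suc_iff[of "\<lambda>k. real k powr (-p)"] by simp

lemma zeta_sum_nonneg: "1 < p \<Longrightarrow> 0 \<le> zeta_sum p"
  unfolding zeta_sum_def by (intro suminf_nonneg zeta_sum_summable) auto

lemma sum_powr_le_zeta_sum:
  assumes "1 < p" "finite A" "A \<subseteq> {1..}"
  shows "(\<Sum>k\<in>A. real k powr (- p)) \<le> zeta_sum p"
proof -
  have "(\<Sum>k\<in>A. real k powr (- p)) = (\<Sum>k\<in>(\<lambda>k. k - 1) ` A. real (Suc k) powr (- p))"
    using assms(3) by (subst sum.reindex) (auto intro!: sum.cong inj_on_diff_nat)
  also have "\<dots> \<le> zeta_sum p"
    unfolding zeta_sum_def using assms by (intro sum_le_suminf zeta_sum_summable) auto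
  finally show ?thesis .
qed

text \<open>The next two estimates compare a difference of powers with the derivative at its end points;
  both come from \<open>1 + t \<le> exp t\<close> and \<open>ln (1 + x) \<le> x\<close>.  They turn sums of powers into telescoping
  sums.\<close>
lemma powr_diff_le:
  assumes "0 < a" "1 \<le> i"
  shows "real i powr (- a) - real (Suc i) powr (- a) \<le> a * real i powr (- a - 1)"
proof -
  have i: "0 < real i" "0 < 1 + 1 / real i" using assms by (simp_all add: add_pos_nonneg)
  have "1 - a / real i \<le> 1 + (- a * ln (1 + 1 / real i))"
    using ln_add_one_self_le_self[of "1 / real i"] assms by (simp add: divide_inverse mult_left_mono)
  also have "\<dots> \<le> exp (- a * ln (1 + 1 / real i))" by (rule exp_ge_add_one_self)
  also have "\<dots> = (1 + 1 / real i) powr (- a)" using i by (simp add: powr_def)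
  finally have "real i powr (- a) * (1 - a / real i) \<le> real i powr (- a) * (1 + 1 / real i) powr (- a)"
    by (intro mult_left_mono) auto
  also have "\<dots> = real (Suc i) powr (- a)"
    using i by (subst powr_mult[symmetric]) (auto simp: algebra_simps)
  finally show ?thesis
    using i by (simp add: right_diff_distrib powr_diff ac_simps)
qed

lemma powr_diff_ge:
  assumes "0 < a" "1 \<le> i"
  shows "a * real (Suc i) powr (- a - 1) \<le> real i powr (- a) - real (Suc i) powr (- a)"
proof -
  let ?s = "real (Suc i)"
  have s: "0 < ?s" "1 / ?s < 1" using assms by auto
  have "ln (1 + (- 1 / ?s)) \<le> - 1 / ?s" using s by (intro ln_add_one_self_le_self2) auto
  then have "1 + a / ?s \<le> 1 + (- a * ln (1 - 1 / ?s))"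
    using assms mult_left_mono[of "ln (1 - 1 / ?s)" "- 1 / ?s" a] by (simp add: divide_inverse)
  also have "\<dots> \<le> exp (- a * ln (1 - 1 / ?s))" by (rule exp_ge_add_one_self)
  also have "\<dots> = (1 - 1 / ?s) powr (- a)" using s by (simp add: powr_def)
  finally have "?s powr (- a) * (1 + a / ?s) \<le> ?s powr (- a) * (1 - 1 / ?s) powr (- a)"
    by (intro mult_left_mono) auto
  also have "\<dots> = real i powr (- a)"
    using s by (subst powr_mult[symmetric]) (auto simp: algebra_simps)
  finally show ?thesis
    using s by (simp add: distrib_left powr_diff ac_simps)
qed

lemma sum_powr_tail_le:
  assumes "1 < p" "1 \<le> m"
  shows "(\<Sum>k\<in>{m<..N}. real k powr (- p)) \<le> real m powr (1 - p) / (p - 1)"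
proof -
  have "(\<Sum>k\<in>{m<..N}. real k powr (- p)) \<le> (real m powr (1 - p) - real N powr (1 - p)) / (p - 1)"
    if "m \<le> N" for N
    using that
  proof (induction N rule: dec_induct)
    case (step n)
    have "{m<..Suc n} = insert (Suc n) {m<..n}" using step by auto
    moreover have "real (Suc n) powr (- p) \<le> (real n powr (1 - p) - real (Suc n) powr (1 - p)) / (p - 1)"
      using powr_diff_ge[of "p - 1" n] assms step by (simp add: pos_le_divide_eq mult.commute)
    ultimately show ?case using step by (simp add: diff_divide_distrib)
  qed simp
  moreover have "(real m powr (1 - p) - real N powr (1 - p)) / (p - 1) \<le> real m powr (1 - p) / (p - 1)"
    using assms by (intro divide_right_mono) auto
  ultimately show ?thesis
    by (cases "m \<le> N") (use assms in \<open>auto intro: order_trans\<close>)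
qed

section \<open>Polynomially decaying eigenvalues\<close>

locale polynomial_spectrum =
  fixes \<kappa> :: "nat \<Rightarrow> real" and \<alpha> C1 :: real
  assumes alpha: "1 < \<alpha>" and C1: "1 < C1"
    and pos: "\<And>k. 1 \<le> k \<Longrightarrow> 0 < \<kappa> k"
    and decay: "\<And>k. 1 \<le> k \<Longrightarrow> \<kappa> k \<le> C1 * real k powr (- \<alpha>)"
    and gap: "\<And>k. 1 \<le> k \<Longrightarrow> inverse C1 * real k powr (- \<alpha> - 1) \<le> \<kappa> k - \<kappa> (Suc k)"
begin

lemma decreasing:
  assumes "1 \<le> j" "j \<le> k"
  shows "\<kappa> k \<le> \<kappa> j"
  using assms(2)
proof (induction k rule: dec_induct)
  case (step n)
  have "0 \<le> inverse C1 * real n powr (- \<alpha> - 1)" using C1 by simp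
  with gap[of n] step assms show ?case by simp
qed simp

lemma diff_ge_powr:
  assumes "1 \<le> j" "j \<le> l"
  shows "(real j powr (- \<alpha>) - real l powr (- \<alpha>)) / (\<alpha> * C1) \<le> \<kappa> j - \<kappa> l"
  using assms(2)
proof (induction l rule: dec_induct)
  case (step n)
  have "(real n powr (- \<alpha>) - real (Suc n) powr (- \<alpha>)) / (\<alpha> * C1) \<le> \<alpha> * real n powr (- \<alpha> - 1) / (\<alpha> * C1)"
    using powr_diff_le[of \<alpha> n] alpha C1 step assms by (intro divide_right_mono) auto
  also have "\<dots> = inverse C1 * real n powr (- \<alpha> - 1)" using alpha by (simp add: divide_inverse)
  also have "\<dots> \<le> \<kappa> n - \<kappa> (Suc n)" using gap[of n] step assms by simp
  finally show ?case using step by (simp add: diff_divide_distrib)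
qed simp

text \<open>The gap between two eigenvalues, in a form that is sharp up to constants both for
  neighbouring and for distant indices.\<close>

lemma diff_ge:
  assumes "1 \<le> j" "j < l"
  shows "real j powr (- \<alpha>) * (real l - real j) / (\<alpha> * C1 * real l) \<le> \<kappa> j - \<kappa> l"
proof -
  have l: "0 < real l" "0 < real j" using assms by auto
  have "real l powr (- \<alpha>) = real j powr (- \<alpha>) * (real j / real l) powr \<alpha>"
    using l by (simp add: powr_divide powr_minus field_simps)
  also have "\<dots> \<le> real j powr (- \<alpha>) * (real j / real l) powr 1"
    using l assms alpha by (intro mult_left_mono powr_mono') auto
  also have "\<dots> = real j powr (- \<alpha>) - real j powr (- \<alpha>) * (real l - real j) / real l"
    using l by (simp add: field_simps)
  finally have "real j powr (- \<alpha>) * (real l - real j) / real l / (\<alpha> * C1)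
      \<le> (real j powr (- \<alpha>) - real l powr (- \<alpha>)) / (\<alpha> * C1)"
    using alpha C1 by (intro divide_right_mono) auto
  also have "\<dots> \<le> \<kappa> j - \<kappa> l" using assms by (intro diff_ge_powr) auto
  finally show ?thesis by (simp add: mult.commute)
qed

text \<open>The gaps between the indices \<open>m\<close> and \<open>2 * m\<close> alone add up to this much.\<close>
lemma kappa_ge:
  assumes "1 \<le> m"
  shows "real m powr (- \<alpha>) / (2 * \<alpha> * C1) \<le> \<kappa> m"
proof -
  have "p / (2 * \<alpha> * C1) = p * (2 * r - r) / (\<alpha> * C1 * (2 * r))" if "0 < r" for p r
    using that by simp
  from this[of "real m" "real m powr (- \<alpha>)"]
  have "real m powr (- \<alpha>) / (2 * \<alpha> * C1)
      = real m powr (- \<alpha>) * (real (2 * m) - real m) / (\<alpha> * C1 * real (2 * m))"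
    using assms by simp
  also have "\<dots> \<le> \<kappa> m - \<kappa> (2 * m)" using assms by (intro diff_ge) auto
  finally show ?thesis using pos[of "2 * m"] assms by simp
qed

lemma inverse_kappa_le:
  assumes "1 \<le> m"
  shows "1 / \<kappa> m \<le> 2 * \<alpha> * C1 * real m powr \<alpha>"
proof -
  have p: "0 < real m powr (- \<alpha>) / (2 * \<alpha> * C1)" using alpha C1 assms by simp
  have "inverse (\<kappa> m) \<le> inverse (real m powr (- \<alpha>) / (2 * \<alpha> * C1))"
    by (rule le_imp_inverse_le[OF kappa_ge[OF assms] p])
  also have "\<dots> = 2 * \<alpha> * C1 * real m powr \<alpha>"
    unfolding powr_minus inverse_divide by (simp only: divide_inverse inverse_inverse_eq)
  finally show ?thesis by (simp only: inverse_eq_divide)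
qed

text \<open>By monotonicity the nearest other eigenvalue is a neighbour, and among the first \<open>m\<close> indices
  the assumed lower bound for the gaps is smallest at \<open>m\<close>.\<close>
lemma min_gap:
  assumes "1 \<le> j" "j \<le> m" "1 \<le> l" "l \<noteq> j"
  shows "real m powr (- \<alpha> - 1) / C1 \<le> \<bar>\<kappa> l - \<kappa> j\<bar>"
proof -
  have mono: "real m powr (- \<alpha> - 1) / C1 \<le> inverse C1 * real i powr (- \<alpha> - 1)" if "1 \<le> i" "i \<le> m" for i
    using that alpha C1 by (simp add: divide_inverse mult.commute powr_mono2')
  show ?thesis
  proof (cases "l < j")
    case True
    with decreasing[of "Suc l" j] gap[of l] mono[of l] assms show ?thesis by auto
  next
    case False
    with decreasing[of "Suc j" l] gap[of j] mono[of j] assms show ?thesis by auto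
  qed
qed

definition weight_const :: real where
  "weight_const = 2 * \<alpha>\<^sup>2 * C1 ^ 4 * (zeta_sum (min \<alpha> 2) + 2 * zeta_sum 2)"

lemma weight_const_nonneg: "0 \<le> weight_const"
  unfolding weight_const_def using C1
  using alpha by (intro mult_nonneg_nonneg add_nonneg_nonneg zeta_sum_nonneg) auto

text \<open>When the entry \<open>(l, j)\<close> of the empirical covariance has variance of order \<open>\<kappa> l * \<kappa> j / n\<close>, the
  mean squared error of the \<open>j\<close>-th empirical eigenfunction is of the order of this sum over \<open>n\<close>.
  Inserting \<open>diff_ge\<close>, the indices near \<open>j\<close> contribute \<open>j\<^sup>2\<close> times an inverse square of the distance;
  the distant larger ones a convergent power sum.\<close>

lemma weight_sum_le:
  assumes j: "1 \<le> j"
  shows "(\<Sum>l\<in>{1..N} - {j}. \<kappa> l * \<kappa> j / (\<kappa> l - \<kappa> j)\<^sup>2) \<le> weight_const * (real j)\<^sup>2"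
proof -
  \<comment> \<open>capping the exponent at 2 bounds \<open>j powr p\<close> by \<open>j\<^sup>2\<close> and keeps the series over \<open>l\<close> convergent\<close>
  define p where "p = min \<alpha> 2"
  have p: "1 < p" "p \<le> \<alpha>" "p \<le> 2" using alpha by (auto simp: p_def)
  \<comment> \<open>the summand is symmetric, so \<open>i < k\<close> stands for the smaller and the larger index\<close>
  have upper: "\<kappa> l * \<kappa> j / (\<kappa> l - \<kappa> j)\<^sup>2 \<le> \<alpha>\<^sup>2 * C1 ^ 4 * ((real i / real k) powr \<alpha> * (real k)\<^sup>2 / (real k - real i)\<^sup>2)"
    if "1 \<le> i" "i < k" "(l = i \<and> j = k) \<or> (l = k \<and> j = i)" for l i k
  proof -
    have ik: "0 < real i" "0 < real k" "0 < real k - real i" using that by auto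
    have g: "0 < real i powr (- \<alpha>) * (real k - real i) / (\<alpha> * C1 * real k)"
      using ik alpha C1 by auto
    have "\<kappa> l * \<kappa> j / (\<kappa> l - \<kappa> j)\<^sup>2 = \<kappa> i * \<kappa> k / (\<kappa> i - \<kappa> k)\<^sup>2"
      using that(3) by (auto simp: power2_commute)
    also have "\<dots> \<le> (C1 * real i powr (- \<alpha>)) * (C1 * real k powr (- \<alpha>))
        / (real i powr (- \<alpha>) * (real k - real i) / (\<alpha> * C1 * real k))\<^sup>2"
      using g diff_ge[of i k] that pos[of i] pos[of k] decay[of i] decay[of k] C1
      by (intro frac_le mult_mono power_mono mult_nonneg_nonneg) (auto intro!: zero_less_power)
    also have "\<dots> = \<alpha>\<^sup>2 * C1 ^ 4 * ((real k powr (- \<alpha>) / real i powr (- \<alpha>)) * (real k)\<^sup>2 / (real k - real i)\<^sup>2)"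
    proof -
      have "(C1 * A) * (C1 * B) / (A * d / (\<alpha> * C1 * r))\<^sup>2 = \<alpha>\<^sup>2 * C1 ^ 4 * ((B / A) * r\<^sup>2 / d\<^sup>2)"
        if "0 < A" "0 < d" "0 < r" for A B d r :: real
        using that alpha C1 by (simp add: power2_eq_square power4_eq_xxxx divide_simps)
      from this[of "real i powr (- \<alpha>)" "real k - real i" "real k"] show ?thesis using ik by simp
    qed
    also have "real k powr (- \<alpha>) / real i powr (- \<alpha>) = (real i / real k) powr \<alpha>"
      using ik by (simp add: powr_divide powr_minus field_simps)
    finally show ?thesis .
  qed
  have each: "\<kappa> l * \<kappa> j / (\<kappa> l - \<kappa> j)\<^sup>2
      \<le> 2 * \<alpha>\<^sup>2 * C1 ^ 4 * (real j)\<^sup>2 * (real l powr (- p) + 1 / (real l - real j)\<^sup>2)"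
    if l: "1 \<le> l" "l \<noteq> j" for l
  proof (cases "l < j")
    case True
    have "(real l / real j) powr \<alpha> \<le> 1" using True l alpha by (intro powr_le1) auto
    then have "(real l / real j) powr \<alpha> * (real j)\<^sup>2 / (real j - real l)\<^sup>2 \<le> 1 * (real j)\<^sup>2 / (real j - real l)\<^sup>2"
      by (intro divide_right_mono mult_right_mono) auto
    also have "\<dots> \<le> 2 * (real j)\<^sup>2 * (real l powr (- p) + 1 / (real l - real j)\<^sup>2)"
    proof -
      have "a / d \<le> 2 * a * (b + 1 / d)" if "0 \<le> a" "0 \<le> b" "0 \<le> d" for a b d :: real
      proof -
        have "0 \<le> 2 * a * b" "0 \<le> a / d" using that by auto
        then show ?thesis by (simp add: distrib_left)
      qed
      from this[of "(real j)\<^sup>2" "real l powr (- p)" "(real j - real l)\<^sup>2"] show ?thesis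
        by (simp add: power2_commute[of "real l"])
    qed
    finally have "(real l / real j) powr \<alpha> * (real j)\<^sup>2 / (real j - real l)\<^sup>2
       \<le> 2 * (real j)\<^sup>2 * (real l powr (- p) + 1 / (real l - real j)\<^sup>2)" .
    then have "\<alpha>\<^sup>2 * C1 ^ 4 * ((real l / real j) powr \<alpha> * (real j)\<^sup>2 / (real j - real l)\<^sup>2)
        \<le> \<alpha>\<^sup>2 * C1 ^ 4 * (2 * (real j)\<^sup>2 * (real l powr (- p) + 1 / (real l - real j)\<^sup>2))"
      using C1 by (intro mult_left_mono) auto
    also have "\<dots> = 2 * \<alpha>\<^sup>2 * C1 ^ 4 * (real j)\<^sup>2 * (real l powr (- p) + 1 / (real l - real j)\<^sup>2)"
      by (simp only: ac_simps)
    finally show ?thesis using upper[of l j l] True l by (auto intro: order_trans)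
  next
    case False
    then have lj: "j < l" "0 < real l - real j" "0 < real j" using l j by auto
    have "(real j / real l) powr \<alpha> * (real l)\<^sup>2 / (real l - real j)\<^sup>2
        \<le> (real j / real l) powr \<alpha> * (2 * (real l - real j)\<^sup>2 + 2 * (real j)\<^sup>2) / (real l - real j)\<^sup>2"
      using sum_power2_le_twice[of "real l - real j" "real j"]
      by (intro divide_right_mono mult_left_mono) auto
    also have "\<dots> = 2 * (real j / real l) powr \<alpha> + 2 * (real j / real l) powr \<alpha> * ((real j)\<^sup>2 / (real l - real j)\<^sup>2)"
      using lj by (simp add: field_simps)
    also have "\<dots> \<le> 2 * ((real j)\<^sup>2 * real l powr (- p)) + 2 * 1 * ((real j)\<^sup>2 / (real l - real j)\<^sup>2)"
    proof (intro add_mono mult_mono)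
      have "(real j / real l) powr \<alpha> \<le> (real j / real l) powr p"
        using lj p j by (intro powr_mono') auto
      also have "\<dots> = real j powr p * real l powr (- p)" using lj by (simp add: powr_divide powr_minus_divide)
      also have "\<dots> \<le> real j powr 2 * real l powr (- p)"
        using j p by (intro mult_right_mono powr_mono) auto
      finally show "(real j / real l) powr \<alpha> \<le> (real j)\<^sup>2 * real l powr (- p)"
        using lj by (simp add: powr_numeral)
      show "(real j / real l) powr \<alpha> \<le> 1" using lj alpha by (intro powr_le1) auto
    qed auto
    also have "\<dots> = 2 * (real j)\<^sup>2 * (real l powr (- p) + 1 / (real l - real j)\<^sup>2)"
      by (simp add: algebra_simps)
    finally have "(real j / real l) powr \<alpha> * (real l)\<^sup>2 / (real l - real j)\<^sup>2
       \<le> 2 * (real j)\<^sup>2 * (real l powr (- p) + 1 / (real l - real j)\<^sup>2)" .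
    then have "\<alpha>\<^sup>2 * C1 ^ 4 * ((real j / real l) powr \<alpha> * (real l)\<^sup>2 / (real l - real j)\<^sup>2)
        \<le> \<alpha>\<^sup>2 * C1 ^ 4 * (2 * (real j)\<^sup>2 * (real l powr (- p) + 1 / (real l - real j)\<^sup>2))"
      using C1 by (intro mult_left_mono) auto
    also have "\<dots> = 2 * \<alpha>\<^sup>2 * C1 ^ 4 * (real j)\<^sup>2 * (real l powr (- p) + 1 / (real l - real j)\<^sup>2)"
      by (simp only: ac_simps)
    finally show ?thesis using upper[of j l l] lj j by (auto intro: order_trans)
  qed
  have "(\<Sum>l\<in>{1..N} - {j}. 1 / (real l - real j)\<^sup>2) \<le> 2 * zeta_sum 2"
  proof -
    have "(\<Sum>l\<in>{1..N} - {j}. 1 / (real l - real j)\<^sup>2)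
        = (\<Sum>l\<in>{1..N} \<inter> {..<j}. 1 / (real l - real j)\<^sup>2) + (\<Sum>l\<in>{1..N} \<inter> {j<..}. 1 / (real l - real j)\<^sup>2)"
      by (subst sum.union_disjoint[symmetric]) (auto intro!: sum.cong)
    also have "(\<Sum>l\<in>{1..N} \<inter> {..<j}. 1 / (real l - real j)\<^sup>2) = (\<Sum>k\<in>(\<lambda>l. j - l) ` ({1..N} \<inter> {..<j}). real k powr (- 2))"
      by (subst sum.reindex)
        (auto simp: inj_on_def powr_minus powr_numeral of_nat_diff divide_inverse power2_commute intro!: sum.cong)
    also have "\<dots> \<le> zeta_sum 2" by (intro sum_powr_le_zeta_sum) auto
    also have "(\<Sum>l\<in>{1..N} \<inter> {j<..}. 1 / (real l - real j)\<^sup>2) = (\<Sum>k\<in>(\<lambda>l. l - j) ` ({1..N} \<inter> {j<..}). real k powr (- 2))"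
      by (subst sum.reindex)
        (auto simp: inj_on_def powr_minus powr_numeral of_nat_diff divide_inverse intro!: sum.cong)
    also have "\<dots> \<le> zeta_sum 2" by (intro sum_powr_le_zeta_sum) auto
    finally show ?thesis by simp
  qed
  moreover have "(\<Sum>l\<in>{1..N} - {j}. real l powr (- p)) \<le> zeta_sum p"
    using p by (intro sum_powr_le_zeta_sum) auto
  ultimately have "2 * \<alpha>\<^sup>2 * C1 ^ 4 * (real j)\<^sup>2 * (\<Sum>l\<in>{1..N} - {j}. real l powr (- p) + 1 / (real l - real j)\<^sup>2)
      \<le> 2 * \<alpha>\<^sup>2 * C1 ^ 4 * (real j)\<^sup>2 * (zeta_sum p + 2 * zeta_sum 2)"
    using C1 by (intro mult_left_mono) (auto simp: sum.distrib)
  moreover have "(\<Sum>l\<in>{1..N} - {j}. \<kappa> l * \<kappa> j / (\<kappa> l - \<kappa> j)\<^sup>2)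
      \<le> 2 * \<alpha>\<^sup>2 * C1 ^ 4 * (real j)\<^sup>2 * (\<Sum>l\<in>{1..N} - {j}. real l powr (- p) + 1 / (real l - real j)\<^sup>2)"
    unfolding sum_distrib_left by (intro sum_mono each) auto
  ultimately show ?thesis
    unfolding weight_const_def p_def[symmetric] by (simp only: ac_simps)
qed

end

section \<open>Truncated expansions of a kernel\<close>

lemma finite_measure_unit_I: "finite_measure unit_I"
  by (rule finite_measureI) (simp add: emeasure_restrict_space space_restrict_space)

lemma sigma_finite_unit_I: "sigma_finite_measure unit_I"
  using finite_measure_unit_I by (simp add: finite_measure_def)

text \<open>Completeness of the tensor basis in the form used below: a uniform bound for the finite
  rectangular sums of squared coefficients bounds the norm.\<close>
lemma kernel_l2norm_power2_le:
  assumes sf: "sigma_finite_measure \<mu>" "sigma_finite_measure \<nu>"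
    and onb: "L2_onb \<mu> \<phi>" "L2_onb \<nu> \<psi>" and T: "T \<in> L2 (\<mu> \<Otimes>\<^sub>M \<nu>)"
    and bound: "\<And>N N'. (\<Sum>k=1..N. \<Sum>j=1..N'. (l2inner (\<mu> \<Otimes>\<^sub>M \<nu>) T (tensor (\<phi> j) (\<psi> k)))\<^sup>2) \<le> B"
  shows "(l2norm (\<mu> \<Otimes>\<^sub>M \<nu>) T)\<^sup>2 \<le> B"
proof -
  have B: "0 \<le> B" using bound[of 0 0] by simp
  have L: "slice \<nu> T (\<psi> k) \<in> L2 \<mu>" if "1 \<le> k" for k
    using L2_onb_in_L2[OF onb(2) that] by (intro slice_in_L2[OF sf T])
  have "(\<Sum>k=1..N. (l2norm \<mu> (slice \<nu> T (\<psi> k)))\<^sup>2) \<le> B" for N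
  proof (rule LIMSEQ_le_const2)
    show "(\<lambda>N'. \<Sum>k=1..N. \<Sum>j=1..N'. (l2inner \<mu> (slice \<nu> T (\<psi> k)) (\<phi> j))\<^sup>2)
        \<longlonglongrightarrow> (\<Sum>k=1..N. (l2norm \<mu> (slice \<nu> T (\<psi> k)))\<^sup>2)"
      by (intro tendsto_sum L2_onb_Parseval_LIMSEQ onb L) simp
    have "(\<Sum>k=1..N. \<Sum>j=1..N'. (l2inner \<mu> (slice \<nu> T (\<psi> k)) (\<phi> j))\<^sup>2)
        = (\<Sum>k=1..N. \<Sum>j=1..N'. (l2inner (\<mu> \<Otimes>\<^sub>M \<nu>) T (tensor (\<phi> j) (\<psi> k)))\<^sup>2)" for N'
      by (intro sum.cong refl) (simp add: l2inner_slice[OF sf T] L2_onb_in_L2[OF onb(1)] L2_onb_in_L2[OF onb(2)])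
    then show "\<exists>M. \<forall>N'\<ge>M. (\<Sum>k=1..N. \<Sum>j=1..N'. (l2inner \<mu> (slice \<nu> T (\<psi> k)) (\<phi> j))\<^sup>2) \<le> B"
      using bound by auto
  qed
  moreover have "(\<Sum>k<N. ennreal ((l2norm \<mu> (slice \<nu> T (\<psi> (Suc k))))\<^sup>2))
      = ennreal (\<Sum>k=1..N. (l2norm \<mu> (slice \<nu> T (\<psi> k)))\<^sup>2)" for N
    by (subst sum_ennreal) (simp_all add: sum.atLeast1_atMost_eq)
  ultimately have "(\<Sum>k. ennreal ((l2norm \<mu> (slice \<nu> T (\<psi> (Suc k))))\<^sup>2)) \<le> ennreal B"
    unfolding suminf_eq_SUP by (intro SUP_least) (simp add: ennreal_leI)
  then show ?thesis
    using B by (simp add: L2_onb_tensor_Parseval_ennreal(1)[OF sf onb T])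
qed

definition kernel_proj ::
  "'a measure \<Rightarrow> nat \<Rightarrow> nat \<Rightarrow> (nat \<Rightarrow> 'a \<Rightarrow> real) \<Rightarrow> ('a \<times> 'a \<Rightarrow> real) \<Rightarrow> 'a \<times> 'a \<Rightarrow> real" where
  "kernel_proj \<mu> m1 m2 \<phi> T = (\<lambda>p. \<Sum>(j, k)\<in>{1..m1} \<times> {1..m2}.
     l2inner (\<mu> \<Otimes>\<^sub>M \<mu>) T (tensor (\<phi> j) (\<phi> k)) * tensor (\<phi> j) (\<phi> k) p)"

text \<open>For orthonormal systems this is the sine of the angle between the \<open>j\<close>-th basis functions;
  unlike the distance it does not depend on their signs.\<close>
definition eigen_dev ::
  "'a measure \<Rightarrow> (nat \<Rightarrow> 'a \<Rightarrow> real) \<Rightarrow> (nat \<Rightarrow> 'a \<Rightarrow> real) \<Rightarrow> nat \<Rightarrow> real" where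
  "eigen_dev \<mu> \<phi> \<phi>' j = l2norm \<mu> (\<lambda>x. \<phi>' j x - l2inner \<mu> (\<phi>' j) (\<phi> j) * \<phi> j x)"

lemma eigen_dev_nonneg: "0 \<le> eigen_dev \<mu> \<phi> \<phi>' j"
  by (simp add: eigen_dev_def)

context
  fixes \<mu> :: "'a measure"
  assumes sf: "sigma_finite_measure \<mu>"
begin

lemma onb_tensor_orthonormal:
  "L2_onb \<mu> \<phi> \<Longrightarrow> orthonormal_on (\<mu> \<Otimes>\<^sub>M \<mu>) ({1..m1} \<times> {1..m2}) (\<lambda>(j, k). tensor (\<phi> j) (\<phi> k))"
  by (intro orthonormal_on_tensor sf L2_onb_orthonormal_atMost)

lemma kernel_proj_in_L2: "L2_onb \<mu> \<phi> \<Longrightarrow> kernel_proj \<mu> m1 m2 \<phi> T \<in> L2 (\<mu> \<Otimes>\<^sub>M \<mu>)"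
  unfolding kernel_proj_def
  by (intro L2_sum) (auto intro!: L2_scale tensor_in_L2 sf simp: L2_onb_in_L2)

lemma kernel_proj_residual_le:
  assumes "L2_onb \<mu> \<phi>" "T \<in> L2 (\<mu> \<Otimes>\<^sub>M \<mu>)"
  shows "l2norm (\<mu> \<Otimes>\<^sub>M \<mu>) (\<lambda>p. T p - kernel_proj \<mu> m1 m2 \<phi> T p) \<le> l2norm (\<mu> \<Otimes>\<^sub>M \<mu>) T"
  using l2norm_orthonormal_residual_le[OF _ onb_tensor_orthonormal[OF assms(1)] assms(2), of m1 m2]
  by (simp add: kernel_proj_def case_prod_unfold)

lemma kernel_proj_residual:
  assumes "L2_onb \<mu> \<phi>" "T \<in> L2 (\<mu> \<Otimes>\<^sub>M \<mu>)"
  shows "(l2norm (\<mu> \<Otimes>\<^sub>M \<mu>) (\<lambda>p. T p - kernel_proj \<mu> m1 m2 \<phi> T p))\<^sup>2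
    = (l2norm (\<mu> \<Otimes>\<^sub>M \<mu>) T)\<^sup>2
      - (\<Sum>(j, k)\<in>{1..m1} \<times> {1..m2}. (l2inner (\<mu> \<Otimes>\<^sub>M \<mu>) T (tensor (\<phi> j) (\<phi> k)))\<^sup>2)"
  using l2norm_orthonormal_residual[OF _ onb_tensor_orthonormal[OF assms(1)] assms(2), of m1 m2]
  by (simp add: kernel_proj_def case_prod_unfold)

text \<open>What remains has coefficients only outside the rectangle, that is, with a large first or a
  large second index; each of the two families is a tail of one power sum times a full one.\<close>
lemma truncation_error:
  assumes onb: "L2_onb \<mu> \<phi>" and T: "T \<in> L2 (\<mu> \<Otimes>\<^sub>M \<mu>)"
    and dec: "\<And>j k. 1 \<le> j \<Longrightarrow> 1 \<le> k \<Longrightarrow>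
      \<bar>l2inner (\<mu> \<Otimes>\<^sub>M \<mu>) T (tensor (\<phi> j) (\<phi> k))\<bar> \<le> C * real j powr (- \<gamma>) * real k powr (- \<beta>)"
    and exps: "1 / 2 < \<gamma>" "1 / 2 < \<beta>" and m: "1 \<le> m1" "1 \<le> m2"
  shows "(l2norm (\<mu> \<Otimes>\<^sub>M \<mu>) (\<lambda>p. T p - kernel_proj \<mu> m1 m2 \<phi> T p))\<^sup>2
    \<le> C\<^sup>2 * (zeta_sum (2 * \<gamma>) / (2 * \<beta> - 1) * real m2 powr (- 2 * \<beta> + 1)
          + zeta_sum (2 * \<beta>) / (2 * \<gamma> - 1) * real m1 powr (- 2 * \<gamma> + 1))"
proof -
  let ?\<mu>2 = "\<mu> \<Otimes>\<^sub>M \<mu>"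
  let ?r = "\<lambda>p. T p - kernel_proj \<mu> m1 m2 \<phi> T p"
  note \<phi> = L2_onb_in_L2[OF onb]
  have r: "?r \<in> L2 ?\<mu>2" by (intro L2_diff T kernel_proj_in_L2 onb)
  have coef: "l2inner ?\<mu>2 ?r (tensor (\<phi> j) (\<phi> k))
      = (if j \<le> m1 \<and> k \<le> m2 then 0 else l2inner ?\<mu>2 T (tensor (\<phi> j) (\<phi> k)))"
    if jk: "1 \<le> j" "1 \<le> k" for j k
  proof -
    let ?c = "\<lambda>i. l2inner ?\<mu>2 T (tensor (\<phi> (fst i)) (\<phi> (snd i)))"
    have "l2inner ?\<mu>2 (kernel_proj \<mu> m1 m2 \<phi> T) (tensor (\<phi> j) (\<phi> k))
        = (\<Sum>i\<in>{1..m1} \<times> {1..m2}. ?c i * l2inner ?\<mu>2 (tensor (\<phi> (fst i)) (\<phi> (snd i))) (tensor (\<phi> j) (\<phi> k)))"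
      unfolding kernel_proj_def case_prod_unfold
      using \<phi> jk sf by (subst l2inner_lincomb_left) (auto intro!: tensor_in_L2)
    also have "\<dots> = (\<Sum>i\<in>{1..m1} \<times> {1..m2}. if i = (j, k) then ?c i else 0)"
      using \<phi> jk sf onb
      by (intro sum.cong) (auto simp: l2inner_tensor_tensor L2_onb_inner split: if_splits)
    finally show ?thesis
      using T kernel_proj_in_L2[OF onb] tensor_in_L2[OF sf sf \<phi> \<phi>] jk
      by (simp add: l2inner_diff_left)
  qed
  have sq: "(real i powr (- a))\<^sup>2 = real i powr (- (2 * a))" for i a
    by (simp add: power2_eq_square powr_add[symmetric])
  show ?thesis
  proof (rule kernel_l2norm_power2_le[OF sf sf onb onb r])
    fix N N'
    let ?g = "\<lambda>j. real j powr (- (2 * \<gamma>))" and ?b = "\<lambda>k. real k powr (- (2 * \<beta>))"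
    have "(\<Sum>k=1..N. \<Sum>j=1..N'. (l2inner ?\<mu>2 ?r (tensor (\<phi> j) (\<phi> k)))\<^sup>2)
        \<le> (\<Sum>k=1..N. \<Sum>j=1..N'. C\<^sup>2 * ((if m2 < k then ?b k else 0) * ?g j + ?b k * (if m1 < j then ?g j else 0)))"
    proof (intro sum_mono)
      fix k j assume jk: "k \<in> {1..N}" "j \<in> {1..N'}"
      have "(l2inner ?\<mu>2 T (tensor (\<phi> j) (\<phi> k)))\<^sup>2 \<le> (C * real j powr (- \<gamma>) * real k powr (- \<beta>))\<^sup>2"
        using power_mono[OF dec[of j k] abs_ge_zero, of 2] jk by simp
      also have "\<dots> = C\<^sup>2 * (?b k * ?g j)" by (simp add: power_mult_distrib sq mult.commute)
      finally show "(l2inner ?\<mu>2 ?r (tensor (\<phi> j) (\<phi> k)))\<^sup>2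
          \<le> C\<^sup>2 * ((if m2 < k then ?b k else 0) * ?g j + ?b k * (if m1 < j then ?g j else 0))"
        using jk by (auto simp: coef distrib_left intro: order_trans)
    qed
    also have "\<dots> = C\<^sup>2 * ((\<Sum>k=1..N. if m2 < k then ?b k else 0) * (\<Sum>j=1..N'. ?g j)
        + (\<Sum>k=1..N. ?b k) * (\<Sum>j=1..N'. if m1 < j then ?g j else 0))"
      by (simp only: sum_product) (simp only: sum_distrib_left sum.distrib distrib_left)
    also have "(\<Sum>k=1..N. if m2 < k then ?b k else 0) = (\<Sum>k\<in>{m2<..N}. ?b k)"
      using m by (subst sum.inter_filter[symmetric]) (auto intro!: sum.cong)
    also have "(\<Sum>j=1..N'. if m1 < j then ?g j else 0) = (\<Sum>j\<in>{m1<..N'}. ?g j)"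
      using m by (subst sum.inter_filter[symmetric]) (auto intro!: sum.cong)
    also have "C\<^sup>2 * ((\<Sum>k\<in>{m2<..N}. ?b k) * (\<Sum>j=1..N'. ?g j) + (\<Sum>k=1..N. ?b k) * (\<Sum>j\<in>{m1<..N'}. ?g j))
        \<le> C\<^sup>2 * (real m2 powr (1 - 2 * \<beta>) / (2 * \<beta> - 1) * zeta_sum (2 * \<gamma>)
            + zeta_sum (2 * \<beta>) * (real m1 powr (1 - 2 * \<gamma>) / (2 * \<gamma> - 1)))"
      using exps m
      by (intro mult_left_mono add_mono mult_mono sum_powr_tail_le sum_powr_le_zeta_sum sum_nonneg zeta_sum_nonneg)
         auto
    finally show "(\<Sum>k=1..N. \<Sum>j=1..N'. (l2inner ?\<mu>2 ?r (tensor (\<phi> j) (\<phi> k)))\<^sup>2)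
        \<le> C\<^sup>2 * (zeta_sum (2 * \<gamma>) / (2 * \<beta> - 1) * real m2 powr (- 2 * \<beta> + 1)
          + zeta_sum (2 * \<beta>) / (2 * \<gamma> - 1) * real m1 powr (- 2 * \<gamma> + 1))"
      by (simp add: mult.commute add.commute)
  qed
qed

lemma eigen_dev_power2:
  assumes "L2_onb \<mu> \<phi>" "L2_onb \<mu> \<phi>'" "1 \<le> j"
  shows "(eigen_dev \<mu> \<phi> \<phi>' j)\<^sup>2 = 1 - (l2inner \<mu> (\<phi>' j) (\<phi> j))\<^sup>2"
proof -
  have "orthonormal_on \<mu> {j} \<phi>"
    by (rule orthonormal_on_subset[OF L2_onb_orthonormal[OF assms(1)]]) (use assms in auto)
  from l2norm_orthonormal_residual[OF _ this L2_onb_in_L2[OF assms(2,3)]] show ?thesis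
    using assms by (simp add: eigen_dev_def L2_onb_l2norm)
qed

text \<open>With \<open>p\<close> and \<open>q\<close> the squared cosines of the two angles, the squared error is at most
  \<open>1 - p * q \<le> (1 - p) + (1 - q)\<close>.\<close>
lemma tensor_projection_error:
  assumes onb: "L2_onb \<mu> \<phi>" "L2_onb \<mu> \<phi>'" and j: "1 \<le> j" "j \<le> m1" and k: "1 \<le> k" "k \<le> m2"
  shows "l2norm (\<mu> \<Otimes>\<^sub>M \<mu>) (\<lambda>p. tensor (\<phi> j) (\<phi> k) p - kernel_proj \<mu> m1 m2 \<phi>' (tensor (\<phi> j) (\<phi> k)) p)
    \<le> eigen_dev \<mu> \<phi> \<phi>' j + eigen_dev \<mu> \<phi> \<phi>' k"
proof (rule power2_le_imp_le)
  let ?\<mu>2 = "\<mu> \<Otimes>\<^sub>M \<mu>"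
  note \<phi> = L2_onb_in_L2[OF onb(1)] L2_onb_in_L2[OF onb(2)]
  let ?p = "\<lambda>j. (l2inner \<mu> (\<phi>' j) (\<phi> j))\<^sup>2"
  have t: "tensor (\<phi> j) (\<phi> k) \<in> L2 ?\<mu>2" using \<phi> j k by (intro tensor_in_L2 sf)
  have in01: "0 \<le> ?p j" "?p j \<le> 1" if "1 \<le> j" for j
    using eigen_dev_power2[OF onb that] zero_le_power2[of "eigen_dev \<mu> \<phi> \<phi>' j"] by (auto simp del: zero_le_power2)
  have "(\<Sum>i\<in>{(j, k)}. (l2inner ?\<mu>2 (tensor (\<phi> j) (\<phi> k)) (tensor (\<phi>' (fst i)) (\<phi>' (snd i))))\<^sup>2)
      \<le> (\<Sum>i\<in>{1..m1} \<times> {1..m2}. (l2inner ?\<mu>2 (tensor (\<phi> j) (\<phi> k)) (tensor (\<phi>' (fst i)) (\<phi>' (snd i))))\<^sup>2)"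
    using j k by (intro sum_mono2) auto
  moreover have "(l2norm ?\<mu>2 (tensor (\<phi> j) (\<phi> k)))\<^sup>2 = 1"
    using \<phi> j k onb by (simp add: l2norm_tensor[OF sf sf] L2_onb_l2norm)
  moreover have "l2inner ?\<mu>2 (tensor (\<phi> j) (\<phi> k)) (tensor (\<phi>' j) (\<phi>' k))
      = l2inner \<mu> (\<phi>' j) (\<phi> j) * l2inner \<mu> (\<phi>' k) (\<phi> k)"
    using \<phi> j k by (simp add: l2inner_tensor_tensor[OF sf sf] l2inner_commute)
  ultimately have "(l2norm ?\<mu>2 (\<lambda>p. tensor (\<phi> j) (\<phi> k) p - kernel_proj \<mu> m1 m2 \<phi>' (tensor (\<phi> j) (\<phi> k)) p))\<^sup>2
      \<le> 1 - ?p j * ?p k"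
    by (simp add: kernel_proj_residual[OF onb(2) t] case_prod_unfold power_mult_distrib)
  also have "\<dots> \<le> (1 - ?p j) + (1 - ?p k)"
    using mult_nonneg_nonneg[of "1 - ?p j" "1 - ?p k"] in01 j k by (simp add: algebra_simps)
  also have "\<dots> = (eigen_dev \<mu> \<phi> \<phi>' j)\<^sup>2 + (eigen_dev \<mu> \<phi> \<phi>' k)\<^sup>2"
    using onb j k by (simp add: eigen_dev_power2)
  also have "\<dots> \<le> (eigen_dev \<mu> \<phi> \<phi>' j + eigen_dev \<mu> \<phi> \<phi>' k)\<^sup>2"
    by (simp add: power2_sum eigen_dev_nonneg)
  finally show "(l2norm ?\<mu>2 (\<lambda>p. tensor (\<phi> j) (\<phi> k) p - kernel_proj \<mu> m1 m2 \<phi>' (tensor (\<phi> j) (\<phi> k)) p))\<^sup>2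
      \<le> (eigen_dev \<mu> \<phi> \<phi>' j + eigen_dev \<mu> \<phi> \<phi>' k)\<^sup>2" .
qed (simp add: eigen_dev_nonneg)

lemma kernel_proj_linear:
  assumes "L2_onb \<mu> \<phi>" "finite A" "\<And>i. i \<in> A \<Longrightarrow> T i \<in> L2 (\<mu> \<Otimes>\<^sub>M \<mu>)"
  shows "kernel_proj \<mu> m1 m2 \<phi> (\<lambda>p. \<Sum>i\<in>A. c i * T i p) p = (\<Sum>i\<in>A. c i * kernel_proj \<mu> m1 m2 \<phi> (T i) p)"
proof -
  have "l2inner (\<mu> \<Otimes>\<^sub>M \<mu>) (\<lambda>p. \<Sum>i\<in>A. c i * T i p) (tensor (\<phi> j) (\<phi> k))
      = (\<Sum>i\<in>A. c i * l2inner (\<mu> \<Otimes>\<^sub>M \<mu>) (T i) (tensor (\<phi> j) (\<phi> k)))" if "1 \<le> j" "1 \<le> k" for j k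
    using that assms
    by (intro l2inner_lincomb_left tensor_in_L2 sf L2_onb_in_L2[OF assms(1)]) auto
  then have "kernel_proj \<mu> m1 m2 \<phi> (\<lambda>p. \<Sum>i\<in>A. c i * T i p) p
    = (\<Sum>(j, k)\<in>{1..m1} \<times> {1..m2}. (\<Sum>i\<in>A. c i * l2inner (\<mu> \<Otimes>\<^sub>M \<mu>) (T i) (tensor (\<phi> j) (\<phi> k))) * tensor (\<phi> j) (\<phi> k) p)"
    unfolding kernel_proj_def by (intro sum.cong) auto
  also have "\<dots> = (\<Sum>i\<in>A. c i * kernel_proj \<mu> m1 m2 \<phi> (T i) p)"
    unfolding kernel_proj_def case_prod_unfold sum_distrib_left sum_distrib_right
    by (subst sum.swap) (simp add: mult.assoc)
  finally show ?thesis .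
qed

text \<open>The remainder of the expansion of \<open>T\<close> in the exact basis is not increased by projecting;
  on the leading part the error of the empirical projection is bounded term by term.\<close>

lemma projection_error:
  assumes onb: "L2_onb \<mu> \<phi>" "L2_onb \<mu> \<phi>'" and T: "T \<in> L2 (\<mu> \<Otimes>\<^sub>M \<mu>)"
  shows "l2norm (\<mu> \<Otimes>\<^sub>M \<mu>) (\<lambda>p. T p - kernel_proj \<mu> m1 m2 \<phi>' T p)
    \<le> l2norm (\<mu> \<Otimes>\<^sub>M \<mu>) (\<lambda>p. T p - kernel_proj \<mu> m1 m2 \<phi> T p)
      + (\<Sum>j=1..m1. \<Sum>k=1..m2. \<bar>l2inner (\<mu> \<Otimes>\<^sub>M \<mu>) T (tensor (\<phi> j) (\<phi> k))\<bar> * (eigen_dev \<mu> \<phi> \<phi>' j + eigen_dev \<mu> \<phi> \<phi>' k))"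
proof -
  let ?\<mu>2 = "\<mu> \<Otimes>\<^sub>M \<mu>"
  let ?A = "{1..m1} \<times> {1..m2}"
  let ?t = "\<lambda>i. tensor (\<phi> (fst i)) (\<phi> (snd i))"
  let ?c = "\<lambda>i. l2inner ?\<mu>2 T (?t i)"
  define P where "P = kernel_proj \<mu> m1 m2 \<phi>'"
  define s where "s = kernel_proj \<mu> m1 m2 \<phi> T"
  define r where "r = (\<lambda>p. T p - s p)"
  have s: "s \<in> L2 ?\<mu>2" unfolding s_def by (rule kernel_proj_in_L2[OF onb(1)])
  have r: "r \<in> L2 ?\<mu>2" unfolding r_def by (intro L2_diff T s)
  have P: "P f \<in> L2 ?\<mu>2" for f unfolding P_def by (rule kernel_proj_in_L2[OF onb(2)])
  have t: "?t i \<in> L2 ?\<mu>2" if "i \<in> ?A" for i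
    using that by (auto intro!: tensor_in_L2 sf L2_onb_in_L2[OF onb(1)])
  have s_sum: "s = (\<lambda>p. \<Sum>i\<in>?A. ?c i * ?t i p)" by (simp add: s_def kernel_proj_def case_prod_unfold)
  have "T = (\<lambda>p. \<Sum>i\<in>{True, False}. 1 * (if i then r else s) p)" by (simp add: r_def)
  then have PT: "P T p = P r p + P s p" for p
    using kernel_proj_linear[OF onb(2), of "{True, False}" "\<lambda>i. if i then r else s" m1 m2 "\<lambda>_. 1" p] r s
    by (simp add: P_def)
  have Ps: "P s p = (\<Sum>i\<in>?A. ?c i * P (?t i) p)" for p
    unfolding s_sum P_def by (rule kernel_proj_linear[OF onb(2)]) (use t in auto)
  have "(\<lambda>p. T p - P T p) = (\<lambda>p. (r p - P r p) + (\<Sum>i\<in>?A. ?c i * (?t i p - P (?t i) p)))"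
    by (rule ext) (simp add: PT Ps r_def fun_cong[OF s_sum] right_diff_distrib sum_subtractf)
  then have "l2norm ?\<mu>2 (\<lambda>p. T p - P T p)
      \<le> l2norm ?\<mu>2 (\<lambda>p. r p - P r p) + l2norm ?\<mu>2 (\<lambda>p. \<Sum>i\<in>?A. ?c i * (?t i p - P (?t i) p))"
    using r P t by (simp only:) (intro l2norm_triangle L2_diff L2_sum L2_scale; simp)
  also have "l2norm ?\<mu>2 (\<lambda>p. r p - P r p) \<le> l2norm ?\<mu>2 r"
    unfolding P_def by (rule kernel_proj_residual_le[OF onb(2) r])
  also have "l2norm ?\<mu>2 (\<lambda>p. \<Sum>i\<in>?A. ?c i * (?t i p - P (?t i) p))
      \<le> (\<Sum>i\<in>?A. \<bar>?c i\<bar> * l2norm ?\<mu>2 (\<lambda>p. ?t i p - P (?t i) p))"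
    using t P by (intro l2norm_lincomb_le L2_diff) auto
  also have "\<dots> \<le> (\<Sum>i\<in>?A. \<bar>?c i\<bar> * (eigen_dev \<mu> \<phi> \<phi>' (fst i) + eigen_dev \<mu> \<phi> \<phi>' (snd i)))"
    unfolding P_def by (intro sum_mono mult_left_mono tensor_projection_error onb) auto
  also have "\<dots> = (\<Sum>j=1..m1. \<Sum>k=1..m2. \<bar>l2inner ?\<mu>2 T (tensor (\<phi> j) (\<phi> k))\<bar> * (eigen_dev \<mu> \<phi> \<phi>' j + eigen_dev \<mu> \<phi> \<phi>' k))"
    by (simp add: sum.cartesian_product case_prod_unfold)
  finally show ?thesis by (simp add: P_def r_def s_def)
qed

text \<open>The component of \<open>\<phi>' k\<close> along \<open>\<phi> k\<close> contributes the image of the fixed function \<open>\<phi> k\<close> under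
  \<open>S\<close>, whose moments are accessible although \<open>\<phi>'\<close> depends on the data; the remainder is paid for
  with the full norm of \<open>S\<close>, which is affordable because the angles are small.  The sum over \<open>j\<close> is
  removed by Bessel's inequality for the orthonormal system \<open>\<phi>'\<close>.\<close>
lemma noise_bound:
  assumes onb: "L2_onb \<mu> \<phi>" "L2_onb \<mu> \<phi>'" and S: "S \<in> L2 (\<mu> \<Otimes>\<^sub>M \<mu>)"
    and pos: "\<And>k. 1 \<le> k \<Longrightarrow> k \<le> m2 \<Longrightarrow> 0 < \<kappa> k"
    and half: "\<And>k. 1 \<le> k \<Longrightarrow> k \<le> m2 \<Longrightarrow> \<kappa> k / 2 \<le> \<kappa>' k"
  shows "(l2norm (\<mu> \<Otimes>\<^sub>M \<mu>) (\<lambda>p. \<Sum>(j, k)\<in>{1..m1} \<times> {1..m2}.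
        l2inner (\<mu> \<Otimes>\<^sub>M \<mu>) S (tensor (\<phi>' j) (\<phi>' k)) / \<kappa>' k * tensor (\<phi>' j) (\<phi>' k) p))\<^sup>2
    \<le> 8 * ((\<Sum>k=1..m2. (l2norm \<mu> (slice \<mu> S (\<phi> k)))\<^sup>2 / (\<kappa> k)\<^sup>2)
        + (l2norm (\<mu> \<Otimes>\<^sub>M \<mu>) S)\<^sup>2 * (\<Sum>k=1..m2. (eigen_dev \<mu> \<phi> \<phi>' k)\<^sup>2 / (\<kappa> k)\<^sup>2))"
proof -
  let ?\<mu>2 = "\<mu> \<Otimes>\<^sub>M \<mu>"
  note \<phi> = L2_onb_in_L2[OF onb(1)] L2_onb_in_L2[OF onb(2)]
  have column: "(\<Sum>j=1..m1. (l2inner ?\<mu>2 S (tensor (\<phi>' j) (\<phi>' k)))\<^sup>2)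
      \<le> 2 * (l2norm \<mu> (slice \<mu> S (\<phi> k)))\<^sup>2 + 2 * ((l2norm ?\<mu>2 S)\<^sup>2 * (eigen_dev \<mu> \<phi> \<phi>' k)\<^sup>2)" if k: "1 \<le> k" for k
  proof -
    define a where "a = l2inner \<mu> (\<phi>' k) (\<phi> k)"
    define w where "w = (\<lambda>x. \<phi>' k x - a * \<phi> k x)"
    have w: "w \<in> L2 \<mu>" unfolding w_def by (intro L2_diff L2_scale \<phi> k)
    have dev: "eigen_dev \<mu> \<phi> \<phi>' k = l2norm \<mu> w" by (simp add: eigen_dev_def w_def a_def)
    have a: "a\<^sup>2 \<le> 1" using eigen_dev_power2[OF onb k] zero_le_power2[of "eigen_dev \<mu> \<phi> \<phi>' k"]
      by (simp add: a_def del: zero_le_power2)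
    have split: "\<phi>' k = (\<lambda>x. a * \<phi> k x + w x)" by (simp add: w_def)
    have "(\<Sum>j=1..m1. (l2inner ?\<mu>2 S (tensor (\<phi>' j) (\<phi>' k)))\<^sup>2)
        = (\<Sum>j=1..m1. (a * l2inner ?\<mu>2 S (tensor (\<phi>' j) (\<phi> k)) + l2inner ?\<mu>2 S (tensor (\<phi>' j) w))\<^sup>2)"
      using \<phi> k w
      by (intro sum.cong refl arg_cong[where f="\<lambda>x. x\<^sup>2"], subst split)
         (auto intro!: l2inner_tensor_add_right sf S)
    also have "\<dots> \<le> (\<Sum>j=1..m1. 2 * (a * l2inner ?\<mu>2 S (tensor (\<phi>' j) (\<phi> k)))\<^sup>2
        + 2 * (l2inner ?\<mu>2 S (tensor (\<phi>' j) w))\<^sup>2)"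
      by (intro sum_mono sum_power2_le_twice)
    also have "\<dots> = 2 * (a\<^sup>2 * (\<Sum>j=1..m1. (l2inner ?\<mu>2 S (tensor (\<phi>' j) (\<phi> k)))\<^sup>2))
        + 2 * (\<Sum>j=1..m1. (l2inner ?\<mu>2 S (tensor (\<phi>' j) w))\<^sup>2)"
      by (simp only: sum.distrib sum_distrib_left power_mult_distrib)
    also have "\<dots> \<le> 2 * (1 * (l2norm \<mu> (slice \<mu> S (\<phi> k)))\<^sup>2) + 2 * ((l2norm ?\<mu>2 S)\<^sup>2 * (l2norm \<mu> w)\<^sup>2)"
    proof (intro add_mono mult_left_mono mult_mono a)
      have "(\<Sum>j=1..m1. (l2inner ?\<mu>2 S (tensor (\<phi>' j) (\<phi> k)))\<^sup>2)
          = (\<Sum>j=1..m1. (l2inner \<mu> (slice \<mu> S (\<phi> k)) (\<phi>' j))\<^sup>2)"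
        using \<phi> k by (intro sum.cong) (auto simp: l2inner_slice[OF sf sf S])
      also have "\<dots> \<le> (l2norm \<mu> (slice \<mu> S (\<phi> k)))\<^sup>2"
        using \<phi> k by (intro Bessel_l2norm L2_onb_orthonormal_atMost onb slice_in_L2 sf S) auto
      finally show "(\<Sum>j=1..m1. (l2inner ?\<mu>2 S (tensor (\<phi>' j) (\<phi> k)))\<^sup>2) \<le> (l2norm \<mu> (slice \<mu> S (\<phi> k)))\<^sup>2" .
      show "(\<Sum>j=1..m1. (l2inner ?\<mu>2 S (tensor (\<phi>' j) w))\<^sup>2) \<le> (l2norm ?\<mu>2 S)\<^sup>2 * (l2norm \<mu> w)\<^sup>2"
        by (intro Bessel_kernel_section sf L2_onb_orthonormal_atMost onb S w) auto
    qed (auto intro: sum_nonneg)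
    finally show ?thesis by (simp add: dev)
  qed
  have "(l2norm ?\<mu>2 (\<lambda>p. \<Sum>(j, k)\<in>{1..m1} \<times> {1..m2}.
        l2inner ?\<mu>2 S (tensor (\<phi>' j) (\<phi>' k)) / \<kappa>' k * tensor (\<phi>' j) (\<phi>' k) p))\<^sup>2
      = (\<Sum>(j, k)\<in>{1..m1} \<times> {1..m2}. (l2inner ?\<mu>2 S (tensor (\<phi>' j) (\<phi>' k)) / \<kappa>' k)\<^sup>2)"
    using l2norm_orthonormal_lincomb[OF _ onb_tensor_orthonormal[OF onb(2)], of m1 m2
        "\<lambda>(j, k). l2inner ?\<mu>2 S (tensor (\<phi>' j) (\<phi>' k)) / \<kappa>' k"]
    by (simp add: case_prod_unfold)
  also have "\<dots> = (\<Sum>k=1..m2. (\<Sum>j=1..m1. (l2inner ?\<mu>2 S (tensor (\<phi>' j) (\<phi>' k)))\<^sup>2) / (\<kappa>' k)\<^sup>2)"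
    by (subst sum.cartesian_product[symmetric], subst sum.swap) (simp add: power_divide sum_divide_distrib)
  also have "\<dots> \<le> (\<Sum>k=1..m2. (2 * (l2norm \<mu> (slice \<mu> S (\<phi> k)))\<^sup>2
      + 2 * ((l2norm ?\<mu>2 S)\<^sup>2 * (eigen_dev \<mu> \<phi> \<phi>' k)\<^sup>2)) / (\<kappa> k / 2)\<^sup>2)"
    using pos half
    by (intro sum_mono frac_le column power_mono) (auto intro!: sum_nonneg add_nonneg_nonneg less_imp_le simp: less_imp_neq[THEN not_sym])
  also have "\<dots> = (\<Sum>k=1..m2. 8 * ((l2norm \<mu> (slice \<mu> S (\<phi> k)))\<^sup>2 / (\<kappa> k)\<^sup>2
      + (l2norm ?\<mu>2 S)\<^sup>2 * ((eigen_dev \<mu> \<phi> \<phi>' k)\<^sup>2 / (\<kappa> k)\<^sup>2)))"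
    by (intro sum.cong refl) (simp add: power_divide add_divide_distrib)
  finally show ?thesis by (simp only: sum_distrib_left sum.distrib distrib_left)
qed

end

section \<open>Deterministic analysis of the estimator\<close>

text \<open>A realization of the sample.  The residuals \<open>eps\<close> are formed with the population means \<open>mX\<close>,
  \<open>mY\<close>, so that distinct observations stay independent; centring at the sample means then costs
  the rank-one corrections built from \<open>xbar\<close> and \<open>ebar\<close>.\<close>
locale functional_sample =
  fixes n :: nat and x y :: "nat \<Rightarrow> real \<Rightarrow> real" and mX mY :: "real \<Rightarrow> real"
    and b :: "real \<times> real \<Rightarrow> real"
  assumes n: "1 \<le> n"
    and x: "\<And>i. 1 \<le> i \<Longrightarrow> x i \<in> L2 unit_I" and y: "\<And>i. 1 \<le> i \<Longrightarrow> y i \<in> L2 unit_I"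
    and mX: "mX \<in> L2 unit_I" and mY: "mY \<in> L2 unit_I" and b: "b \<in> L2 unit_I2"
begin

definition xc :: "nat \<Rightarrow> real \<Rightarrow> real" where
  "xc i = (\<lambda>t. x i t - mX t)"

definition eps :: "nat \<Rightarrow> real \<Rightarrow> real" where
  "eps i = (\<lambda>s. y i s - mY s - slice unit_I b (xc i) s)"

definition xbar :: "real \<Rightarrow> real" where
  "xbar = (\<lambda>t. (\<Sum>i=1..n. xc i t) / real n)"

definition ebar :: "real \<Rightarrow> real" where
  "ebar = (\<lambda>s. (\<Sum>i=1..n. eps i s) / real n)"

definition C0 :: "real \<times> real \<Rightarrow> real" where
  "C0 = (\<lambda>p. (\<Sum>i=1..n. tensor (xc i) (xc i) p) / real n)"

definition S0 :: "real \<times> real \<Rightarrow> real" where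
  "S0 = (\<lambda>p. (\<Sum>i=1..n. tensor (eps i) (xc i) p) / real n)"

definition S :: "real \<times> real \<Rightarrow> real" where
  "S = (\<lambda>p. S0 p - tensor ebar xbar p)"

lemmas sf = sigma_finite_unit_I

lemma xc: "1 \<le> i \<Longrightarrow> xc i \<in> L2 unit_I"
  unfolding xc_def by (intro L2_diff x mX)

lemma eps: "1 \<le> i \<Longrightarrow> eps i \<in> L2 unit_I"
  unfolding eps_def by (intro L2_diff y mY slice_in_L2 sf b xc)

lemma xbar: "xbar \<in> L2 unit_I" and ebar: "ebar \<in> L2 unit_I"
  unfolding xbar_def ebar_def by (intro L2_divide L2_sum; simp add: xc eps)+

lemma C0: "C0 \<in> L2 unit_I2" and S0: "S0 \<in> L2 unit_I2"
  unfolding C0_def S0_def by (intro L2_divide L2_sum tensor_in_L2 sf; simp add: xc eps)+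

lemma S: "S \<in> L2 unit_I2"
  unfolding S_def by (intro L2_diff S0 tensor_in_L2 sf ebar xbar)

lemma l2inner_xbar: "f \<in> L2 unit_I \<Longrightarrow> l2inner unit_I xbar f = (\<Sum>i=1..n. l2inner unit_I (xc i) f) / real n"
  unfolding xbar_def by (subst l2inner_divide_left, subst l2inner_sum_left) (auto simp: xc)

lemma l2inner_ebar: "f \<in> L2 unit_I \<Longrightarrow> l2inner unit_I ebar f = (\<Sum>i=1..n. l2inner unit_I (eps i) f) / real n"
  unfolding ebar_def by (subst l2inner_divide_left, subst l2inner_sum_left) (auto simp: eps)

lemma l2inner_C0: "f \<in> L2 unit_I \<Longrightarrow> h \<in> L2 unit_I \<Longrightarrow>
    l2inner unit_I2 C0 (tensor f h) = (\<Sum>i=1..n. l2inner unit_I (xc i) f * l2inner unit_I (xc i) h) / real n"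
  unfolding C0_def
  by (subst l2inner_divide_left, subst l2inner_sum_left)
     (auto simp: xc tensor_in_L2 sf l2inner_tensor_tensor)

lemma l2inner_S0: "f \<in> L2 unit_I \<Longrightarrow> h \<in> L2 unit_I \<Longrightarrow>
    l2inner unit_I2 S0 (tensor f h) = (\<Sum>i=1..n. l2inner unit_I (eps i) f * l2inner unit_I (xc i) h) / real n"
  unfolding S0_def
  by (subst l2inner_divide_left, subst l2inner_sum_left)
     (auto simp: xc eps tensor_in_L2 sf l2inner_tensor_tensor)

lemma centred: "x i t - sample_mean n x t = xc i t - xbar t"
proof -
  have "xbar t = sample_mean n x t - mX t"
    using n by (simp add: xbar_def xc_def sample_mean_def sum_subtractf diff_divide_distrib)
  then show ?thesis by (simp add: xc_def)
qed

lemma sample_cov_eq: "sample_cov n x = (\<lambda>p. C0 p - tensor xbar xbar p)"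
proof (rule ext)
  fix p :: "real \<times> real"
  obtain s t where p: "p = (s, t)" by force
  have sums: "(\<Sum>i=1..n. xc i s) = real n * xbar s" "(\<Sum>i=1..n. xc i t) = real n * xbar t"
    using n by (simp_all add: xbar_def)
  have "(\<Sum>i=1..n. (xc i s - xbar s) * (xc i t - xbar t))
      = (\<Sum>i=1..n. xc i s * xc i t - xbar t * xc i s - xbar s * xc i t + xbar s * xbar t)"
    by (intro sum.cong refl) (simp add: algebra_simps)
  also have "\<dots> = (\<Sum>i=1..n. xc i s * xc i t) - xbar t * (\<Sum>i=1..n. xc i s)
      - xbar s * (\<Sum>i=1..n. xc i t) + real n * (xbar s * xbar t)"
    by (simp only: sum.distrib sum_subtractf sum_distrib_left) simp
  also have "\<dots> = (\<Sum>i=1..n. xc i s * xc i t) - real n * (xbar s * xbar t)"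
    unfolding sums by simp
  finally have "(\<Sum>i=1..n. (xc i s - xbar s) * (xc i t - xbar t))
      = (\<Sum>i=1..n. xc i s * xc i t) - real n * (xbar s * xbar t)" .
  then show "sample_cov n x p = C0 p - tensor xbar xbar p"
    using n by (simp add: p sample_cov_def centred C0_def diff_divide_distrib)
qed

lemma sample_cov_in_L2: "sample_cov n x \<in> L2 unit_I2"
  unfolding sample_cov_eq by (intro L2_diff C0 tensor_in_L2 sf xbar)

text \<open>The centred predictors sum to zero, so the constant parts of the responses drop out of the
  empirical cross-covariance; its regression part is \<open>b\<close> composed with the empirical covariance,
  for which the second function is an eigenfunction.\<close>

lemma empirical_coefficient:
  assumes spec: "spectral_expansion unit_I (sample_cov n x) \<kappa>' \<phi>'" and j: "1 \<le> j" and k: "1 \<le> k"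
    and nz: "\<kappa>' k \<noteq> 0"
  shows "b_tilde_coeff n x y \<kappa>' \<phi>' d j k
    = l2inner unit_I2 b (tensor (\<phi>' j) (\<phi>' k)) + l2inner unit_I2 S (tensor (\<phi>' j) (\<phi>' k)) / \<kappa>' k"
proof -
  note onb = spectral_expansion_onb[OF spec]
  define f where "f = \<phi>' j"
  define h where "h = \<phi>' k"
  have f: "f \<in> L2 unit_I" and h: "h \<in> L2 unit_I"
    using L2_onb_in_L2[OF onb] j k by (simp_all add: f_def h_def)
  define g where "g = slice unit_I (\<lambda>(t, s). b (s, t)) f"
  have g: "g \<in> L2 unit_I" unfolding g_def by (intro slice_in_L2 swap_in_L2 sf b f)
  have g_inner: "l2inner unit_I g v = l2inner unit_I2 b (tensor f v)" if v: "v \<in> L2 unit_I" for v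
    unfolding g_def using l2inner_slice[OF sf sf swap_in_L2[OF sf sf b] v f] l2inner_swap[OF sf sf b f v]
    by simp
  define z where "z i = (\<lambda>t. x i t - sample_mean n x t)" for i
  have z_eq: "z i = (\<lambda>t. xc i t - xbar t)" for i by (simp add: z_def centred)
  have z: "z i \<in> L2 unit_I" if "1 \<le> i" for i unfolding z_eq by (intro L2_diff xc xbar that)
  have z_inner: "l2inner unit_I (z i) v = l2inner unit_I (xc i) v - l2inner unit_I xbar v"
    if "1 \<le> i" "v \<in> L2 unit_I" for i v unfolding z_eq using that by (simp add: l2inner_diff_left xc xbar)
  have sum_z: "(\<Sum>i=1..n. l2inner unit_I (z i) v) = 0" if v: "v \<in> L2 unit_I" for v
    using n by (simp add: z_inner v sum_subtractf l2inner_xbar)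
  have y_inner: "l2inner unit_I (y i) f = l2inner unit_I (eps i) f + l2inner unit_I g (z i)
      + (l2inner unit_I mY f + l2inner unit_I g xbar)" if i: "1 \<le> i" for i
  proof -
    have "l2inner unit_I (eps i) f = l2inner unit_I (y i) f - l2inner unit_I mY f - l2inner unit_I2 b (tensor f (xc i))"
      unfolding eps_def using i f
      by (simp add: l2inner_diff_left L2_diff y mY xc slice_in_L2 sf b l2inner_slice)
    moreover have "l2inner unit_I2 b (tensor f (xc i)) = l2inner unit_I g (z i) + l2inner unit_I g xbar"
      unfolding z_eq using i by (simp add: g_inner[symmetric] xc l2inner_diff_right g xbar)
    ultimately show ?thesis by simp
  qed
  have "(\<Sum>i=1..n. l2inner unit_I (y i) f * l2inner unit_I (z i) h)
      = (\<Sum>i=1..n. l2inner unit_I (eps i) f * l2inner unit_I (z i) h)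
      + (\<Sum>i=1..n. l2inner unit_I g (z i) * l2inner unit_I (z i) h)
      + (l2inner unit_I mY f + l2inner unit_I g xbar) * (\<Sum>i=1..n. l2inner unit_I (z i) h)"
    by (simp add: y_inner distrib_right sum.distrib sum_distrib_left)
  also have "(\<Sum>i=1..n. l2inner unit_I (eps i) f * l2inner unit_I (z i) h) = real n * l2inner unit_I2 S (tensor f h)"
    unfolding S_def using f h n
    by (simp add: l2inner_diff_left S0 tensor_in_L2 sf ebar xbar l2inner_tensor_tensor l2inner_S0 z_inner
        l2inner_ebar right_diff_distrib sum_subtractf sum_distrib_right)
  also have "(\<Sum>i=1..n. l2inner unit_I g (z i) * l2inner unit_I (z i) h) = real n * l2inner unit_I2 (sample_cov n x) (tensor g h)"
  proof -
    have "sample_cov n x = (\<lambda>p. (\<Sum>i=1..n. tensor (z i) (z i) p) / real n)"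
      by (simp add: sample_cov_def z_def fun_eq_iff)
    then show ?thesis
      using n g h
      by (simp add: l2inner_divide_left)
         (subst l2inner_sum_left, auto simp: z tensor_in_L2 sf l2inner_tensor_tensor l2inner_commute[of unit_I g])
  qed
  also have "l2inner unit_I2 (sample_cov n x) (tensor g h) = \<kappa>' k * l2inner unit_I2 b (tensor f h)"
    using spectral_expansion_eigen(2)[OF sf sample_cov_in_L2 spec g k] h
    by (simp add: h_def g_inner[symmetric] l2inner_commute)
  finally have "(\<Sum>i=1..n. l2inner unit_I (y i) f * l2inner unit_I (z i) h)
      = real n * l2inner unit_I2 S (tensor f h) + real n * (\<kappa>' k * l2inner unit_I2 b (tensor f h))"
    by (simp only: sum_z[OF h] mult_zero_right add_0_right)
  then show ?thesis
    using n nz by (simp add: b_tilde_coeff_def f_def[symmetric] h_def[symmetric] z_def[symmetric] add_divide_distrib)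
qed

end

text \<open>The constant of the risk bound when all sample statistics are at most \<open>L\<close> times their natural
  order: truncation error, rotation of the projections, and noise, in this order.\<close>
definition risk_const :: "real \<Rightarrow> real \<Rightarrow> real \<Rightarrow> real \<Rightarrow> real \<Rightarrow> real" where
  "risk_const \<alpha> \<beta> \<gamma> C1 L =
     6 * C1\<^sup>2 * (zeta_sum (2 * \<gamma>) / (2 * \<beta> - 1) + zeta_sum (2 * \<beta>) / (2 * \<gamma> - 1))
     + 204 * C1\<^sup>2 * L * ((zeta_sum \<beta>)\<^sup>2 * zeta_sum (2 * \<gamma> - 2) + (zeta_sum \<gamma>)\<^sup>2 * zeta_sum (2 * \<beta> - 2))
     + 16 * ((2 * L + 2 * L\<^sup>2) + (2 + 2 * L) * (17 / 2 * \<alpha>\<^sup>2 * L))"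

locale estimator_setting = polynomial_spectrum \<kappa> \<alpha> C1 + functional_sample n x y mX mY b
  for \<kappa> \<alpha> C1 n x y mX mY b +
  fixes K :: "real \<times> real \<Rightarrow> real" and \<phi> \<phi>' :: "nat \<Rightarrow> real \<Rightarrow> real" and \<kappa>' :: "nat \<Rightarrow> real" and \<beta> \<gamma> :: real
  assumes K: "K \<in> L2 unit_I2" and spec: "spectral_expansion unit_I K \<kappa> \<phi>"
    and spec': "spectral_expansion unit_I (sample_cov n x) \<kappa>' \<phi>'"
    and beta: "3 / 2 < \<beta>" and gamma: "3 / 2 < \<gamma>"
    and b_decay: "\<And>j k. 1 \<le> j \<Longrightarrow> 1 \<le> k \<Longrightarrow>
      \<bar>l2inner unit_I2 b (tensor (\<phi> j) (\<phi> k))\<bar> \<le> C1 * real j powr (- \<gamma>) * real k powr (- \<beta>)"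
begin

abbreviation \<omega> :: "nat \<Rightarrow> real" where "\<omega> \<equiv> eigen_dev unit_I \<phi> \<phi>'"

lemma onb: "L2_onb unit_I \<phi>" and onb': "L2_onb unit_I \<phi>'"
  using spec spec' by (auto dest: spectral_expansion_onb)

text \<open>Everything random enters through the following scalar statistics of the sample, each of
  order \<open>1 / n\<close> up to the displayed powers of the truncation levels.\<close>

context
  fixes L :: real and m1 m2 :: nat and U :: "nat \<Rightarrow> real"
  assumes L: "0 < L" and m: "1 \<le> m1" "1 \<le> m2"
    and cov_stat: "(l2norm unit_I2 (\<lambda>p. C0 p - K p))\<^sup>2 \<le> L / real n"
    and mean_stat: "(l2norm unit_I xbar)\<^sup>2 \<le> L / real n"
    and noise_stat: "(l2norm unit_I2 S0)\<^sup>2 \<le> L / real n"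
    and noise_mean_stat: "(l2norm unit_I ebar)\<^sup>2 \<le> L / real n"
    and U: "\<And>j N. 1 \<le> j \<Longrightarrow> j \<le> max m1 m2 \<Longrightarrow>
      (\<Sum>l\<in>{1..N} - {j}. (l2inner unit_I2 (\<lambda>p. C0 p - K p) (tensor (\<phi> l) (\<phi> j)))\<^sup>2 / (\<kappa> l - \<kappa> j)\<^sup>2) \<le> U j"
    and eigen_stat: "\<And>m. m = m1 \<or> m = m2 \<Longrightarrow> (\<Sum>j=1..m. U j / (real j)\<^sup>2) \<le> L * real m / real n"
    and noise_coef_stat: "(\<Sum>k=1..m2. (l2norm unit_I (slice unit_I S0 (\<phi> k)))\<^sup>2 / (\<kappa> k)\<^sup>2)
      \<le> L * real m2 powr (\<alpha> + 1) / real n"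
    and mean_coef_stat: "(\<Sum>k=1..m2. (l2inner unit_I xbar (\<phi> k))\<^sup>2 / (\<kappa> k)\<^sup>2)
      \<le> L * real m2 powr (\<alpha> + 1) / real n"
    and small: "sqrt (L / real n) + L / real n \<le> real (max m1 m2) powr (- \<alpha> - 1) / (4 * C1)"
begin

abbreviation gapM :: real where "gapM \<equiv> real (max m1 m2) powr (- \<alpha> - 1) / C1"

lemma gapM_pos: "0 < gapM"
  using m C1 by simp

text \<open>The levels are so small that the squared statistical error is at most a fixed fraction of the
  squared eigenvalue gap; this is what absorbs all second-order terms below.\<close>
lemma Ln_le: "L / real n \<le> gapM\<^sup>2 / 16"
proof -
  have "0 < L / real n" using L n by simp
  then have "sqrt (L / real n) \<le> gapM / 4" using small by simp
  then have "(sqrt (L / real n))\<^sup>2 \<le> (gapM / 4)\<^sup>2" using L by (intro power_mono) auto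
  then show ?thesis using L by (simp add: power_divide)
qed

lemma sample_cov_diff: "(\<lambda>p. sample_cov n x p - K p) = (\<lambda>p. (C0 p - K p) - tensor xbar xbar p)"
  by (simp add: sample_cov_eq fun_eq_iff)

lemma cov_error: "l2norm unit_I2 (\<lambda>p. sample_cov n x p - K p) \<le> gapM / 4"
proof -
  have "l2norm unit_I2 (\<lambda>p. sample_cov n x p - K p)
      \<le> l2norm unit_I2 (\<lambda>p. C0 p - K p) + l2norm unit_I2 (tensor xbar xbar)"
    unfolding sample_cov_diff by (intro l2norm_triangle_diff L2_diff C0 K tensor_in_L2 sf xbar)
  also have "l2norm unit_I2 (tensor xbar xbar) = (l2norm unit_I xbar)\<^sup>2"
    by (simp add: l2norm_tensor sf xbar power2_eq_square)
  also have "l2norm unit_I2 (\<lambda>p. C0 p - K p) \<le> sqrt (L / real n)"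
    using cov_stat by (rule real_le_rsqrt)
  finally show ?thesis using mean_stat small by simp
qed

text \<open>The rank-one correction to the empirical covariance enters the perturbation bound through
  \<open>(l2norm xbar)^4 / gap^2\<close>, which is again of order \<open>1 / n\<close>; fourth moments of the sample mean
  are thus avoided.\<close>
lemma dev_le:
  assumes j: "1 \<le> j" "j \<le> max m1 m2"
  shows "(\<omega> j)\<^sup>2 \<le> 32 * U j + 2 * (L / real n)"
proof -
  have j_L2: "\<phi> j \<in> L2 unit_I" by (rule L2_onb_in_L2[OF onb j(1)])
  have "(\<omega> j)\<^sup>2 \<le> 16 * (2 * U j + L / (8 * real n))"
    unfolding eigen_dev_def
  proof (rule eigenfunction_perturbation[OF sf K sample_cov_in_L2 spec spec' j(1) gapM_pos _ cov_error])
    fix l :: nat assume "1 \<le> l" "l \<noteq> j"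
    then show "gapM \<le> \<bar>\<kappa> l - \<kappa> j\<bar>" using j by (intro min_gap)
  next
    fix N :: nat
    let ?D = "\<lambda>l. l2inner unit_I2 (\<lambda>p. C0 p - K p) (tensor (\<phi> l) (\<phi> j))"
    let ?E = "\<lambda>l. l2inner unit_I2 (tensor xbar xbar) (tensor (\<phi> l) (\<phi> j))"
    have each: "(l2inner unit_I2 (\<lambda>p. sample_cov n x p - K p) (tensor (\<phi> l) (\<phi> j)))\<^sup>2 / (\<kappa> l - \<kappa> j)\<^sup>2
        \<le> 2 * ((?D l)\<^sup>2 / (\<kappa> l - \<kappa> j)\<^sup>2) + 2 / gapM\<^sup>2 * (?E l)\<^sup>2" if l: "l \<in> {1..N} - {j}" for l
    proof -
      have "\<phi> l \<in> L2 unit_I" using l by (intro L2_onb_in_L2[OF onb]) auto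
      then have "l2inner unit_I2 (\<lambda>p. sample_cov n x p - K p) (tensor (\<phi> l) (\<phi> j)) = ?D l - ?E l"
        unfolding sample_cov_diff using j_L2
        by (intro l2inner_diff_left L2_diff C0 K tensor_in_L2 sf xbar)
      then have "(l2inner unit_I2 (\<lambda>p. sample_cov n x p - K p) (tensor (\<phi> l) (\<phi> j)))\<^sup>2 / (\<kappa> l - \<kappa> j)\<^sup>2
          \<le> (2 * (?D l)\<^sup>2 + 2 * (?E l)\<^sup>2) / (\<kappa> l - \<kappa> j)\<^sup>2"
        by (simp only:) (intro divide_right_mono diff_power2_le_twice; simp)
      moreover have "(?E l)\<^sup>2 / (\<kappa> l - \<kappa> j)\<^sup>2 \<le> (?E l)\<^sup>2 / gapM\<^sup>2"
      proof (rule divide_left_mono)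
        have "gapM \<le> \<bar>\<kappa> l - \<kappa> j\<bar>" using l j by (intro min_gap) auto
        from power_mono[OF this, of 2] gapM_pos show "gapM\<^sup>2 \<le> (\<kappa> l - \<kappa> j)\<^sup>2" by simp
        with gapM_pos show "0 < (\<kappa> l - \<kappa> j)\<^sup>2 * gapM\<^sup>2"
          by (intro mult_pos_pos less_le_trans[OF zero_less_power[OF gapM_pos, of 2]]) auto
      qed simp
      ultimately show ?thesis by (simp add: add_divide_distrib)
    qed
    have sum_le: "(\<Sum>l\<in>{1..N} - {j}. (l2inner unit_I2 (\<lambda>p. sample_cov n x p - K p) (tensor (\<phi> l) (\<phi> j)))\<^sup>2 / (\<kappa> l - \<kappa> j)\<^sup>2)
        \<le> 2 * (\<Sum>l\<in>{1..N} - {j}. (?D l)\<^sup>2 / (\<kappa> l - \<kappa> j)\<^sup>2) + 2 / gapM\<^sup>2 * (\<Sum>l\<in>{1..N} - {j}. (?E l)\<^sup>2)"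
      unfolding sum_distrib_left sum.distrib[symmetric] by (intro sum_mono each)
    have "(\<Sum>l\<in>{1..N} - {j}. (?E l)\<^sup>2) \<le> (l2norm unit_I2 (tensor xbar xbar))\<^sup>2 * (l2norm unit_I (\<phi> j))\<^sup>2"
      by (intro Bessel_kernel_section sf tensor_in_L2 xbar j_L2
          orthonormal_on_subset[OF L2_onb_orthonormal[OF onb]]) auto
    also have "\<dots> = (l2norm unit_I xbar)\<^sup>2 * (l2norm unit_I xbar)\<^sup>2"
      using onb j by (simp add: l2norm_tensor sf xbar L2_onb_l2norm power2_eq_square)
    also have "\<dots> \<le> gapM\<^sup>2 / 16 * (L / real n)"
      by (intro mult_mono mean_stat order_trans[OF mean_stat Ln_le]) auto
    finally have "2 / gapM\<^sup>2 * (\<Sum>l\<in>{1..N} - {j}. (?E l)\<^sup>2) \<le> 2 / gapM\<^sup>2 * (gapM\<^sup>2 / 16 * (L / real n))"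
      by (rule mult_left_mono) simp
    also have "\<dots> = L / (8 * real n)"
    proof -
      have "2 / g\<^sup>2 * (g\<^sup>2 / 16 * q) = q / 8" if "0 < g" for g q :: real
        using that by simp
      from this[OF gapM_pos] show ?thesis by simp
    qed
    finally show "(\<Sum>l\<in>{1..N} - {j}. (l2inner unit_I2 (\<lambda>p. sample_cov n x p - K p) (tensor (\<phi> l) (\<phi> j)))\<^sup>2 / (\<kappa> l - \<kappa> j)\<^sup>2)
        \<le> 2 * U j + L / (8 * real n)"
      using U[OF j, of N] sum_le by linarith
  qed
  then show ?thesis by simp
qed

lemma dev_sum_le:
  assumes m': "m = m1 \<or> m = m2"
  shows "(\<Sum>j=1..m. (\<omega> j)\<^sup>2 / (real j)\<^sup>2) \<le> 34 * (L * real m / real n)"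
proof -
  have "(\<Sum>j=1..m. (\<omega> j)\<^sup>2 / (real j)\<^sup>2) \<le> (\<Sum>j=1..m. 32 * (U j / (real j)\<^sup>2) + 2 * (L / real n))"
  proof (rule sum_mono)
    fix j assume j: "j \<in> {1..m}"
    then have "(\<omega> j)\<^sup>2 / (real j)\<^sup>2 \<le> (32 * U j + 2 * (L / real n)) / (real j)\<^sup>2"
      using m' by (intro divide_right_mono dev_le) auto
    also have "\<dots> = 32 * (U j / (real j)\<^sup>2) + 2 * (L / real n) / (real j)\<^sup>2"
      by (simp add: add_divide_distrib)
    also have "2 * (L / real n) / (real j)\<^sup>2 \<le> 2 * (L / real n) / 1"
      using j L by (intro divide_left_mono) auto
    finally show "(\<omega> j)\<^sup>2 / (real j)\<^sup>2 \<le> 32 * (U j / (real j)\<^sup>2) + 2 * (L / real n)" by simp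
  qed
  also have "\<dots> = 32 * (\<Sum>j=1..m. U j / (real j)\<^sup>2) + 2 * (L * real m / real n)"
    by (simp add: sum.distrib sum_distrib_left)
  finally show ?thesis using eigen_stat[OF m'] by simp
qed

text \<open>Cauchy-Schwarz with the weights \<open>j powr (1 - p)\<close>, which are square summable for
  \<open>p > 3 / 2\<close>: this is where the smoothness of the coefficient function beats the growth \<open>j / sqrt n\<close>
  of the angles.\<close>
lemma weighted_dev_sum_le:
  assumes "m = m1 \<or> m = m2" and p: "3 / 2 < p"
  shows "(\<Sum>j=1..m. real j powr (- p) * \<omega> j)\<^sup>2 \<le> zeta_sum (2 * p - 2) * (34 * (L * real m / real n))"
proof -
  have "(\<Sum>j=1..m. real j powr (- p) * \<omega> j)\<^sup>2 = (\<Sum>j=1..m. (real j powr (1 - p)) * (\<omega> j / real j))\<^sup>2"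
    by (intro arg_cong[where f="\<lambda>x. x\<^sup>2"] sum.cong refl) (auto simp: powr_diff powr_minus field_simps)
  also have "\<dots> \<le> (\<Sum>j=1..m. (real j powr (1 - p))\<^sup>2) * (\<Sum>j=1..m. (\<omega> j / real j)\<^sup>2)"
    by (rule Cauchy_Schwarz_ineq_sum)
  also have "(\<Sum>j=1..m. (real j powr (1 - p))\<^sup>2) = (\<Sum>j=1..m. real j powr (- (2 * p - 2)))"
    by (intro sum.cong refl) (auto simp: power2_eq_square powr_add[symmetric] algebra_simps)
  also have "\<dots> * (\<Sum>j=1..m. (\<omega> j / real j)\<^sup>2) \<le> zeta_sum (2 * p - 2) * (34 * (L * real m / real n))"
    using dev_sum_le[OF assms(1)] p
    by (intro mult_mono sum_powr_le_zeta_sum zeta_sum_nonneg sum_nonneg) (auto simp: power_divide)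
  finally show ?thesis .
qed

text \<open>An eigenvalue is at least as large as the gap below it, so an error of a quarter of the gap
  leaves most of it; in particular no empirical eigenvalue in a denominator vanishes.\<close>
lemma kappa'_ge:
  assumes "1 \<le> k" "k \<le> m2"
  shows "\<kappa> k / 2 \<le> \<kappa>' k"
proof -
  have "\<bar>\<kappa>' k - \<kappa> k\<bar> \<le> gapM / 4"
    using eigenvalue_perturbation[OF sf K sample_cov_in_L2 spec spec' assms(1)] cov_error by simp
  moreover have "gapM \<le> \<kappa> k"
    using min_gap[of k "max m1 m2" "Suc k"] pos[of "Suc k"] decreasing[of k "Suc k"] assms
    by (simp add: le_max_iff_disj)
  moreover have "t / 2 \<le> t'" if "\<bar>t' - t\<bar> \<le> g / 4" "g \<le> t" "0 < g" for t t' g :: real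
    using that by linarith
  ultimately show ?thesis using gapM_pos by blast
qed

lemma dev_over_kappa_le:
  "L / real n * (\<Sum>k=1..m2. (\<omega> k)\<^sup>2 / (\<kappa> k)\<^sup>2) \<le> 17 / 2 * \<alpha>\<^sup>2 * (L * real m2 / real n)"
proof -
  let ?M = "real (max m1 m2)"
  have M: "0 < ?M" using m by auto
  have "(\<Sum>k=1..m2. (\<omega> k)\<^sup>2 / (\<kappa> k)\<^sup>2) \<le> (\<Sum>k=1..m2. (2 * \<alpha> * C1)\<^sup>2 * (?M powr (\<alpha> + 1))\<^sup>2 * ((\<omega> k)\<^sup>2 / (real k)\<^sup>2))"
  proof (rule sum_mono)
    fix k assume k: "k \<in> {1..m2}"
    have "(1 / \<kappa> k)\<^sup>2 \<le> (2 * \<alpha> * C1 * (?M powr (\<alpha> + 1) / real k))\<^sup>2"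
    proof (rule power_mono)
      have "real k powr \<alpha> = real k powr (\<alpha> + 1) / real k" using k by (simp add: powr_add)
      also have "\<dots> \<le> ?M powr (\<alpha> + 1) / real k"
        using k alpha by (intro divide_right_mono powr_mono2) auto
      finally have "real k powr \<alpha> \<le> ?M powr (\<alpha> + 1) / real k" .
      then have "2 * \<alpha> * C1 * real k powr \<alpha> \<le> 2 * \<alpha> * C1 * (?M powr (\<alpha> + 1) / real k)"
        using alpha C1 by (intro mult_left_mono) auto
      then show "1 / \<kappa> k \<le> 2 * \<alpha> * C1 * (?M powr (\<alpha> + 1) / real k)"
        using inverse_kappa_le[of k] k by simp
      show "0 \<le> 1 / \<kappa> k" using pos[of k] k by simp
    qed
    then have "(\<omega> k)\<^sup>2 * (1 / \<kappa> k)\<^sup>2 \<le> (\<omega> k)\<^sup>2 * (2 * \<alpha> * C1 * (?M powr (\<alpha> + 1) / real k))\<^sup>2"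
      by (intro mult_left_mono) auto
    then show "(\<omega> k)\<^sup>2 / (\<kappa> k)\<^sup>2 \<le> (2 * \<alpha> * C1)\<^sup>2 * (?M powr (\<alpha> + 1))\<^sup>2 * ((\<omega> k)\<^sup>2 / (real k)\<^sup>2)"
      by (simp add: power_divide power_mult_distrib mult_ac)
  qed
  also have "\<dots> \<le> (2 * \<alpha> * C1)\<^sup>2 * (?M powr (\<alpha> + 1))\<^sup>2 * (34 * (L * real m2 / real n))"
    unfolding sum_distrib_left[symmetric] by (intro mult_left_mono dev_sum_le) auto
  finally have "L / real n * (\<Sum>k=1..m2. (\<omega> k)\<^sup>2 / (\<kappa> k)\<^sup>2)
      \<le> gapM\<^sup>2 / 16 * ((2 * \<alpha> * C1)\<^sup>2 * (?M powr (\<alpha> + 1))\<^sup>2 * (34 * (L * real m2 / real n)))"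
    using Ln_le L by (intro mult_mono) (auto intro!: sum_nonneg)
  also have "\<dots> = (gapM * (?M powr (\<alpha> + 1) * C1))\<^sup>2 * (17 / 2 * \<alpha>\<^sup>2 * (L * real m2 / real n))"
    by (simp add: power_mult_distrib power_divide mult_ac)
  also have "gapM * (?M powr (\<alpha> + 1) * C1) = 1"
  proof -
    have "?M powr (- \<alpha> - 1) * ?M powr (\<alpha> + 1) = 1" using M by (simp add: powr_add[symmetric] less_max_iff_disj)
    then show ?thesis using C1 by simp
  qed
  finally show ?thesis by simp
qed

text \<open>The sample means hidden in \<open>S\<close> only multiply the leading terms by bounded factors,
  because \<open>L / n\<close> is at most \<open>L\<close>; what remains are the two sums of \<open>noise_bound\<close>.\<close>
lemma noise_error:
  "(l2norm unit_I2 (\<lambda>p. \<Sum>(j, k)\<in>{1..m1} \<times> {1..m2}.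
        l2inner unit_I2 S (tensor (\<phi>' j) (\<phi>' k)) / \<kappa>' k * tensor (\<phi>' j) (\<phi>' k) p))\<^sup>2
    \<le> 8 * ((2 * L + 2 * L\<^sup>2) + (2 + 2 * L) * (17 / 2 * \<alpha>\<^sup>2 * L)) * (real m2 powr (\<alpha> + 1) / real n)"
proof -
  let ?a = "real m2 powr (\<alpha> + 1) / real n"
  have Ln: "L / real n \<le> L" using L n by (simp add: divide_le_eq)
  have slice_S: "(l2norm unit_I (slice unit_I S (\<phi> k)))\<^sup>2
      \<le> 2 * (l2norm unit_I (slice unit_I S0 (\<phi> k)))\<^sup>2 + 2 * (L * (l2inner unit_I xbar (\<phi> k))\<^sup>2)" if k: "1 \<le> k" for k
  proof -
    have k_L2: "\<phi> k \<in> L2 unit_I" by (rule L2_onb_in_L2[OF onb k])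
    have "AE s in unit_I. slice unit_I S (\<phi> k) s = slice unit_I S0 (\<phi> k) s - l2inner unit_I xbar (\<phi> k) * ebar s"
      using AE_slice_in_L2[OF sf sf S0]
    proof eventually_elim
      case (elim s)
      have "slice unit_I S (\<phi> k) s = slice unit_I S0 (\<phi> k) s - l2inner unit_I (\<lambda>t. ebar s * xbar t) (\<phi> k)"
        unfolding slice_def S_def tensor_apply using elim k_L2
        by (intro l2inner_diff_left L2_scale xbar)
      then show ?case by (subst (asm) l2inner_scale_left) (simp add: mult.commute)
    qed
    then have "l2norm unit_I (slice unit_I S (\<phi> k))
        = l2norm unit_I (\<lambda>s. slice unit_I S0 (\<phi> k) s - l2inner unit_I xbar (\<phi> k) * ebar s)"
      by (rule l2norm_cong_AE) (auto intro!: L2_measurable L2_intros slice_in_L2 sf S S0 k_L2 ebar)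
    then have "(l2norm unit_I (slice unit_I S (\<phi> k)))\<^sup>2 \<le> 2 * (l2norm unit_I (slice unit_I S0 (\<phi> k)))\<^sup>2
        + 2 * (l2norm unit_I (\<lambda>s. l2inner unit_I xbar (\<phi> k) * ebar s))\<^sup>2"
      by (simp only:) (intro l2norm_diff_power2_le_twice L2_intros slice_in_L2 sf S0 k_L2 ebar)
    also have "(l2norm unit_I (\<lambda>s. l2inner unit_I xbar (\<phi> k) * ebar s))\<^sup>2 = (l2norm unit_I ebar)\<^sup>2 * (l2inner unit_I xbar (\<phi> k))\<^sup>2"
      by (simp add: l2norm_scale power_mult_distrib)
    also have "\<dots> \<le> L * (l2inner unit_I xbar (\<phi> k))\<^sup>2"
      using noise_mean_stat Ln by (intro mult_right_mono) auto
    finally show ?thesis by simp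
  qed
  have "(\<Sum>k=1..m2. (l2norm unit_I (slice unit_I S (\<phi> k)))\<^sup>2 / (\<kappa> k)\<^sup>2)
      \<le> (\<Sum>k=1..m2. (2 * (l2norm unit_I (slice unit_I S0 (\<phi> k)))\<^sup>2 + 2 * (L * (l2inner unit_I xbar (\<phi> k))\<^sup>2)) / (\<kappa> k)\<^sup>2)"
    by (intro sum_mono divide_right_mono slice_S) auto
  also have "\<dots> = 2 * (\<Sum>k=1..m2. (l2norm unit_I (slice unit_I S0 (\<phi> k)))\<^sup>2 / (\<kappa> k)\<^sup>2)
      + 2 * (L * (\<Sum>k=1..m2. (l2inner unit_I xbar (\<phi> k))\<^sup>2 / (\<kappa> k)\<^sup>2))"
    by (simp add: sum_distrib_left sum.distrib add_divide_distrib)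
  also have "\<dots> \<le> 2 * (L * ?a) + 2 * (L * (L * ?a))"
    using noise_coef_stat mean_coef_stat L by (intro add_mono mult_left_mono) auto
  finally have A: "(\<Sum>k=1..m2. (l2norm unit_I (slice unit_I S (\<phi> k)))\<^sup>2 / (\<kappa> k)\<^sup>2) \<le> (2 * L + 2 * L\<^sup>2) * ?a"
    by (simp add: power2_eq_square algebra_simps)
  have "(l2norm unit_I2 S)\<^sup>2 \<le> 2 * (l2norm unit_I2 S0)\<^sup>2 + 2 * (l2norm unit_I2 (tensor ebar xbar))\<^sup>2"
    unfolding S_def by (intro l2norm_diff_power2_le_twice S0 tensor_in_L2 sf ebar xbar)
  also have "(l2norm unit_I2 (tensor ebar xbar))\<^sup>2 = (l2norm unit_I ebar)\<^sup>2 * (l2norm unit_I xbar)\<^sup>2"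
    by (simp add: l2norm_tensor sf ebar xbar power_mult_distrib)
  also have "\<dots> \<le> L * (L / real n)"
    using noise_mean_stat mean_stat Ln L by (intro mult_mono) auto
  finally have "(l2norm unit_I2 S)\<^sup>2 \<le> 2 * (l2norm unit_I2 S0)\<^sup>2 + 2 * (L * (L / real n))" by simp
  moreover have "(2 + 2 * L) * (L / real n) = 2 * (L / real n) + 2 * (L * (L / real n))"
    by (simp only: distrib_right mult.assoc)
  ultimately have "(l2norm unit_I2 S)\<^sup>2 \<le> (2 + 2 * L) * (L / real n)"
    using noise_stat by linarith
  then have "(l2norm unit_I2 S)\<^sup>2 * (\<Sum>k=1..m2. (\<omega> k)\<^sup>2 / (\<kappa> k)\<^sup>2)
      \<le> (2 + 2 * L) * (L / real n) * (\<Sum>k=1..m2. (\<omega> k)\<^sup>2 / (\<kappa> k)\<^sup>2)"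
    by (intro mult_right_mono sum_nonneg) auto
  also have "\<dots> \<le> (2 + 2 * L) * (17 / 2 * \<alpha>\<^sup>2 * (L * real m2 / real n))"
    using L dev_over_kappa_le unfolding mult.assoc by (intro mult_left_mono) (auto simp: mult.assoc)
  also have "\<dots> = (2 + 2 * L) * (17 / 2 * \<alpha>\<^sup>2 * L) * (real m2 / real n)" by simp
  also have "\<dots> \<le> (2 + 2 * L) * (17 / 2 * \<alpha>\<^sup>2 * L) * ?a"
    using L m alpha powr_mono[of 1 "\<alpha> + 1" "real m2"] by (intro mult_left_mono divide_right_mono) auto
  finally have B: "(l2norm unit_I2 S)\<^sup>2 * (\<Sum>k=1..m2. (\<omega> k)\<^sup>2 / (\<kappa> k)\<^sup>2) \<le> (2 + 2 * L) * (17 / 2 * \<alpha>\<^sup>2 * L) * ?a" .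
  have "8 * ((\<Sum>k=1..m2. (l2norm unit_I (slice unit_I S (\<phi> k)))\<^sup>2 / (\<kappa> k)\<^sup>2)
        + (l2norm unit_I2 S)\<^sup>2 * (\<Sum>k=1..m2. (\<omega> k)\<^sup>2 / (\<kappa> k)\<^sup>2))
      \<le> 8 * ((2 * L + 2 * L\<^sup>2) + (2 + 2 * L) * (17 / 2 * \<alpha>\<^sup>2 * L)) * ?a"
    using A B unfolding mult.assoc[of 8] distrib_right[of _ _ ?a] by (intro mult_left_mono add_mono) auto
  then show ?thesis
    using noise_bound[OF sf onb onb' S, of m2 \<kappa> \<kappa>' m1] pos kappa'_ge by (auto intro: order_trans)
qed

lemma projection_error_le:
  "(l2norm unit_I2 (\<lambda>p. b p - kernel_proj unit_I m1 m2 \<phi>' b p))\<^sup>2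
    \<le> 3 * (C1\<^sup>2 * (zeta_sum (2 * \<gamma>) / (2 * \<beta> - 1) * real m2 powr (- 2 * \<beta> + 1)
          + zeta_sum (2 * \<beta>) / (2 * \<gamma> - 1) * real m1 powr (- 2 * \<gamma> + 1)))
      + 3 * (C1\<^sup>2 * (zeta_sum \<beta>)\<^sup>2 * (zeta_sum (2 * \<gamma> - 2) * (34 * (L * real m1 / real n))))
      + 3 * (C1\<^sup>2 * (zeta_sum \<gamma>)\<^sup>2 * (zeta_sum (2 * \<beta> - 2) * (34 * (L * real m2 / real n))))"
proof -
  define R where "R = l2norm unit_I2 (\<lambda>p. b p - kernel_proj unit_I m1 m2 \<phi> b p)"
  define A where "A = C1 * zeta_sum \<beta> * (\<Sum>j=1..m1. real j powr (- \<gamma>) * \<omega> j)"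
  define B where "B = C1 * zeta_sum \<gamma> * (\<Sum>k=1..m2. real k powr (- \<beta>) * \<omega> k)"
  have \<omega>: "0 \<le> \<omega> j" for j by (rule eigen_dev_nonneg)
  have "(\<Sum>j=1..m1. \<Sum>k=1..m2. \<bar>l2inner unit_I2 b (tensor (\<phi> j) (\<phi> k))\<bar> * (\<omega> j + \<omega> k))
      \<le> (\<Sum>j=1..m1. \<Sum>k=1..m2. C1 * real j powr (- \<gamma>) * real k powr (- \<beta>) * (\<omega> j + \<omega> k))"
    by (intro sum_mono mult_right_mono b_decay add_nonneg_nonneg \<omega>) auto
  also have "\<dots> = (\<Sum>j=1..m1. \<Sum>k=1..m2. C1 * ((real j powr (- \<gamma>) * \<omega> j) * real k powr (- \<beta>)))
      + (\<Sum>j=1..m1. \<Sum>k=1..m2. C1 * (real j powr (- \<gamma>) * (real k powr (- \<beta>) * \<omega> k)))"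
    unfolding sum.distrib[symmetric] by (intro sum.cong refl) (simp add: algebra_simps)
  also have "\<dots> = C1 * ((\<Sum>j=1..m1. real j powr (- \<gamma>) * \<omega> j) * (\<Sum>k=1..m2. real k powr (- \<beta>)))
      + C1 * ((\<Sum>j=1..m1. real j powr (- \<gamma>)) * (\<Sum>k=1..m2. real k powr (- \<beta>) * \<omega> k))"
    by (simp only: sum_product) (simp only: sum_distrib_left)
  also have "\<dots> \<le> C1 * ((\<Sum>j=1..m1. real j powr (- \<gamma>) * \<omega> j) * zeta_sum \<beta>)
      + C1 * (zeta_sum \<gamma> * (\<Sum>k=1..m2. real k powr (- \<beta>) * \<omega> k))"
    using beta gamma C1 \<omega>
    by (intro add_mono mult_left_mono mult_right_mono sum_powr_le_zeta_sum sum_nonneg) auto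
  also have "\<dots> = A + B" by (simp add: A_def B_def mult_ac)
  finally have "(\<Sum>j=1..m1. \<Sum>k=1..m2. \<bar>l2inner unit_I2 b (tensor (\<phi> j) (\<phi> k))\<bar> * (\<omega> j + \<omega> k)) \<le> A + B" .
  with projection_error[OF sf onb onb' b, of m1 m2]
  have "l2norm unit_I2 (\<lambda>p. b p - kernel_proj unit_I m1 m2 \<phi>' b p) \<le> R + A + B" by (simp add: R_def)
  then have "(l2norm unit_I2 (\<lambda>p. b p - kernel_proj unit_I m1 m2 \<phi>' b p))\<^sup>2 \<le> (R + A + B)\<^sup>2"
    by (intro power_mono) auto
  also have "\<dots> \<le> 3 * R\<^sup>2 + 3 * A\<^sup>2 + 3 * B\<^sup>2"
    using zero_le_power2[of "R - A"] zero_le_power2[of "R - B"] zero_le_power2[of "A - B"]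
    by (simp add: power2_eq_square algebra_simps)
  also have "R\<^sup>2 \<le> C1\<^sup>2 * (zeta_sum (2 * \<gamma>) / (2 * \<beta> - 1) * real m2 powr (- 2 * \<beta> + 1)
          + zeta_sum (2 * \<beta>) / (2 * \<gamma> - 1) * real m1 powr (- 2 * \<gamma> + 1))"
    unfolding R_def using beta gamma m by (intro truncation_error sf onb b b_decay) auto
  also have "A\<^sup>2 \<le> C1\<^sup>2 * (zeta_sum \<beta>)\<^sup>2 * (zeta_sum (2 * \<gamma> - 2) * (34 * (L * real m1 / real n)))"
    unfolding A_def power_mult_distrib using gamma by (intro mult_left_mono weighted_dev_sum_le) auto
  also have "B\<^sup>2 \<le> C1\<^sup>2 * (zeta_sum \<gamma>)\<^sup>2 * (zeta_sum (2 * \<beta> - 2) * (34 * (L * real m2 / real n)))"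
    unfolding B_def power_mult_distrib using beta by (intro mult_left_mono weighted_dev_sum_le) auto
  finally show ?thesis by simp
qed

lemma risk_bound:
  "(l2norm unit_I2 (\<lambda>p. b_tilde n m1 m2 x y \<kappa>' \<phi>' d p - b p))\<^sup>2
    \<le> risk_const \<alpha> \<beta> \<gamma> C1 L * ((real m1 + real m2 powr (\<alpha> + 1)) / real n
        + real m1 powr (- 2 * \<gamma> + 1) + real m2 powr (- 2 * \<beta> + 1))"
proof -
  define N where "N = (\<lambda>p. \<Sum>(j, k)\<in>{1..m1} \<times> {1..m2}.
        l2inner unit_I2 S (tensor (\<phi>' j) (\<phi>' k)) / \<kappa>' k * tensor (\<phi>' j) (\<phi>' k) p)"
  define r where "r = (\<lambda>p. b p - kernel_proj unit_I m1 m2 \<phi>' b p)"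
  have \<phi>'_L2: "\<phi>' j \<in> L2 unit_I" if "1 \<le> j" for j by (rule L2_onb_in_L2[OF onb' that])
  have N: "N \<in> L2 unit_I2" unfolding N_def case_prod_unfold
    by (intro L2_intros tensor_in_L2 sf) (auto intro!: \<phi>'_L2)
  have r: "r \<in> L2 unit_I2" unfolding r_def by (intro L2_diff b kernel_proj_in_L2 sf onb')
  have "b_tilde n m1 m2 x y \<kappa>' \<phi>' d p = kernel_proj unit_I m1 m2 \<phi>' b p + N p" for p
  proof -
    have "b_tilde n m1 m2 x y \<kappa>' \<phi>' d p
        = (\<Sum>(j, k)\<in>{1..m1} \<times> {1..m2}. b_tilde_coeff n x y \<kappa>' \<phi>' d j k * tensor (\<phi>' j) (\<phi>' k) p)"
      by (simp add: b_tilde_def sum.cartesian_product)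
    also have "\<dots> = (\<Sum>(j, k)\<in>{1..m1} \<times> {1..m2}. (l2inner unit_I2 b (tensor (\<phi>' j) (\<phi>' k))
        + l2inner unit_I2 S (tensor (\<phi>' j) (\<phi>' k)) / \<kappa>' k) * tensor (\<phi>' j) (\<phi>' k) p)"
    proof (intro sum.cong refl, clarify)
      fix j k assume "j \<in> {1..m1}" "k \<in> {1..m2}"
      then have jk: "1 \<le> j" "1 \<le> k" "k \<le> m2" by auto
      have "\<kappa>' k \<noteq> 0" using kappa'_ge[OF jk(2,3)] pos[OF jk(2)] by auto
      from empirical_coefficient[OF spec' jk(1,2) this]
      show "b_tilde_coeff n x y \<kappa>' \<phi>' d j k * tensor (\<phi>' j) (\<phi>' k) p = (l2inner unit_I2 b (tensor (\<phi>' j) (\<phi>' k))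
        + l2inner unit_I2 S (tensor (\<phi>' j) (\<phi>' k)) / \<kappa>' k) * tensor (\<phi>' j) (\<phi>' k) p" by simp
    qed
    finally show ?thesis
      by (simp add: kernel_proj_def N_def case_prod_unfold distrib_right sum.distrib)
  qed
  then have "(\<lambda>p. b_tilde n m1 m2 x y \<kappa>' \<phi>' d p - b p) = (\<lambda>p. N p - r p)" by (simp add: r_def fun_eq_iff)
  then have "(l2norm unit_I2 (\<lambda>p. b_tilde n m1 m2 x y \<kappa>' \<phi>' d p - b p))\<^sup>2
      \<le> 2 * (l2norm unit_I2 N)\<^sup>2 + 2 * (l2norm unit_I2 r)\<^sup>2"
    by (simp only:) (intro l2norm_diff_power2_le_twice N r)
  also note noise_error[folded N_def]
  also note projection_error_le[folded r_def]
  finally have main: "(l2norm unit_I2 (\<lambda>p. b_tilde n m1 m2 x y \<kappa>' \<phi>' d p - b p))\<^sup>2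
    \<le> 2 * (8 * ((2 * L + 2 * L\<^sup>2) + (2 + 2 * L) * (17 / 2 * \<alpha>\<^sup>2 * L)) * (real m2 powr (\<alpha> + 1) / real n))
      + 2 * (3 * (C1\<^sup>2 * (zeta_sum (2 * \<gamma>) / (2 * \<beta> - 1) * real m2 powr (- 2 * \<beta> + 1)
          + zeta_sum (2 * \<beta>) / (2 * \<gamma> - 1) * real m1 powr (- 2 * \<gamma> + 1)))
      + 3 * (C1\<^sup>2 * (zeta_sum \<beta>)\<^sup>2 * (zeta_sum (2 * \<gamma> - 2) * (34 * (L * real m1 / real n))))
      + 3 * (C1\<^sup>2 * (zeta_sum \<gamma>)\<^sup>2 * (zeta_sum (2 * \<beta> - 2) * (34 * (L * real m2 / real n)))))"
    by simp
  define a where "a = real m1 / real n"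
  define c where "c = real m2 powr (\<alpha> + 1) / real n"
  define e where "e = real m1 powr (- 2 * \<gamma> + 1)"
  define f where "f = real m2 powr (- 2 * \<beta> + 1)"
  have nn: "0 \<le> a" "0 \<le> c" "0 \<le> e" "0 \<le> f" by (simp_all add: a_def c_def e_def f_def)
  define c' where "c' = real m2 / real n"
  have m2c: "c' \<le> c"
    using m alpha powr_mono[of 1 "\<alpha> + 1" "real m2"]
    by (auto simp: c_def c'_def intro!: divide_right_mono)
  define Z where "Z = 8 * ((2 * L + 2 * L\<^sup>2) + (2 + 2 * L) * (17 / 2 * \<alpha>\<^sup>2 * L))"
  define z1 where "z1 = zeta_sum (2 * \<gamma>) / (2 * \<beta> - 1)"
  define z2 where "z2 = zeta_sum (2 * \<beta>) / (2 * \<gamma> - 1)"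
  define z3 where "z3 = (zeta_sum \<beta>)\<^sup>2 * zeta_sum (2 * \<gamma> - 2)"
  define z4 where "z4 = (zeta_sum \<gamma>)\<^sup>2 * zeta_sum (2 * \<beta> - 2)"
  have zn: "0 \<le> Z" "0 \<le> z1" "0 \<le> z2" "0 \<le> z3" "0 \<le> z4"
    using L beta gamma by (simp_all add: Z_def z1_def z2_def z3_def z4_def zeta_sum_nonneg)
  have "2 * (Z * c) + 2 * (3 * (C1\<^sup>2 * (z1 * f + z2 * e)) + 3 * (34 * C1\<^sup>2 * L * z3 * a) + 3 * (34 * C1\<^sup>2 * L * z4 * c'))
      \<le> (6 * C1\<^sup>2 * (z1 + z2) + 204 * C1\<^sup>2 * L * (z3 + z4) + 2 * Z) * (a + c + e + f)"
  proof -
    have "C1\<^sup>2 * L * z4 * c' \<le> C1\<^sup>2 * L * z4 * c"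
      using m2c zn L by (intro mult_left_mono) auto
    moreover have "0 \<le> C1\<^sup>2 * z1 * (a + c + e)" "0 \<le> C1\<^sup>2 * z2 * (a + c + f)" "0 \<le> C1\<^sup>2 * L * z3 * (c + e + f)"
      "0 \<le> C1\<^sup>2 * L * z4 * (a + e + f)" "0 \<le> Z * (a + e + f)"
      using zn nn L by simp_all
    ultimately show ?thesis by (simp add: algebra_simps)
  qed
  moreover have "(l2norm unit_I2 (\<lambda>p. b_tilde n m1 m2 x y \<kappa>' \<phi>' d p - b p))\<^sup>2
     \<le> 2 * (Z * c) + 2 * (3 * (C1\<^sup>2 * (z1 * f + z2 * e)) + 3 * (34 * C1\<^sup>2 * L * z3 * a) + 3 * (34 * C1\<^sup>2 * L * z4 * c'))"
    using main by (simp add: Z_def c_def c'_def z1_def z2_def z3_def z4_def a_def e_def f_def mult_ac)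
  moreover have "risk_const \<alpha> \<beta> \<gamma> C1 L = 6 * C1\<^sup>2 * (z1 + z2) + 204 * C1\<^sup>2 * L * (z3 + z4) + 2 * Z"
    by (simp add: risk_const_def Z_def z1_def z2_def z3_def z4_def)
  moreover have "(real m1 + real m2 powr (\<alpha> + 1)) / real n = a + c"
    by (simp add: a_def c_def add_divide_distrib)
  ultimately show ?thesis by (simp add: e_def f_def add.assoc)
qed

end

end

section \<open>Random elements of L2\<close>

lemma space_L2_borel: "space (L2_borel \<mu>) = L2 \<mu>"
  unfolding L2_borel_def by (rule space_measure_of) auto

text \<open>By Cauchy-Schwarz the functional is continuous, so preimages of open sets belong to the
  generator.\<close>
lemma l2inner_measurable_L2_borel:
  assumes g: "g \<in> L2 \<mu>"
  shows "(\<lambda>f. l2inner \<mu> f g) \<in> borel_measurable (L2_borel \<mu>)"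
proof (rule borel_measurableI)
  fix V :: "real set" assume V: "open V"
  let ?U = "(\<lambda>f. l2inner \<mu> f g) -` V \<inter> space (L2_borel \<mu>)"
  have "\<exists>e>0. \<forall>h\<in>L2 \<mu>. l2norm \<mu> (\<lambda>x. h x - f x) < e \<longrightarrow> h \<in> ?U" if "f \<in> ?U" for f
  proof -
    from that have f: "f \<in> L2 \<mu>" "l2inner \<mu> f g \<in> V" by (auto simp: space_L2_borel)
    from V f(2) obtain e where e: "0 < e" "ball (l2inner \<mu> f g) e \<subseteq> V" by (meson openE)
    define d where "d = e / (l2norm \<mu> g + 1)"
    have pos: "0 < l2norm \<mu> g + 1" by (rule add_nonneg_pos) auto
    have "h \<in> ?U" if h: "h \<in> L2 \<mu>" "l2norm \<mu> (\<lambda>x. h x - f x) < d" for h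
    proof -
      have "\<bar>l2inner \<mu> h g - l2inner \<mu> f g\<bar> \<le> l2norm \<mu> (\<lambda>x. h x - f x) * l2norm \<mu> g"
        using Cauchy_Schwarz_l2inner[OF L2_diff[OF h(1) f(1)] g] h f g by (simp add: l2inner_diff_left)
      also have "\<dots> \<le> l2norm \<mu> (\<lambda>x. h x - f x) * (l2norm \<mu> g + 1)" by (intro mult_left_mono) auto
      also have "\<dots> < e" using h(2) pos by (simp add: d_def pos_less_divide_eq)
      finally have "l2inner \<mu> h g \<in> ball (l2inner \<mu> f g) e" by (simp add: dist_real_def abs_minus_commute)
      with e h show ?thesis by (auto simp: space_L2_borel)
    qed
    moreover have "0 < d" using e pos by (simp add: d_def)
    ultimately show ?thesis by blast
  qed
  then have "?U \<in> {U. U \<subseteq> L2 \<mu> \<and>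
         (\<forall>f\<in>U. \<exists>e>0. \<forall>g\<in>L2 \<mu>. l2norm \<mu> (\<lambda>x. g x - f x) < e \<longrightarrow> g \<in> U)}"
    by (auto simp: space_L2_borel)
  then show "?U \<in> sets (L2_borel \<mu>)"
    unfolding L2_borel_def by (subst sets_measure_of) (auto intro!: sigma_sets.Basic)
qed

lemma L2_random_variable_in_L2:
  "L2_random_variable M X \<Longrightarrow> \<omega> \<in> space M \<Longrightarrow> X \<omega> \<in> L2 unit_I"
  using measurable_space[of X M "L2_borel unit_I"] by (auto simp: L2_random_variable_def space_L2_borel)

lemma L2_random_variable_joint:
  assumes "prob_space M" and X: "L2_random_variable M X"
    and X2: "integrable M (\<lambda>\<omega>. (l2norm unit_I (X \<omega>))\<^sup>2)"
  shows "(\<lambda>(\<omega>, t). X \<omega> t) \<in> L2 (M \<Otimes>\<^sub>M unit_I)"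
proof -
  interpret prob_space M by fact
  interpret I: finite_measure unit_I by (rule finite_measure_unit_I)
  interpret pair_sigma_finite M unit_I ..
  have meas [measurable]: "(\<lambda>(\<omega>, t). X \<omega> t) \<in> borel_measurable (M \<Otimes>\<^sub>M unit_I)"
    using X by (simp add: L2_random_variable_def)
  have "integrable (M \<Otimes>\<^sub>M unit_I) (\<lambda>p. ((\<lambda>(\<omega>, t). X \<omega> t) p)\<^sup>2)"
  proof (rule Fubini_integrable)
    show "integrable M (\<lambda>\<omega>. \<integral>t. norm (((\<lambda>(\<omega>, t). X \<omega> t) (\<omega>, t))\<^sup>2) \<partial>unit_I)"
      using X2 by (simp add: l2norm_power2_integral)
    show "AE \<omega> in M. integrable unit_I (\<lambda>t. ((\<lambda>(\<omega>, t). X \<omega> t) (\<omega>, t))\<^sup>2)"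
      using L2_square_integrable[OF L2_random_variable_in_L2[OF X]] by (intro AE_I2) simp
  qed measurable
  then show ?thesis by (simp add: L2_def)
qed

text \<open>From here on a random element is a square-integrable function \<open>Z\<close> of the sample point and
  the argument, so that expectations of inner products are inner products on the product space.\<close>

locale L2_process = prob_space M for M :: "'w measure" +
  fixes Z :: "'w \<Rightarrow> real \<Rightarrow> real"
  assumes joint: "(\<lambda>(\<omega>, t). Z \<omega> t) \<in> L2 (M \<Otimes>\<^sub>M unit_I)"
begin

lemmas sfI = sigma_finite_unit_I
lemma sfM: "sigma_finite_measure M" ..

lemma slice_joint: "slice unit_I (\<lambda>(\<omega>, t). Z \<omega> t) f = (\<lambda>\<omega>. l2inner unit_I (Z \<omega>) f)"
  by (simp add: slice_def)

lemma inner_in_L2: "f \<in> L2 unit_I \<Longrightarrow> (\<lambda>\<omega>. l2inner unit_I (Z \<omega>) f) \<in> L2 M"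
  using slice_in_L2(1)[OF sfM sfI joint, of f] by (simp add: slice_joint)

lemma AE_in_L2: "AE \<omega> in M. Z \<omega> \<in> L2 unit_I"
  using AE_slice_in_L2[OF sfM sfI joint] by simp

lemma swap: "(\<lambda>(t, \<omega>). Z \<omega> t) \<in> L2 (unit_I \<Otimes>\<^sub>M M)"
  using swap_in_L2[OF sfM sfI joint] by (simp add: case_prod_unfold)

definition weighted_mean :: "('w \<Rightarrow> real) \<Rightarrow> real \<Rightarrow> real" where
  "weighted_mean h = (\<lambda>t. \<integral>\<omega>. Z \<omega> t * h \<omega> \<partial>M)"

lemma weighted_mean_eq_slice: "weighted_mean h = slice M (\<lambda>(t, \<omega>). Z \<omega> t) h"
  by (simp add: weighted_mean_def slice_def l2inner_def)

lemma weighted_mean_in_L2: "h \<in> L2 M \<Longrightarrow> weighted_mean h \<in> L2 unit_I"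
  unfolding weighted_mean_eq_slice by (rule slice_in_L2(1)[OF sfI sfM swap])

lemma l2inner_weighted_mean:
  assumes h: "h \<in> L2 M" and f: "f \<in> L2 unit_I"
  shows "l2inner unit_I (weighted_mean h) f = (\<integral>\<omega>. l2inner unit_I (Z \<omega>) f * h \<omega> \<partial>M)"
proof -
  have "l2inner unit_I (weighted_mean h) f = l2inner (unit_I \<Otimes>\<^sub>M M) (\<lambda>(t, \<omega>). Z \<omega> t) (tensor f h)"
    unfolding weighted_mean_eq_slice by (rule l2inner_slice[OF sfI sfM swap f h])
  also have "\<dots> = l2inner (M \<Otimes>\<^sub>M unit_I) (\<lambda>(\<omega>, t). Z \<omega> t) (tensor h f)"
    using l2inner_swap[OF sfM sfI joint h f] by (simp add: case_prod_unfold)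
  also have "\<dots> = l2inner M (\<lambda>\<omega>. l2inner unit_I (Z \<omega>) f) h"
    using l2inner_slice[OF sfM sfI joint h f] by (simp add: slice_joint)
  finally show ?thesis by (simp add: l2inner_def[of M])
qed

lemma mean_fun_eq: "mean_fun M Z = weighted_mean (\<lambda>_. 1)"
  by (simp add: mean_fun_def weighted_mean_def)

lemma mean_in_L2: "mean_fun M Z \<in> L2 unit_I"
  unfolding mean_fun_eq by (intro weighted_mean_in_L2 L2_const)

lemma l2inner_mean: "f \<in> L2 unit_I \<Longrightarrow> l2inner unit_I (mean_fun M Z) f = (\<integral>\<omega>. l2inner unit_I (Z \<omega>) f \<partial>M)"
  unfolding mean_fun_eq by (subst l2inner_weighted_mean) (auto intro: L2_const)

lemma norm_integrable: "integrable M (\<lambda>\<omega>. (l2norm unit_I (Z \<omega>))\<^sup>2)"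
proof -
  interpret I: finite_measure unit_I by (rule finite_measure_unit_I)
  interpret pair_sigma_finite M unit_I ..
  show ?thesis
    using integrable_fst'[OF L2_square_integrable[OF joint]] by (simp add: l2norm_power2_integral)
qed

lemma minus_const:
  assumes m: "m \<in> L2 unit_I"
  shows "L2_process M (\<lambda>\<omega> t. Z \<omega> t - m t)"
proof
  have "tensor (\<lambda>_. 1) m \<in> L2 (M \<Otimes>\<^sub>M unit_I)" by (intro tensor_in_L2 sfM sfI L2_const m)
  from L2_diff[OF joint this] show "(\<lambda>(\<omega>, t). Z \<omega> t - m t) \<in> L2 (M \<Otimes>\<^sub>M unit_I)"
    by (simp add: case_prod_unfold tensor_def)
qed

lemma minus:
  assumes "L2_process M Z'"
  shows "L2_process M (\<lambda>\<omega> t. Z \<omega> t - Z' \<omega> t)"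
proof
  interpret Z': L2_process M Z' by fact
  from L2_diff[OF joint Z'.joint] show "(\<lambda>(\<omega>, t). Z \<omega> t - Z' \<omega> t) \<in> L2 (M \<Otimes>\<^sub>M unit_I)"
    by (simp add: case_prod_unfold)
qed

definition second_moment :: "real \<times> real \<Rightarrow> real" where
  "second_moment = (\<lambda>(s, t). \<integral>\<omega>. Z \<omega> s * Z \<omega> t \<partial>M)"

text \<open>Pointwise Cauchy-Schwarz bounds the square by \<open>V s * V t\<close>, \<open>V\<close> being the integrable function of
  pointwise second moments.\<close>
lemma second_moment_in_L2: "second_moment \<in> L2 unit_I2"
proof -
  interpret I: finite_measure unit_I by (rule finite_measure_unit_I)
  interpret II: pair_sigma_finite unit_I unit_I ..
  interpret IM: pair_sigma_finite unit_I M ..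
  have [measurable]: "(\<lambda>p. Z (snd p) (fst p)) \<in> borel_measurable (unit_I \<Otimes>\<^sub>M M)"
    using L2_measurable[OF swap] by (simp add: case_prod_unfold)
  have m1 [measurable]: "(\<lambda>q. Z (snd q) (fst (fst q))) \<in> borel_measurable (unit_I2 \<Otimes>\<^sub>M M)"
    using measurable_compose[of "\<lambda>q. (fst (fst q), snd q)" "unit_I2 \<Otimes>\<^sub>M M" "unit_I \<Otimes>\<^sub>M M" "\<lambda>p. Z (snd p) (fst p)" borel] by simp
  have m2 [measurable]: "(\<lambda>q. Z (snd q) (snd (fst q))) \<in> borel_measurable (unit_I2 \<Otimes>\<^sub>M M)"
    using measurable_compose[of "\<lambda>q. (snd (fst q), snd q)" "unit_I2 \<Otimes>\<^sub>M M" "unit_I \<Otimes>\<^sub>M M" "\<lambda>p. Z (snd p) (fst p)" borel] by simp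
  have meas [measurable]: "second_moment \<in> borel_measurable unit_I2"
  proof -
    have "(\<lambda>(p, \<omega>). Z \<omega> (fst p) * Z \<omega> (snd p)) \<in> borel_measurable (unit_I2 \<Otimes>\<^sub>M M)"
      using borel_measurable_times[OF m1 m2] by (simp add: case_prod_unfold)
    from borel_measurable_lebesgue_integral[OF this] show ?thesis
      by (simp add: second_moment_def case_prod_unfold)
  qed
  define V where "V s = (\<integral>\<omega>. (Z \<omega> s)\<^sup>2 \<partial>M)" for s
  have V_int: "integrable unit_I V"
    using IM.integrable_fst'[OF L2_square_integrable[OF swap]] by (simp add: V_def[abs_def])
  have V_nonneg: "0 \<le> V s" for s by (simp add: V_def)
  note [measurable] = borel_measurable_integrable[OF V_int]
  have sec: "AE s in unit_I. (\<lambda>\<omega>. Z \<omega> s) \<in> L2 M"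
    using AE_slice_in_L2[OF sfI sfM swap] by simp
  have prod_int: "integrable unit_I2 (\<lambda>p. V (fst p) * V (snd p))"
    using V_int V_nonneg by (intro II.Fubini_integrable) auto
  have "AE p in unit_I2. (second_moment p)\<^sup>2 \<le> V (fst p) * V (snd p)"
  proof (rule II.AE_pair_measure)
    show "{p \<in> space unit_I2. (second_moment p)\<^sup>2 \<le> V (fst p) * V (snd p)} \<in> sets unit_I2"
      by measurable
    show "AE s in unit_I. AE t in unit_I. (second_moment (s, t))\<^sup>2 \<le> V (fst (s, t)) * V (snd (s, t))"
      using sec
    proof eventually_elim
      case (elim s)
      show ?case
        using sec
      proof eventually_elim
        case (elim t)
        from Cauchy_Schwarz_l2inner_power2[OF \<open>(\<lambda>\<omega>. Z \<omega> s) \<in> L2 M\<close> elim] show ?case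
          by (simp add: second_moment_def V_def l2inner_def power2_eq_square)
      qed
    qed
  qed
  then have "integrable unit_I2 (\<lambda>p. (second_moment p)\<^sup>2)"
    by (intro Bochner_Integration.integrable_bound[OF prod_int]) auto
  then show ?thesis by (simp add: L2_def)
qed

text \<open>Fubini, justified by the same computation for the absolute values: the integral of the absolute
  integrand over the square factorizes into two square-integrable random variables.\<close>
lemma l2inner_second_moment:
  assumes f: "f \<in> L2 unit_I" and g: "g \<in> L2 unit_I"
  shows "l2inner unit_I2 second_moment (tensor f g)
    = (\<integral>\<omega>. l2inner unit_I (Z \<omega>) f * l2inner unit_I (Z \<omega>) g \<partial>M)"
proof -
  interpret I: finite_measure unit_I by (rule finite_measure_unit_I)
  interpret II: pair_sigma_finite unit_I unit_I ..
  have sfII: "sigma_finite_measure unit_I2" by (rule II.sigma_finite_measure_axioms)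
  interpret MII: pair_sigma_finite M unit_I2 by (simp add: pair_sigma_finite_def sfII sfM)
  note [measurable] = L2_measurable[OF f] L2_measurable[OF g]
  have [measurable]: "(\<lambda>p. Z (fst p) (snd p)) \<in> borel_measurable (M \<Otimes>\<^sub>M unit_I)"
    using L2_measurable[OF joint] by (simp add: case_prod_unfold)
  have m1 [measurable]: "(\<lambda>q. Z (fst q) (fst (snd q))) \<in> borel_measurable (M \<Otimes>\<^sub>M unit_I2)"
    using measurable_compose[of "\<lambda>q. (fst q, fst (snd q))" "M \<Otimes>\<^sub>M unit_I2" "M \<Otimes>\<^sub>M unit_I" "\<lambda>p. Z (fst p) (snd p)" borel] by simp
  have m2 [measurable]: "(\<lambda>q. Z (fst q) (snd (snd q))) \<in> borel_measurable (M \<Otimes>\<^sub>M unit_I2)"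
    using measurable_compose[of "\<lambda>q. (fst q, snd (snd q))" "M \<Otimes>\<^sub>M unit_I2" "M \<Otimes>\<^sub>M unit_I" "\<lambda>p. Z (fst p) (snd p)" borel] by simp
  define F where "F = (\<lambda>q. tensor (Z (fst q)) (Z (fst q)) (snd q) * tensor f g (snd q))"
  have F_meas [measurable]: "F \<in> borel_measurable (M \<Otimes>\<^sub>M unit_I2)"
    unfolding F_def tensor_def case_prod_unfold by measurable
  have abs_process: "L2_process M (\<lambda>\<omega> t. \<bar>Z \<omega> t\<bar>)"
    by standard (use L2_abs[OF joint] in \<open>simp add: case_prod_unfold\<close>)
  interpret A: L2_process M "\<lambda>\<omega> t. \<bar>Z \<omega> t\<bar>" by (rule abs_process)
  have inner: "(\<integral>p. F (\<omega>, p) \<partial>unit_I2) = l2inner unit_I (Z \<omega>) f * l2inner unit_I (Z \<omega>) g"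
    "(\<integral>p. \<bar>F (\<omega>, p)\<bar> \<partial>unit_I2) = l2inner unit_I (\<lambda>t. \<bar>Z \<omega> t\<bar>) (\<lambda>t. \<bar>f t\<bar>) * l2inner unit_I (\<lambda>t. \<bar>Z \<omega> t\<bar>) (\<lambda>t. \<bar>g t\<bar>)"
    "integrable unit_I2 (\<lambda>p. F (\<omega>, p))"
    if z: "Z \<omega> \<in> L2 unit_I" for \<omega>
  proof -
    show "integrable unit_I2 (\<lambda>p. F (\<omega>, p))"
      unfolding F_def using z f g by (simp add: L2_mult_integrable tensor_in_L2 sfI)
    show "(\<integral>p. F (\<omega>, p) \<partial>unit_I2) = l2inner unit_I (Z \<omega>) f * l2inner unit_I (Z \<omega>) g"
      using l2inner_tensor_tensor[OF sfI sfI z z f g] by (simp add: F_def l2inner_def)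
    have "(\<integral>p. \<bar>F (\<omega>, p)\<bar> \<partial>unit_I2) = l2inner unit_I2 (tensor (\<lambda>t. \<bar>Z \<omega> t\<bar>) (\<lambda>t. \<bar>Z \<omega> t\<bar>)) (tensor (\<lambda>t. \<bar>f t\<bar>) (\<lambda>t. \<bar>g t\<bar>))"
      by (simp add: F_def l2inner_def tensor_def case_prod_unfold abs_mult)
    also have "\<dots> = l2inner unit_I (\<lambda>t. \<bar>Z \<omega> t\<bar>) (\<lambda>t. \<bar>f t\<bar>) * l2inner unit_I (\<lambda>t. \<bar>Z \<omega> t\<bar>) (\<lambda>t. \<bar>g t\<bar>)"
      using z f g by (intro l2inner_tensor_tensor sfI L2_abs)
    finally show "(\<integral>p. \<bar>F (\<omega>, p)\<bar> \<partial>unit_I2) = l2inner unit_I (\<lambda>t. \<bar>Z \<omega> t\<bar>) (\<lambda>t. \<bar>f t\<bar>) * l2inner unit_I (\<lambda>t. \<bar>Z \<omega> t\<bar>) (\<lambda>t. \<bar>g t\<bar>)" .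
  qed
  have F_int: "integrable (M \<Otimes>\<^sub>M unit_I2) F"
  proof (rule MII.Fubini_integrable[OF F_meas])
    have "integrable M (\<lambda>\<omega>. l2inner unit_I (\<lambda>t. \<bar>Z \<omega> t\<bar>) (\<lambda>t. \<bar>f t\<bar>) * l2inner unit_I (\<lambda>t. \<bar>Z \<omega> t\<bar>) (\<lambda>t. \<bar>g t\<bar>))"
      by (intro L2_mult_integrable A.inner_in_L2 L2_abs f g)
    moreover have "(\<lambda>\<omega>. \<integral>p. norm (F (\<omega>, p)) \<partial>unit_I2) \<in> borel_measurable M"
      using sfII by (intro sigma_finite_measure.borel_measurable_lebesgue_integral) (auto simp: case_prod_unfold)
    moreover have "AE \<omega> in M. l2inner unit_I (\<lambda>t. \<bar>Z \<omega> t\<bar>) (\<lambda>t. \<bar>f t\<bar>) * l2inner unit_I (\<lambda>t. \<bar>Z \<omega> t\<bar>) (\<lambda>t. \<bar>g t\<bar>)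
        = (\<integral>p. norm (F (\<omega>, p)) \<partial>unit_I2)"
      using AE_in_L2 by eventually_elim (simp add: inner)
    ultimately show "integrable M (\<lambda>\<omega>. \<integral>p. norm (F (\<omega>, p)) \<partial>unit_I2)"
      by (rule integrable_cong_AE_imp)
    show "AE \<omega> in M. integrable unit_I2 (\<lambda>p. F (\<omega>, p))"
      using AE_in_L2 by eventually_elim (rule inner)
  qed
  have "l2inner unit_I2 second_moment (tensor f g) = (\<integral>p. (\<integral>\<omega>. F (\<omega>, p) \<partial>M) \<partial>unit_I2)"
    by (simp add: l2inner_def second_moment_def F_def tensor_def case_prod_unfold)
  also have "\<dots> = (\<integral>\<omega>. (\<integral>p. F (\<omega>, p) \<partial>unit_I2) \<partial>M)"
    using MII.Fubini_integral[of "\<lambda>\<omega> p. F (\<omega>, p)"] F_int by simp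
  also have "\<dots> = (\<integral>\<omega>. l2inner unit_I (Z \<omega>) f * l2inner unit_I (Z \<omega>) g \<partial>M)"
  proof (rule integral_cong_AE)
    show "(\<lambda>\<omega>. \<integral>p. F (\<omega>, p) \<partial>unit_I2) \<in> borel_measurable M"
      using sfII by (intro sigma_finite_measure.borel_measurable_lebesgue_integral) (auto simp: case_prod_unfold)
    show "AE \<omega> in M. (\<integral>p. F (\<omega>, p) \<partial>unit_I2) = l2inner unit_I (Z \<omega>) f * l2inner unit_I (Z \<omega>) g"
      using AE_in_L2 by eventually_elim (rule inner)
  qed (use inner_in_L2[OF f, THEN L2_measurable] inner_in_L2[OF g, THEN L2_measurable] in measurable)
  finally show ?thesis .
qed

end

section \<open>Moments of sample averages\<close>

text \<open>Independence kills the mixed terms.  Extended nonnegative integrals are used so that the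
  identity can be summed over infinitely many functionals \<open>h\<close>.\<close>
lemma (in prob_space) iid_average_second_moment:
  fixes W :: "nat \<Rightarrow> 'a \<Rightarrow> 'c" and h :: "'c \<Rightarrow> real"
  assumes indep: "indep_vars (\<lambda>_. N) W {1..}"
    and ident: "\<And>i. 1 \<le> i \<Longrightarrow> distr M N (W i) = distr M N W0" and W0: "W0 \<in> measurable M N"
    and h: "h \<in> borel_measurable N" and sq: "integrable M (\<lambda>\<omega>. (h (W0 \<omega>))\<^sup>2)"
    and mean: "(\<integral>\<omega>. h (W0 \<omega>) \<partial>M) = 0" and n: "1 \<le> n"
  shows "(\<integral>\<^sup>+\<omega>. ennreal (((\<Sum>i=1..n. h (W i \<omega>)) / real n)\<^sup>2) \<partial>M)
    = ennreal (1 / real n) * (\<integral>\<^sup>+\<omega>. ennreal ((h (W0 \<omega>))\<^sup>2) \<partial>M)"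
proof -
  have W: "W i \<in> measurable M N" if "1 \<le> i" for i
    using indep that by (auto simp: indep_vars_def2)
  let ?H = "\<lambda>i \<omega>. h (W i \<omega>)"
  have meas: "?H i \<in> borel_measurable M" if "1 \<le> i" for i
    using measurable_compose[OF W[OF that] h] .
  have meas0: "(\<lambda>\<omega>. h (W0 \<omega>)) \<in> borel_measurable M" using measurable_compose[OF W0 h] .
  define v where "v = (\<integral>\<omega>. (h (W0 \<omega>))\<^sup>2 \<partial>M)"
  have sq_i: "integrable M (\<lambda>\<omega>. (?H i \<omega>)\<^sup>2)" "(\<integral>\<omega>. (?H i \<omega>)\<^sup>2 \<partial>M) = v"
    and mean_i: "(\<integral>\<omega>. ?H i \<omega> \<partial>M) = 0" if i: "1 \<le> i" for i
  proof -
    have h2: "(\<lambda>w. (h w)\<^sup>2) \<in> borel_measurable N" using h by measurable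
    show "integrable M (\<lambda>\<omega>. (?H i \<omega>)\<^sup>2)"
      using sq integrable_distr_eq[OF W[OF i] h2] integrable_distr_eq[OF W0 h2] ident[OF i] by simp
    show "(\<integral>\<omega>. (?H i \<omega>)\<^sup>2 \<partial>M) = v"
      using integral_distr[OF W[OF i] h2] integral_distr[OF W0 h2] ident[OF i] by (simp add: v_def)
    show "(\<integral>\<omega>. ?H i \<omega> \<partial>M) = 0"
      using integral_distr[OF W[OF i] h] integral_distr[OF W0 h] ident[OF i] mean by simp
  qed
  have L2: "?H i \<in> L2 M" if "1 \<le> i" for i using meas[OF that] sq_i(1)[OF that] by (simp add: L2_def)
  have cross: "(\<integral>\<omega>. ?H i \<omega> * ?H j \<omega> \<partial>M) = (if i = j then v else 0)" if "1 \<le> i" "1 \<le> j" for i j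
  proof (cases "i = j")
    case True
    then show ?thesis using sq_i(2)[OF that(1)] by (simp add: power2_eq_square)
  next
    case False
    have "indep_vars (\<lambda>_. borel) ?H {i, j}"
      using indep_vars_compose2[OF indep_vars_subset[OF indep, of "{i, j}"], of "\<lambda>_. h" "\<lambda>_. borel"] h that
      by auto
    then have "(\<integral>\<omega>. (\<Prod>k\<in>{i, j}. ?H k \<omega>) \<partial>M) = (\<Prod>k\<in>{i, j}. \<integral>\<omega>. ?H k \<omega> \<partial>M)"
      using that L2_integrable[OF L2] by (intro indep_vars_lebesgue_integral) auto
    then show ?thesis using False mean_i[OF that(1)] by simp
  qed
  have sum_L2: "(\<lambda>\<omega>. (\<Sum>i=1..n. ?H i \<omega>) / real n) \<in> L2 M"
    by (intro L2_divide L2_sum L2) auto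
  have "(\<integral>\<omega>. (\<Sum>i=1..n. ?H i \<omega>)\<^sup>2 \<partial>M) = (\<integral>\<omega>. (\<Sum>i=1..n. \<Sum>j=1..n. ?H i \<omega> * ?H j \<omega>) \<partial>M)"
    by (simp add: power2_eq_square sum_product)
  also have "\<dots> = (\<Sum>i=1..n. \<Sum>j=1..n. \<integral>\<omega>. ?H i \<omega> * ?H j \<omega> \<partial>M)"
    by (subst Bochner_Integration.integral_sum)
       (auto intro!: Bochner_Integration.integrable_sum L2_mult_integrable L2 sum.cong Bochner_Integration.integral_sum)
  also have "\<dots> = (\<Sum>i=1..n. \<Sum>j=1..n. if i = j then v else 0)"
    by (intro sum.cong refl cross) auto
  also have "\<dots> = real n * v" by (simp add: sum.delta')
  finally have "(\<integral>\<omega>. ((\<Sum>i=1..n. ?H i \<omega>) / real n)\<^sup>2 \<partial>M) = 1 / real n * v"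
    using n by (simp add: power_divide power2_eq_square)
  then have "(\<integral>\<^sup>+\<omega>. ennreal (((\<Sum>i=1..n. ?H i \<omega>) / real n)\<^sup>2) \<partial>M) = ennreal (1 / real n * v)"
    by (subst nn_integral_eq_integral[OF L2_square_integrable[OF sum_L2]]) auto
  also have "\<dots> = ennreal (1 / real n) * ennreal v" by (rule ennreal_mult) (simp_all add: v_def)
  also have "ennreal v = (\<integral>\<^sup>+\<omega>. ennreal ((h (W0 \<omega>))\<^sup>2) \<partial>M)"
    by (subst nn_integral_eq_integral[OF sq]) (auto simp: v_def)
  finally show ?thesis .
qed

section \<open>Moments in the functional linear model\<close>

text \<open>Depending on the two curves only, this expression of the regression error has the same law for
  every observation.\<close>

definition regression_residual ::
  "(real \<Rightarrow> real) \<Rightarrow> (real \<Rightarrow> real) \<Rightarrow> (real \<times> real \<Rightarrow> real) \<Rightarrow> (real \<Rightarrow> real) \<Rightarrow> (real \<Rightarrow> real) \<Rightarrow> real \<Rightarrow> real" where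
  "regression_residual mX mY b x y = (\<lambda>s. y s - mY s - slice unit_I b (\<lambda>t. x t - mX t) s)"

lemma l2inner_regression_residual_measurable:
  assumes mX: "mX \<in> L2 unit_I" and mY: "mY \<in> L2 unit_I" and b: "b \<in> L2 unit_I2" and f: "f \<in> L2 unit_I"
  shows "(\<lambda>(x, y). l2inner unit_I (regression_residual mX mY b x y) f)
    \<in> borel_measurable (L2_borel unit_I \<Otimes>\<^sub>M L2_borel unit_I)"
proof -
  note sf = sigma_finite_unit_I
  define g where "g = slice unit_I (\<lambda>(t, s). b (s, t)) f"
  have g: "g \<in> L2 unit_I" unfolding g_def by (intro slice_in_L2 swap_in_L2 sf b f)
  note [measurable] = l2inner_measurable_L2_borel[OF f] l2inner_measurable_L2_borel[OF g]
  have "l2inner unit_I (regression_residual mX mY b x y) f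
      = l2inner unit_I y f - l2inner unit_I mY f - (l2inner unit_I x g - l2inner unit_I mX g)"
    if x: "x \<in> L2 unit_I" and y: "y \<in> L2 unit_I" for x y
  proof -
    have xc: "(\<lambda>t. x t - mX t) \<in> L2 unit_I" by (intro L2_diff x mX)
    have "l2inner unit_I (slice unit_I b (\<lambda>t. x t - mX t)) f = l2inner unit_I (\<lambda>t. x t - mX t) g"
      unfolding g_def
      using l2inner_slice[OF sf sf swap_in_L2[OF sf sf b] xc f] l2inner_slice[OF sf sf b f xc] l2inner_swap[OF sf sf b f xc]
      by (simp add: l2inner_commute[of unit_I "\<lambda>t. x t - mX t"])
    then show ?thesis
      unfolding regression_residual_def using x y mX mY f g xc
      by (simp add: l2inner_diff_left L2_diff slice_in_L2 sf b)
  qed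
  then have "(\<lambda>w. l2inner unit_I (regression_residual mX mY b (fst w) (snd w)) f) \<in> borel_measurable (L2_borel unit_I \<Otimes>\<^sub>M L2_borel unit_I)
      \<longleftrightarrow> (\<lambda>w. l2inner unit_I (snd w) f - l2inner unit_I mY f - (l2inner unit_I (fst w) g - l2inner unit_I mX g)) \<in> borel_measurable (L2_borel unit_I \<Otimes>\<^sub>M L2_borel unit_I)"
    by (intro measurable_cong) (auto simp: space_pair_measure space_L2_borel)
  also have "\<dots>" by measurable
  finally show ?thesis by (simp add: case_prod_unfold)
qed

locale functional_linear_model = prob_space M for M :: "'w measure" +
  fixes X Y EYX :: "'w \<Rightarrow> real \<Rightarrow> real" and b :: "real \<times> real \<Rightarrow> real" and C1 :: real
  assumes rvX: "L2_random_variable M X" and rvY: "L2_random_variable M Y"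
    and X2: "integrable M (\<lambda>\<omega>. (l2norm unit_I (X \<omega>))\<^sup>2)"
    and Y2: "integrable M (\<lambda>\<omega>. (l2norm unit_I (Y \<omega>))\<^sup>2)"
    and b_L2: "b \<in> L2 unit_I2"
    and cond_exp: "is_L2_cond_exp M (sigma_gen M X) Y EYX"
    and model: "AE \<omega> in M. AE s in unit_I.
      EYX \<omega> s = mean_fun M Y s + (\<integral>t. b (s, t) * (X \<omega> t - mean_fun M X t) \<partial>unit_I)"
    and error_bound: "AE \<omega> in M.
      real_cond_exp M (sigma_gen M X) (\<lambda>\<omega>'. (l2norm unit_I (\<lambda>s. Y \<omega>' s - EYX \<omega>' s))\<^sup>2) \<omega> \<le> C1"
    and C1_nonneg: "0 \<le> C1"
begin

abbreviation "mX \<equiv> mean_fun M X"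
abbreviation "mY \<equiv> mean_fun M Y"
abbreviation "F \<equiv> sigma_gen M X"

text \<open>\<open>R\<close> is the error by definition, \<open>res\<close> its expression through the model.  They agree almost
  surely; the conditional moment assumptions concern \<open>R\<close>, whereas \<open>res\<close> is a function of the pair
  of curves and can therefore be evaluated at every observation.\<close>
definition Xc :: "'w \<Rightarrow> real \<Rightarrow> real" where "Xc \<omega> = (\<lambda>t. X \<omega> t - mX t)"
definition R :: "'w \<Rightarrow> real \<Rightarrow> real" where "R \<omega> = (\<lambda>s. Y \<omega> s - EYX \<omega> s)"
definition res :: "'w \<Rightarrow> real \<Rightarrow> real" where "res \<omega> = regression_residual mX mY b (X \<omega>) (Y \<omega>)"

lemmas sfI = sigma_finite_unit_I

sublocale X: L2_process M X
  by standard (rule L2_random_variable_joint[OF prob_space_axioms rvX X2])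

sublocale Y: L2_process M Y
  by standard (rule L2_random_variable_joint[OF prob_space_axioms rvY Y2])

lemma mX: "mX \<in> L2 unit_I" and mY: "mY \<in> L2 unit_I"
  by (rule X.mean_in_L2 Y.mean_in_L2)+

sublocale Xc: L2_process M Xc
  using X.minus_const[OF mX] by (simp add: Xc_def[abs_def])

lemma Xc_L2: "\<omega> \<in> space M \<Longrightarrow> Xc \<omega> \<in> L2 unit_I"
  unfolding Xc_def by (intro L2_diff mX L2_random_variable_in_L2[OF rvX])

lemma rvEYX: "L2_random_variable M EYX" and EYX_F: "EYX \<in> measurable F (L2_borel unit_I)"
  and EYX_mean: "A \<in> sets F \<Longrightarrow> AE s in unit_I. (LINT \<omega>:A|M. EYX \<omega> s) = (LINT \<omega>:A|M. Y \<omega> s)"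
  using cond_exp by (auto simp: is_L2_cond_exp_def)

lemma model_slice: "AE \<omega> in M. AE s in unit_I. EYX \<omega> s = mY s + slice unit_I b (Xc \<omega>) s"
  using model by (simp add: slice_def l2inner_def Xc_def)

text \<open>Square integrability of the conditional expectation is read off from the model, which makes it
  almost surely an affine function of the predictor.\<close>
lemma EYX2: "integrable M (\<lambda>\<omega>. (l2norm unit_I (EYX \<omega>))\<^sup>2)"
proof (rule Bochner_Integration.integrable_bound)
  interpret I: finite_measure unit_I by (rule finite_measure_unit_I)
  show "integrable M (\<lambda>\<omega>. 2 * (l2norm unit_I mY)\<^sup>2 + 2 * ((l2norm unit_I2 b)\<^sup>2 * (l2norm unit_I (Xc \<omega>))\<^sup>2))"
    using Xc.norm_integrable by simp
  have "(\<lambda>p. EYX (fst p) (snd p)) \<in> borel_measurable (M \<Otimes>\<^sub>M unit_I)"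
    using rvEYX by (simp add: L2_random_variable_def case_prod_unfold)
  then have "(\<lambda>(\<omega>, t). (EYX \<omega> t)\<^sup>2) \<in> borel_measurable (M \<Otimes>\<^sub>M unit_I)"
    unfolding case_prod_unfold by (rule borel_measurable_power)
  then show "(\<lambda>\<omega>. (l2norm unit_I (EYX \<omega>))\<^sup>2) \<in> borel_measurable M"
    unfolding l2norm_power2_integral by (rule I.borel_measurable_lebesgue_integral)
  show "AE \<omega> in M. norm ((l2norm unit_I (EYX \<omega>))\<^sup>2)
      \<le> norm (2 * (l2norm unit_I mY)\<^sup>2 + 2 * ((l2norm unit_I2 b)\<^sup>2 * (l2norm unit_I (Xc \<omega>))\<^sup>2))"
    using model_slice AE_space
  proof eventually_elim
    case (elim \<omega>)
    note xc = Xc_L2[OF elim(2)]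
    note B = slice_in_L2[OF sfI sfI b_L2 xc]
    have "l2norm unit_I (EYX \<omega>) = l2norm unit_I (\<lambda>s. mY s + slice unit_I b (Xc \<omega>) s)"
      using elim by (intro l2norm_cong_AE)
        (auto intro!: L2_measurable L2_random_variable_in_L2[OF rvEYX] L2_add mY B)
    also have "\<dots>\<^sup>2 \<le> 2 * (l2norm unit_I mY)\<^sup>2 + 2 * (l2norm unit_I (slice unit_I b (Xc \<omega>)))\<^sup>2"
      using power_mono[OF l2norm_triangle[OF mY B(1)] l2norm_nonneg, of 2]
        sum_power2_le_twice[of "l2norm unit_I mY" "l2norm unit_I (slice unit_I b (Xc \<omega>))"] by linarith
    also have "\<dots> \<le> 2 * (l2norm unit_I mY)\<^sup>2 + 2 * ((l2norm unit_I2 b)\<^sup>2 * (l2norm unit_I (Xc \<omega>))\<^sup>2)"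
      using B(2) by simp
    finally show ?case by simp
  qed
qed

sublocale EYX: L2_process M EYX
  by standard (rule L2_random_variable_joint[OF prob_space_axioms rvEYX EYX2])

sublocale R: L2_process M R
  using Y.minus[OF EYX.L2_process_axioms] by (simp add: R_def[abs_def])

lemma R_L2: "\<omega> \<in> space M \<Longrightarrow> R \<omega> \<in> L2 unit_I"
  unfolding R_def by (intro L2_diff L2_random_variable_in_L2[OF rvY] L2_random_variable_in_L2[OF rvEYX])

lemma l2inner_R: "\<omega> \<in> space M \<Longrightarrow> f \<in> L2 unit_I \<Longrightarrow>
    l2inner unit_I (R \<omega>) f = l2inner unit_I (Y \<omega>) f - l2inner unit_I (EYX \<omega>) f"
  unfolding R_def
  by (intro l2inner_diff_left L2_random_variable_in_L2[OF rvY] L2_random_variable_in_L2[OF rvEYX])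

lemma res_L2: "\<omega> \<in> space M \<Longrightarrow> res \<omega> \<in> L2 unit_I"
  unfolding res_def regression_residual_def Xc_def[symmetric]
  by (intro L2_diff L2_random_variable_in_L2[OF rvY] mY slice_in_L2 sfI b_L2 Xc_L2)

lemma res_AE: "AE \<omega> in M. AE s in unit_I. res \<omega> s = R \<omega> s"
  using model_slice
proof eventually_elim
  case (elim \<omega>)
  then show ?case
    by eventually_elim (simp add: res_def regression_residual_def R_def Xc_def)
qed

lemma l2inner_res_AE: "f \<in> L2 unit_I \<Longrightarrow> AE \<omega> in M. l2inner unit_I (res \<omega>) f = l2inner unit_I (R \<omega>) f"
  using res_AE AE_space
  by eventually_elim (intro l2inner_cong_AE L2_measurable res_L2 R_L2)

lemma subalgebra_F: "subalgebra M F"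
  using rvX by (auto simp: subalgebra_def L2_random_variable_def sets_vimage_algebra
      intro!: sets.sigma_sets_subset measurable_sets)

sublocale Fin: finite_measure_subalgebra M F
  by standard (rule subalgebra_F)

lemma X_F: "X \<in> measurable F (L2_borel unit_I)"
  using rvX by (intro measurable_vimage_algebra1) (auto simp: L2_random_variable_def dest: measurable_space)

lemma l2inner_Xc: "\<omega> \<in> space M \<Longrightarrow> f \<in> L2 unit_I \<Longrightarrow>
    l2inner unit_I (Xc \<omega>) f = l2inner unit_I (X \<omega>) f - l2inner unit_I mX f"
  unfolding Xc_def by (intro l2inner_diff_left L2_random_variable_in_L2[OF rvX] mX)

lemma l2inner_Xc_F: "f \<in> L2 unit_I \<Longrightarrow> (\<lambda>\<omega>. l2inner unit_I (Xc \<omega>) f) \<in> borel_measurable F"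
  using measurable_compose[OF X_F l2inner_measurable_L2_borel, of f]
  by (subst measurable_cong[where g="\<lambda>\<omega>. l2inner unit_I (X \<omega>) f - l2inner unit_I mX f"])
     (auto simp: l2inner_Xc)

text \<open>Testing the function-valued conditional expectation against \<open>f\<close>: on each event of the
  conditioning algebra the two weighted means agree almost everywhere as functions of the
  argument, hence so do their inner products with \<open>f\<close>.\<close>
lemma l2inner_EYX_cond_exp:
  assumes f: "f \<in> L2 unit_I"
  shows "AE \<omega> in M. real_cond_exp M F (\<lambda>\<omega>. l2inner unit_I (Y \<omega>) f) \<omega> = l2inner unit_I (EYX \<omega>) f"
proof (rule Fin.real_cond_exp_charact)
  fix A assume A: "A \<in> sets F"
  then have AM: "A \<in> sets M" using subalgebra_F by (auto simp: subalgebra_def)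
  have "(\<lambda>\<omega>. (indicator A \<omega> :: real)\<^sup>2) = indicator A" by (auto simp: fun_eq_iff indicator_def)
  then have ind: "indicator A \<in> L2 M" using AM by (simp add: L2_def emeasure_eq_measure)
  have eq: "(\<integral>\<omega>\<in>A. l2inner unit_I (Z \<omega>) f \<partial>M) = (\<integral>\<omega>. l2inner unit_I (Z \<omega>) f * indicator A \<omega> \<partial>M)"
    for Z :: "'w \<Rightarrow> real \<Rightarrow> real" by (simp add: set_lebesgue_integral_def mult.commute)
  have "AE s in unit_I. Y.weighted_mean (indicator A) s = EYX.weighted_mean (indicator A) s"
    using EYX_mean[OF A]
    by eventually_elim (simp add: Y.weighted_mean_def EYX.weighted_mean_def set_lebesgue_integral_def mult.commute)
  then have "l2inner unit_I (Y.weighted_mean (indicator A)) f = l2inner unit_I (EYX.weighted_mean (indicator A)) f"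
    by (intro l2inner_cong_AE L2_measurable Y.weighted_mean_in_L2 EYX.weighted_mean_in_L2 ind f)
  then show "(\<integral>\<omega>\<in>A. l2inner unit_I (Y \<omega>) f \<partial>M) = (\<integral>\<omega>\<in>A. l2inner unit_I (EYX \<omega>) f \<partial>M)"
    by (simp only: eq Y.l2inner_weighted_mean[OF ind f] EYX.l2inner_weighted_mean[OF ind f])
qed (use f in \<open>auto intro!: L2_integrable Y.inner_in_L2 EYX.inner_in_L2 measurable_compose[OF EYX_F l2inner_measurable_L2_borel]\<close>)

lemma R_uncorrelated:
  assumes f: "f \<in> L2 unit_I" and h: "h \<in> L2 M" "h \<in> borel_measurable F"
  shows "(\<integral>\<omega>. h \<omega> * l2inner unit_I (R \<omega>) f \<partial>M) = 0"
proof -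
  have int: "integrable M (\<lambda>\<omega>. h \<omega> * l2inner unit_I (Y \<omega>) f)" "integrable M (\<lambda>\<omega>. h \<omega> * l2inner unit_I (EYX \<omega>) f)"
    by (intro L2_mult_integrable h Y.inner_in_L2 EYX.inner_in_L2 f)+
  have "(\<integral>\<omega>. h \<omega> * l2inner unit_I (R \<omega>) f \<partial>M)
      = (\<integral>\<omega>. h \<omega> * l2inner unit_I (Y \<omega>) f - h \<omega> * l2inner unit_I (EYX \<omega>) f \<partial>M)"
    by (intro Bochner_Integration.integral_cong refl) (simp add: l2inner_R f right_diff_distrib)
  also have "\<dots> = (\<integral>\<omega>. h \<omega> * l2inner unit_I (Y \<omega>) f \<partial>M) - (\<integral>\<omega>. h \<omega> * l2inner unit_I (EYX \<omega>) f \<partial>M)"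
    using int by simp
  also have "(\<integral>\<omega>. h \<omega> * l2inner unit_I (Y \<omega>) f \<partial>M)
      = (\<integral>\<omega>. h \<omega> * real_cond_exp M F (\<lambda>\<omega>. l2inner unit_I (Y \<omega>) f) \<omega> \<partial>M)"
    by (intro Fin.real_cond_exp_intg(2)[symmetric] int h(2) L2_measurable[OF Y.inner_in_L2] f)
  also have "\<dots> = (\<integral>\<omega>. h \<omega> * l2inner unit_I (EYX \<omega>) f \<partial>M)"
  proof (rule integral_cong_AE)
    show "AE \<omega> in M. h \<omega> * real_cond_exp M F (\<lambda>\<omega>. l2inner unit_I (Y \<omega>) f) \<omega> = h \<omega> * l2inner unit_I (EYX \<omega>) f"
      using l2inner_EYX_cond_exp[OF f] by eventually_elim simp
  qed (use L2_measurable[OF h(1)] L2_measurable[OF EYX.inner_in_L2[OF f]] in measurable)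
  finally show ?thesis by simp
qed

text \<open>The bound on the conditional variance is integrated against a nonnegative weight that need not
  be bounded, hence the detour through the nonnegative conditional expectation.\<close>
lemma R_conditional_variance:
  assumes g: "g \<in> borel_measurable F"
  shows "(\<integral>\<^sup>+\<omega>. g \<omega> * ennreal ((l2norm unit_I (R \<omega>))\<^sup>2) \<partial>M) \<le> ennreal C1 * (\<integral>\<^sup>+\<omega>. g \<omega> \<partial>M)"
proof -
  let ?r = "\<lambda>\<omega>. (l2norm unit_I (R \<omega>))\<^sup>2"
  have r_meas [measurable]: "?r \<in> borel_measurable M" using R.norm_integrable by (rule borel_measurable_integrable)
  have gM [measurable]: "g \<in> borel_measurable M" by (rule measurable_from_subalg[OF subalgebra_F g])
  have "(\<lambda>\<omega>. ennreal (- ?r \<omega>)) = (\<lambda>_. 0)" by (simp add: fun_eq_iff ennreal_neg)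
  then have zero: "AE \<omega> in M. nn_cond_exp M F (\<lambda>\<omega>. ennreal (- ?r \<omega>)) \<omega> = 0"
    using Fin.nn_cond_exp_F_meas[of "\<lambda>_. 0"] by (auto elim: AE_mp)
  have "(\<integral>\<^sup>+\<omega>. nn_cond_exp M F (\<lambda>\<omega>. ennreal (?r \<omega>)) \<omega> \<partial>M) = (\<integral>\<^sup>+\<omega>. ennreal (?r \<omega>) \<partial>M)"
    using Fin.nn_cond_exp_intg[of "\<lambda>_. 1" "\<lambda>\<omega>. ennreal (?r \<omega>)"] by simp
  also have "\<dots> < \<infinity>" using R.norm_integrable by (simp add: nn_integral_eq_integral)
  finally have "AE \<omega> in M. nn_cond_exp M F (\<lambda>\<omega>. ennreal (?r \<omega>)) \<omega> \<noteq> \<infinity>"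
    by (intro nn_integral_noteq_infinite) auto
  then have le: "AE \<omega> in M. nn_cond_exp M F (\<lambda>\<omega>. ennreal (?r \<omega>)) \<omega> \<le> ennreal C1"
    using zero error_bound
  proof eventually_elim
    case (elim \<omega>)
    then have "enn2real (nn_cond_exp M F (\<lambda>\<omega>. ennreal (?r \<omega>)) \<omega>) \<le> C1"
      by (simp add: real_cond_exp_def R_def)
    with elim(1) show ?case
      by (metis ennreal_enn2real ennreal_leI infinity_ennreal_def less_top)
  qed
  have "(\<integral>\<^sup>+\<omega>. g \<omega> * ennreal (?r \<omega>) \<partial>M) = (\<integral>\<^sup>+\<omega>. g \<omega> * nn_cond_exp M F (\<lambda>\<omega>. ennreal (?r \<omega>)) \<omega> \<partial>M)"
    by (rule Fin.nn_cond_exp_intg[symmetric]) (use g in auto)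
  also have "\<dots> \<le> (\<integral>\<^sup>+\<omega>. g \<omega> * ennreal C1 \<partial>M)"
    using le by (intro nn_integral_mono_AE) (auto elim!: eventually_mono intro: mult_left_mono)
  also have "\<dots> = ennreal C1 * (\<integral>\<^sup>+\<omega>. g \<omega> \<partial>M)"
    by (subst nn_integral_multc) (auto simp: mult.commute)
  finally show ?thesis .
qed

end

section \<open>Order of the sample statistics\<close>

locale flr_sample = functional_linear_model M X Y EYX b C1 + polynomial_spectrum \<kappa> \<alpha> C1
  for M :: "'w measure" and X Y EYX :: "'w \<Rightarrow> real \<Rightarrow> real" and b :: "real \<times> real \<Rightarrow> real"
    and C1 :: real and \<kappa> :: "nat \<Rightarrow> real" and \<alpha> :: real +
  fixes \<phi> :: "nat \<Rightarrow> real \<Rightarrow> real" and Xs Ys :: "nat \<Rightarrow> 'w \<Rightarrow> real \<Rightarrow> real"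
  assumes K_spec: "spectral_expansion unit_I (cov_kernel M X) \<kappa> \<phi>"
    and rvXs: "\<And>i. i \<ge> 1 \<Longrightarrow> L2_random_variable M (Xs i)"
    and rvYs: "\<And>i. i \<ge> 1 \<Longrightarrow> L2_random_variable M (Ys i)"
    and indep: "indep_vars (\<lambda>_. L2_borel unit_I \<Otimes>\<^sub>M L2_borel unit_I)
      (\<lambda>i \<omega>. (Xs i \<omega>, Ys i \<omega>)) {1..}"
    and ident: "\<And>i. i \<ge> 1 \<Longrightarrow>
      distr M (L2_borel unit_I \<Otimes>\<^sub>M L2_borel unit_I) (\<lambda>\<omega>. (Xs i \<omega>, Ys i \<omega>)) =
      distr M (L2_borel unit_I \<Otimes>\<^sub>M L2_borel unit_I) (\<lambda>\<omega>. (X \<omega>, Y \<omega>))"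
    and xi4: "\<And>k. k \<ge> 1 \<Longrightarrow> integrable M (\<lambda>\<omega>. (score M X (\<phi> k) \<omega>) ^ 4)"
      "\<And>k. k \<ge> 1 \<Longrightarrow> (\<integral>\<omega>. (score M X (\<phi> k) \<omega>) ^ 4 \<partial>M) \<le> C1 * (\<kappa> k)\<^sup>2"
begin

abbreviation "xi k \<omega> \<equiv> l2inner unit_I (Xc \<omega>) (\<phi> k)"
abbreviation "eta j \<omega> \<equiv> l2inner unit_I (res \<omega>) (\<phi> j)"

text \<open>Scores and residual coefficients as functionals of a pair of curves: in this form independence
  and equality in law pass from the observations to them.\<close>

definition hxi :: "nat \<Rightarrow> (real \<Rightarrow> real) \<times> (real \<Rightarrow> real) \<Rightarrow> real" where
  "hxi k = (\<lambda>(x, y). l2inner unit_I (\<lambda>t. x t - mX t) (\<phi> k))"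

definition heta :: "nat \<Rightarrow> (real \<Rightarrow> real) \<times> (real \<Rightarrow> real) \<Rightarrow> real" where
  "heta j = (\<lambda>(x, y). l2inner unit_I (regression_residual mX mY b x y) (\<phi> j))"

abbreviation "BB \<equiv> L2_borel unit_I \<Otimes>\<^sub>M L2_borel unit_I"
abbreviation "W i \<omega> \<equiv> (Xs i \<omega>, Ys i \<omega>)"

lemma onb: "L2_onb unit_I \<phi>"
  using K_spec by (rule spectral_expansion_onb)

lemmas phi = L2_onb_in_L2[OF onb]

lemma hxi_W0: "hxi k (X \<omega>, Y \<omega>) = xi k \<omega>" and heta_W0: "heta j (X \<omega>, Y \<omega>) = eta j \<omega>"
  by (simp_all add: hxi_def heta_def Xc_def res_def)

lemma heta_measurable [measurable]: "1 \<le> j \<Longrightarrow> heta j \<in> borel_measurable BB"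
  unfolding heta_def by (rule l2inner_regression_residual_measurable[OF mX mY b_L2 phi])

lemma hxi_measurable [measurable]:
  assumes k: "1 \<le> k"
  shows "hxi k \<in> borel_measurable BB"
proof -
  note [measurable] = l2inner_measurable_L2_borel[OF phi[OF k]]
  have "(\<lambda>w. l2inner unit_I (fst w) (\<phi> k) - l2inner unit_I mX (\<phi> k)) \<in> borel_measurable BB"
    by measurable
  then show ?thesis
    by (subst measurable_cong[where g="\<lambda>w. l2inner unit_I (fst w) (\<phi> k) - l2inner unit_I mX (\<phi> k)"])
       (auto simp: hxi_def space_pair_measure space_L2_borel l2inner_diff_left mX phi[OF k])
qed

lemma W0_measurable: "(\<lambda>\<omega>. (X \<omega>, Y \<omega>)) \<in> measurable M BB"
  using rvX rvY by (intro measurable_Pair) (auto simp: L2_random_variable_def)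

lemma W_measurable [measurable]: "1 \<le> i \<Longrightarrow> W i \<in> measurable M BB"
  using rvXs rvYs by (intro measurable_Pair) (auto simp: L2_random_variable_def)

lemma average_second_moment:
  assumes "h \<in> borel_measurable BB" "integrable M (\<lambda>\<omega>. (h (X \<omega>, Y \<omega>))\<^sup>2)"
    "(\<integral>\<omega>. h (X \<omega>, Y \<omega>) \<partial>M) = 0" "1 \<le> n"
  shows "(\<integral>\<^sup>+\<omega>. ennreal (((\<Sum>i=1..n. h (W i \<omega>)) / real n)\<^sup>2) \<partial>M)
    = ennreal (1 / real n) * (\<integral>\<^sup>+\<omega>. ennreal ((h (X \<omega>, Y \<omega>))\<^sup>2) \<partial>M)"
  by (rule iid_average_second_moment[OF indep ident W0_measurable assms]) auto

lemma xi_L2: "1 \<le> k \<Longrightarrow> xi k \<in> L2 M"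
  by (intro Xc.inner_in_L2 phi)

lemma eta_AE: "1 \<le> j \<Longrightarrow> AE \<omega> in M. eta j \<omega> = l2inner unit_I (R \<omega>) (\<phi> j)"
  by (rule l2inner_res_AE[OF phi])

lemma eta_measurable [measurable]: "1 \<le> j \<Longrightarrow> eta j \<in> borel_measurable M"
  using measurable_compose[OF W0_measurable heta_measurable, of j] by (simp add: heta_W0)

lemma xi_measurable [measurable]: "1 \<le> k \<Longrightarrow> xi k \<in> borel_measurable M"
  by (rule L2_measurable[OF xi_L2])

lemma cov_kernel_eq: "cov_kernel M X = Xc.second_moment"
  by (simp add: cov_kernel_def Xc.second_moment_def Xc_def)

lemma K_L2: "cov_kernel M X \<in> L2 unit_I2"
  unfolding cov_kernel_eq by (rule Xc.second_moment_in_L2)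

lemma xi_cov:
  assumes "1 \<le> j" "1 \<le> k"
  shows "(\<integral>\<omega>. xi j \<omega> * xi k \<omega> \<partial>M) = (if j = k then \<kappa> k else 0)"
proof -
  have "(\<integral>\<omega>. xi j \<omega> * xi k \<omega> \<partial>M) = l2inner unit_I2 (cov_kernel M X) (tensor (\<phi> j) (\<phi> k))"
    unfolding cov_kernel_eq using assms by (intro Xc.l2inner_second_moment[symmetric] phi)
  also have "\<dots> = (if j = k then \<kappa> k else 0)"
    using assms onb by (simp add: spectral_expansion_eigen(1)[OF sfI K_L2 K_spec] phi L2_onb_inner)
  finally show ?thesis .
qed

lemma cov_kernel_coef: "1 \<le> j \<Longrightarrow> 1 \<le> k \<Longrightarrow>
    l2inner unit_I2 (cov_kernel M X) (tensor (\<phi> j) (\<phi> k)) = (if j = k then \<kappa> k else 0)"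
  using onb by (simp add: spectral_expansion_eigen(1)[OF sfI K_L2 K_spec] phi L2_onb_inner)

lemma xi_mean: "1 \<le> k \<Longrightarrow> (\<integral>\<omega>. xi k \<omega> \<partial>M) = 0"
proof -
  assume k: "1 \<le> k"
  have "(\<integral>\<omega>. xi k \<omega> \<partial>M) = (\<integral>\<omega>. l2inner unit_I (X \<omega>) (\<phi> k) - l2inner unit_I mX (\<phi> k) \<partial>M)"
    by (intro Bochner_Integration.integral_cong refl l2inner_Xc phi k)
  also have "\<dots> = 0"
    using L2_integrable[OF X.inner_in_L2[OF phi[OF k]]] by (simp add: X.l2inner_mean phi[OF k] prob_space)
  finally show ?thesis .
qed

lemma score_eq: "score M X (\<phi> k) \<omega> = xi k \<omega>"
  by (simp add: score_def Xc_def)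

lemma xi_sq_L2: "1 \<le> k \<Longrightarrow> (\<lambda>\<omega>. (xi k \<omega>)\<^sup>2) \<in> L2 M"
  using xi4(1)[of k] L2_measurable[OF xi_L2, of k] by (simp add: L2_def score_eq)

lemma xi_sq_second_moment:
  assumes k: "1 \<le> k"
  shows "(\<integral>\<^sup>+\<omega>. ennreal ((xi k \<omega>)\<^sup>2) \<partial>M) = ennreal (\<kappa> k)"
  using L2_square_integrable[OF xi_L2[OF k]] xi_cov[OF k k]
  by (simp add: nn_integral_eq_integral power2_eq_square)

lemma xi_prod_L2:
  assumes "1 \<le> j" "1 \<le> k"
  shows "integrable M (\<lambda>\<omega>. (xi j \<omega> * xi k \<omega>)\<^sup>2)"
    and "(\<integral>\<omega>. (xi j \<omega> * xi k \<omega>)\<^sup>2 \<partial>M) \<le> C1 * (\<kappa> j * \<kappa> k)"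
proof -
  show "integrable M (\<lambda>\<omega>. (xi j \<omega> * xi k \<omega>)\<^sup>2)"
    using L2_mult_integrable[OF xi_sq_L2[OF assms(1)] xi_sq_L2[OF assms(2)]]
    by (simp add: power_mult_distrib)
  have fourth: "l2inner M (\<lambda>\<omega>. (xi k \<omega>)\<^sup>2) (\<lambda>\<omega>. (xi k \<omega>)\<^sup>2) \<le> C1 * (\<kappa> k)\<^sup>2" if "1 \<le> k" for k
    using xi4(2)[OF that] by (simp add: l2inner_def score_eq power2_eq_square power4_eq_xxxx mult.assoc)
  have "(l2inner M (\<lambda>\<omega>. (xi j \<omega>)\<^sup>2) (\<lambda>\<omega>. (xi k \<omega>)\<^sup>2))\<^sup>2 \<le> (C1 * (\<kappa> j)\<^sup>2) * (C1 * (\<kappa> k)\<^sup>2)"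
  proof (rule order_trans[OF Cauchy_Schwarz_l2inner_power2[OF xi_sq_L2[OF assms(1)] xi_sq_L2[OF assms(2)]]])
    have "0 \<le> C1 * (\<kappa> j)\<^sup>2" using C1 by simp
    then show "l2inner M (\<lambda>\<omega>. (xi j \<omega>)\<^sup>2) (\<lambda>\<omega>. (xi j \<omega>)\<^sup>2) * l2inner M (\<lambda>\<omega>. (xi k \<omega>)\<^sup>2) (\<lambda>\<omega>. (xi k \<omega>)\<^sup>2)
        \<le> (C1 * (\<kappa> j)\<^sup>2) * (C1 * (\<kappa> k)\<^sup>2)"
      by (intro mult_mono fourth assms l2inner_self_nonneg)
  qed
  also have "\<dots> = (C1 * (\<kappa> j * \<kappa> k))\<^sup>2" by (simp add: power2_eq_square)
  finally have "l2inner M (\<lambda>\<omega>. (xi j \<omega>)\<^sup>2) (\<lambda>\<omega>. (xi k \<omega>)\<^sup>2) \<le> C1 * (\<kappa> j * \<kappa> k)"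
    by (rule power2_le_imp_le) (use C1 pos[OF assms(1)] pos[OF assms(2)] in auto)
  then show "(\<integral>\<omega>. (xi j \<omega> * xi k \<omega>)\<^sup>2 \<partial>M) \<le> C1 * (\<kappa> j * \<kappa> k)"
    by (simp add: l2inner_def power_mult_distrib)
qed

text \<open>Parseval for the error, under the expectation.\<close>
lemma sum_eta_sq:
  assumes h: "h \<in> borel_measurable F"
  shows "(\<Sum>j. \<integral>\<^sup>+\<omega>. h \<omega> * ennreal ((eta (Suc j) \<omega>)\<^sup>2) \<partial>M) \<le> ennreal C1 * (\<integral>\<^sup>+\<omega>. h \<omega> \<partial>M)"
proof -
  have [measurable]: "h \<in> borel_measurable M" by (rule measurable_from_subalg[OF subalgebra_F h])
  have "(\<Sum>j. \<integral>\<^sup>+\<omega>. h \<omega> * ennreal ((eta (Suc j) \<omega>)\<^sup>2) \<partial>M)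
      = (\<integral>\<^sup>+\<omega>. (\<Sum>j. h \<omega> * ennreal ((eta (Suc j) \<omega>)\<^sup>2)) \<partial>M)"
    by (subst nn_integral_suminf) auto
  also have "\<dots> = (\<integral>\<^sup>+\<omega>. h \<omega> * ennreal ((l2norm unit_I (R \<omega>))\<^sup>2) \<partial>M)"
  proof (rule nn_integral_cong_AE)
    have "AE \<omega> in M. \<forall>j. eta (Suc j) \<omega> = l2inner unit_I (R \<omega>) (\<phi> (Suc j))"
      unfolding AE_all_countable by (intro allI eta_AE) simp
    then show "AE \<omega> in M. (\<Sum>j. h \<omega> * ennreal ((eta (Suc j) \<omega>)\<^sup>2)) = h \<omega> * ennreal ((l2norm unit_I (R \<omega>))\<^sup>2)"
      using AE_space
    proof eventually_elim
      case (elim \<omega>)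
      from L2_onb_Parseval_ennreal[OF onb R_L2[OF elim(2)]] elim(1) show ?case
        by (simp add: ennreal_suminf_cmult)
    qed
  qed
  also have "\<dots> \<le> ennreal C1 * (\<integral>\<^sup>+\<omega>. h \<omega> \<partial>M)" by (rule R_conditional_variance[OF h])
  finally show ?thesis .
qed

lemma sum_eta_xi_sq:
  assumes k: "1 \<le> k"
  shows "(\<Sum>j. \<integral>\<^sup>+\<omega>. ennreal ((eta (Suc j) \<omega> * xi k \<omega>)\<^sup>2) \<partial>M) \<le> ennreal (C1 * \<kappa> k)"
proof -
  note [measurable] = l2inner_Xc_F[OF phi[OF k]]
  have "(\<lambda>\<omega>. ennreal ((xi k \<omega>)\<^sup>2)) \<in> borel_measurable F" by measurable
  from sum_eta_sq[OF this]
  have "(\<Sum>j. \<integral>\<^sup>+\<omega>. ennreal ((xi k \<omega>)\<^sup>2) * ennreal ((eta (Suc j) \<omega>)\<^sup>2) \<partial>M) \<le> ennreal C1 * ennreal (\<kappa> k)"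
    unfolding xi_sq_second_moment[OF k] .
  moreover have "ennreal ((eta j \<omega> * xi k \<omega>)\<^sup>2) = ennreal ((xi k \<omega>)\<^sup>2) * ennreal ((eta j \<omega>)\<^sup>2)" for j \<omega>
    unfolding power_mult_distrib mult.commute[of "(eta j \<omega>)\<^sup>2"] by (rule ennreal_mult) simp_all
  moreover have "ennreal (C1 * \<kappa> k) = ennreal C1 * ennreal (\<kappa> k)"
    using C1 pos[OF k] by (intro ennreal_mult) auto
  ultimately show ?thesis by (simp only:)
qed

lemma eta_moments:
  assumes "1 \<le> j"
  shows "integrable M (\<lambda>\<omega>. (eta j \<omega>)\<^sup>2)" "(\<integral>\<omega>. eta j \<omega> \<partial>M) = 0"
proof -
  show "integrable M (\<lambda>\<omega>. (eta j \<omega>)\<^sup>2)"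
  proof (rule integrable_cong_AE_imp)
    show "integrable M (\<lambda>\<omega>. (l2inner unit_I (R \<omega>) (\<phi> j))\<^sup>2)"
      by (intro L2_square_integrable R.inner_in_L2 phi assms)
    show "AE \<omega> in M. (l2inner unit_I (R \<omega>) (\<phi> j))\<^sup>2 = (eta j \<omega>)\<^sup>2"
      using eta_AE[OF assms] by eventually_elim simp
  qed (use eta_measurable[OF assms] in measurable)
  have "(\<integral>\<omega>. eta j \<omega> \<partial>M) = (\<integral>\<omega>. 1 * l2inner unit_I (R \<omega>) (\<phi> j) \<partial>M)"
    using eta_AE[OF assms] assms L2_measurable[OF R.inner_in_L2[OF phi[OF assms]]]
    by (intro integral_cong_AE) auto
  also have "\<dots> = 0" by (intro R_uncorrelated phi assms L2_const) auto
  finally show "(\<integral>\<omega>. eta j \<omega> \<partial>M) = 0" .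
qed

lemma eta_xi_moments:
  assumes j: "1 \<le> j" and k: "1 \<le> k"
  shows "integrable M (\<lambda>\<omega>. (eta j \<omega> * xi k \<omega>)\<^sup>2)" "(\<integral>\<omega>. eta j \<omega> * xi k \<omega> \<partial>M) = 0"
proof -
  obtain j' where j': "j = Suc j'" using j by (cases j) auto
  have "(\<integral>\<^sup>+\<omega>. ennreal ((eta j \<omega> * xi k \<omega>)\<^sup>2) \<partial>M)
      \<le> (\<Sum>j. \<integral>\<^sup>+\<omega>. ennreal ((eta (Suc j) \<omega> * xi k \<omega>)\<^sup>2) \<partial>M)"
    unfolding j'
    by (rule sum_le_suminf[of "\<lambda>j. \<integral>\<^sup>+\<omega>. ennreal ((eta (Suc j) \<omega> * xi k \<omega>)\<^sup>2) \<partial>M" "{j'}", simplified])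
  also have "\<dots> \<le> ennreal (C1 * \<kappa> k)" by (rule sum_eta_xi_sq[OF k])
  also have "\<dots> < \<infinity>" by simp
  finally show "integrable M (\<lambda>\<omega>. (eta j \<omega> * xi k \<omega>)\<^sup>2)"
    using j k by (intro integrableI_bounded) auto
  have "(\<integral>\<omega>. eta j \<omega> * xi k \<omega> \<partial>M) = (\<integral>\<omega>. xi k \<omega> * l2inner unit_I (R \<omega>) (\<phi> j) \<partial>M)"
    using eta_AE[OF j] j k L2_measurable[OF R.inner_in_L2[OF phi[OF j]]]
    by (intro integral_cong_AE) (auto simp: mult.commute)
  also have "\<dots> = 0" by (intro R_uncorrelated phi j xi_L2 k l2inner_Xc_F)
  finally show "(\<integral>\<omega>. eta j \<omega> * xi k \<omega> \<partial>M) = 0" .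
qed

subsection \<open>Coordinates of the sample statistics\<close>

definition avg :: "nat \<Rightarrow> ((real \<Rightarrow> real) \<times> (real \<Rightarrow> real) \<Rightarrow> real) \<Rightarrow> 'w \<Rightarrow> real" where
  "avg n h \<omega> = (\<Sum>i=1..n. h (W i \<omega>)) / real n"

definition hcov :: "nat \<Rightarrow> nat \<Rightarrow> (real \<Rightarrow> real) \<times> (real \<Rightarrow> real) \<Rightarrow> real" where
  "hcov l j w = hxi l w * hxi j w - (if l = j then \<kappa> j else 0)"

definition hnoise :: "nat \<Rightarrow> nat \<Rightarrow> (real \<Rightarrow> real) \<times> (real \<Rightarrow> real) \<Rightarrow> real" where
  "hnoise j k w = heta j w * hxi k w"

lemma avg_measurable:
  assumes "h \<in> borel_measurable BB"
  shows "avg n h \<in> borel_measurable M"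
proof -
  have "(\<lambda>\<omega>. \<Sum>i=1..n. h (W i \<omega>)) \<in> borel_measurable M"
    by (intro borel_measurable_sum measurable_compose[OF W_measurable assms]) auto
  then show ?thesis unfolding avg_def[abs_def] by simp
qed

lemma hcov_measurable: "1 \<le> l \<Longrightarrow> 1 \<le> j \<Longrightarrow> hcov l j \<in> borel_measurable BB"
  unfolding hcov_def[abs_def] by measurable

lemma hnoise_measurable: "1 \<le> j \<Longrightarrow> 1 \<le> k \<Longrightarrow> hnoise j k \<in> borel_measurable BB"
  unfolding hnoise_def[abs_def] by measurable

lemma nn_avg_hxi:
  assumes "1 \<le> n" "1 \<le> k"
  shows "ennreal (real n) * (\<integral>\<^sup>+\<omega>. ennreal ((avg n (hxi k) \<omega>)\<^sup>2) \<partial>M) = ennreal (\<kappa> k)"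
proof -
  have "(\<integral>\<^sup>+\<omega>. ennreal ((avg n (hxi k) \<omega>)\<^sup>2) \<partial>M) = ennreal (1 / real n) * ennreal (\<kappa> k)"
    unfolding avg_def using assms
    by (subst average_second_moment)
       (auto simp: hxi_W0 xi_sq_second_moment xi_mean L2_square_integrable[OF xi_L2])
  then show ?thesis
    using assms pos[of k] by (simp add: ennreal_mult[symmetric])
qed

text \<open>The variance of a product of scores is at most its second moment, which the fourth-moment
  assumption bounds by Cauchy-Schwarz.\<close>
lemma nn_avg_hcov:
  assumes "1 \<le> n" "1 \<le> l" "1 \<le> j"
  shows "ennreal (real n) * (\<integral>\<^sup>+\<omega>. ennreal ((avg n (hcov l j) \<omega>)\<^sup>2) \<partial>M) \<le> ennreal (C1 * (\<kappa> l * \<kappa> j))"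
proof -
  let ?p = "\<lambda>\<omega>. xi l \<omega> * xi j \<omega>"
  let ?c = "if l = j then \<kappa> j else 0"
  have p: "?p \<in> L2 M" using xi_prod_L2(1)[OF assms(2,3)] assms by (simp add: L2_def)
  have h: "hcov l j (X \<omega>, Y \<omega>) = ?p \<omega> - ?c" for \<omega> by (simp add: hcov_def hxi_W0)
  have L2h: "(\<lambda>\<omega>. ?p \<omega> - ?c) \<in> L2 M" by (intro L2_diff p L2_const)
  have mean: "(\<integral>\<omega>. ?p \<omega> - ?c \<partial>M) = 0"
    using L2_integrable[OF p] xi_cov[OF assms(2,3)] by (simp add: prob_space)
  have "(\<integral>\<omega>. (?p \<omega> - ?c)\<^sup>2 \<partial>M) = (\<integral>\<omega>. (?p \<omega>)\<^sup>2 - 2 * ?c * (?p \<omega> - ?c) - ?c\<^sup>2 \<partial>M)"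
    by (intro Bochner_Integration.integral_cong refl) (simp add: power2_eq_square algebra_simps)
  also have "\<dots> = (\<integral>\<omega>. (?p \<omega>)\<^sup>2 \<partial>M) - ?c\<^sup>2"
    using xi_prod_L2(1)[OF assms(2,3)] L2_integrable[OF L2h] mean by (simp add: prob_space)
  also have "\<dots> \<le> C1 * (\<kappa> l * \<kappa> j)" using xi_prod_L2(2)[OF assms(2,3)] by (auto intro: order_trans[rotated])
  finally have le: "(\<integral>\<omega>. (?p \<omega> - ?c)\<^sup>2 \<partial>M) \<le> C1 * (\<kappa> l * \<kappa> j)" .
  have "(\<integral>\<^sup>+\<omega>. ennreal ((avg n (hcov l j) \<omega>)\<^sup>2) \<partial>M) = ennreal (1 / real n) * ennreal (\<integral>\<omega>. (?p \<omega> - ?c)\<^sup>2 \<partial>M)"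
    unfolding avg_def using assms hcov_measurable L2_square_integrable[OF L2h] mean
    by (subst average_second_moment) (auto simp: h nn_integral_eq_integral)
  then have "ennreal (real n) * (\<integral>\<^sup>+\<omega>. ennreal ((avg n (hcov l j) \<omega>)\<^sup>2) \<partial>M) = ennreal (\<integral>\<omega>. (?p \<omega> - ?c)\<^sup>2 \<partial>M)"
    using assms by (simp add: ennreal_mult[symmetric])
  then show ?thesis using le by (simp add: ennreal_leI)
qed

lemma nn_avg_heta:
  assumes "1 \<le> n"
  shows "ennreal (real n) * (\<Sum>j. \<integral>\<^sup>+\<omega>. ennreal ((avg n (heta (Suc j)) \<omega>)\<^sup>2) \<partial>M) \<le> ennreal C1"
proof -
  have "(\<integral>\<^sup>+\<omega>. ennreal ((avg n (heta (Suc j)) \<omega>)\<^sup>2) \<partial>M) = ennreal (1 / real n) * (\<integral>\<^sup>+\<omega>. 1 * ennreal ((eta (Suc j) \<omega>)\<^sup>2) \<partial>M)" for j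
    unfolding avg_def using assms eta_moments[of "Suc j"]
    by (subst average_second_moment) (auto simp: heta_W0)
  then have "ennreal (real n) * (\<Sum>j. \<integral>\<^sup>+\<omega>. ennreal ((avg n (heta (Suc j)) \<omega>)\<^sup>2) \<partial>M)
      = ennreal (real n) * (ennreal (1 / real n) * (\<Sum>j. \<integral>\<^sup>+\<omega>. 1 * ennreal ((eta (Suc j) \<omega>)\<^sup>2) \<partial>M))"
    by (simp only: ennreal_suminf_cmult)
  also have "\<dots> = (\<Sum>j. \<integral>\<^sup>+\<omega>. 1 * ennreal ((eta (Suc j) \<omega>)\<^sup>2) \<partial>M)"
    using assms by (simp add: mult.assoc[symmetric] ennreal_mult[symmetric])
  also have "\<dots> \<le> ennreal C1 * (\<integral>\<^sup>+\<omega>. 1 \<partial>M)" by (rule sum_eta_sq) simp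
  finally show ?thesis by (simp add: emeasure_space_1)
qed

lemma nn_avg_hnoise:
  assumes "1 \<le> n" and k: "1 \<le> k"
  shows "ennreal (real n) * (\<Sum>j. \<integral>\<^sup>+\<omega>. ennreal ((avg n (hnoise (Suc j) k) \<omega>)\<^sup>2) \<partial>M) \<le> ennreal (C1 * \<kappa> k)"
proof -
  have "(\<integral>\<^sup>+\<omega>. ennreal ((avg n (hnoise (Suc j) k) \<omega>)\<^sup>2) \<partial>M) = ennreal (1 / real n) * (\<integral>\<^sup>+\<omega>. ennreal ((eta (Suc j) \<omega> * xi k \<omega>)\<^sup>2) \<partial>M)" for j
    unfolding avg_def using assms eta_xi_moments[of "Suc j" k] hnoise_measurable[of "Suc j" k]
    by (subst average_second_moment) (auto simp: hnoise_def heta_W0 hxi_W0)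
  then have "ennreal (real n) * (\<Sum>j. \<integral>\<^sup>+\<omega>. ennreal ((avg n (hnoise (Suc j) k) \<omega>)\<^sup>2) \<partial>M)
      = ennreal (real n) * (ennreal (1 / real n) * (\<Sum>j. \<integral>\<^sup>+\<omega>. ennreal ((eta (Suc j) \<omega> * xi k \<omega>)\<^sup>2) \<partial>M))"
    by (simp only: ennreal_suminf_cmult)
  also have "\<dots> = (\<Sum>j. \<integral>\<^sup>+\<omega>. ennreal ((eta (Suc j) \<omega> * xi k \<omega>)\<^sup>2) \<partial>M)"
    using assms by (simp add: mult.assoc[symmetric] ennreal_mult[symmetric])
  also have "\<dots> \<le> ennreal (C1 * \<kappa> k)" by (rule sum_eta_xi_sq[OF k])
  finally show ?thesis .
qed

text \<open>The statistics on which the deterministic bound depends, in the exact eigenbasis, scaled so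
  that their expectations are bounded uniformly in the sample size and the truncation levels.\<close>

definition Vcov :: "nat \<Rightarrow> 'w \<Rightarrow> ennreal" where
  "Vcov n \<omega> = ennreal (real n) * (\<Sum>j. \<Sum>l. ennreal ((avg n (hcov (Suc l) (Suc j)) \<omega>)\<^sup>2))"

definition Vmean :: "nat \<Rightarrow> 'w \<Rightarrow> ennreal" where
  "Vmean n \<omega> = ennreal (real n) * (\<Sum>k. ennreal ((avg n (hxi (Suc k)) \<omega>)\<^sup>2))"

definition Vnoise :: "nat \<Rightarrow> 'w \<Rightarrow> ennreal" where
  "Vnoise n \<omega> = ennreal (real n) * (\<Sum>k. \<Sum>j. ennreal ((avg n (hnoise (Suc j) (Suc k)) \<omega>)\<^sup>2))"

definition Vnoise_mean :: "nat \<Rightarrow> 'w \<Rightarrow> ennreal" where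
  "Vnoise_mean n \<omega> = ennreal (real n) * (\<Sum>j. ennreal ((avg n (heta (Suc j)) \<omega>)\<^sup>2))"

definition gap_weight :: "nat \<Rightarrow> nat \<Rightarrow> real" where
  "gap_weight l j = (if l = j then 0 else 1 / (\<kappa> l - \<kappa> j)\<^sup>2)"

text \<open>By the perturbation lemma, this is the leading term of the squared angle between the \<open>j\<close>-th
  empirical and exact eigenfunctions.\<close>
definition Ucol :: "nat \<Rightarrow> nat \<Rightarrow> 'w \<Rightarrow> ennreal" where
  "Ucol n j \<omega> = (\<Sum>l. ennreal (gap_weight (Suc l) j) * ennreal ((avg n (hcov (Suc l) j) \<omega>)\<^sup>2))"

definition Veigen :: "nat \<Rightarrow> nat \<Rightarrow> 'w \<Rightarrow> ennreal" where
  "Veigen n m \<omega> = ennreal (real n / real m) * (\<Sum>j=1..m. ennreal (1 / (real j)\<^sup>2) * Ucol n j \<omega>)"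

definition Vnoise_coef :: "nat \<Rightarrow> nat \<Rightarrow> 'w \<Rightarrow> ennreal" where
  "Vnoise_coef n m \<omega> = ennreal (real n * real m powr (- \<alpha> - 1)) *
     (\<Sum>k=1..m. ennreal (1 / (\<kappa> k)\<^sup>2) * (\<Sum>j. ennreal ((avg n (hnoise (Suc j) k) \<omega>)\<^sup>2)))"

definition Vmean_coef :: "nat \<Rightarrow> nat \<Rightarrow> 'w \<Rightarrow> ennreal" where
  "Vmean_coef n m \<omega> = ennreal (real n * real m powr (- \<alpha> - 1)) *
     (\<Sum>k=1..m. ennreal (1 / (\<kappa> k)\<^sup>2) * ennreal ((avg n (hxi k) \<omega>)\<^sup>2))"

lemma nn_integral_cmult_suminf:
  assumes "\<And>k. f k \<in> borel_measurable M"
  shows "(\<integral>\<^sup>+\<omega>. c * (\<Sum>k. f k \<omega>) \<partial>M) = (\<Sum>k. c * (\<integral>\<^sup>+\<omega>. f k \<omega> \<partial>M))"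
proof -
  have "(\<integral>\<^sup>+\<omega>. c * (\<Sum>k. f k \<omega>) \<partial>M) = c * (\<integral>\<^sup>+\<omega>. (\<Sum>k. f k \<omega>) \<partial>M)"
    by (intro nn_integral_cmult borel_measurable_suminf_order assms)
  also have "(\<integral>\<^sup>+\<omega>. (\<Sum>k. f k \<omega>) \<partial>M) = (\<Sum>k. \<integral>\<^sup>+\<omega>. f k \<omega> \<partial>M)"
    by (intro nn_integral_suminf assms)
  finally show ?thesis by (simp add: ennreal_suminf_cmult)
qed

lemma nn_integral_cmult_sum:
  assumes "\<And>k. k \<in> A \<Longrightarrow> f k \<in> borel_measurable M"
  shows "(\<integral>\<^sup>+\<omega>. c * (\<Sum>k\<in>A. w k * f k \<omega>) \<partial>M) = c * (\<Sum>k\<in>A. w k * (\<integral>\<^sup>+\<omega>. f k \<omega> \<partial>M))"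
proof -
  have "(\<integral>\<^sup>+\<omega>. c * (\<Sum>k\<in>A. w k * f k \<omega>) \<partial>M) = c * (\<integral>\<^sup>+\<omega>. (\<Sum>k\<in>A. w k * f k \<omega>) \<partial>M)"
    by (intro nn_integral_cmult borel_measurable_sum borel_measurable_times_ennreal assms) auto
  also have "(\<integral>\<^sup>+\<omega>. (\<Sum>k\<in>A. w k * f k \<omega>) \<partial>M) = (\<Sum>k\<in>A. \<integral>\<^sup>+\<omega>. w k * f k \<omega> \<partial>M)"
    by (intro nn_integral_sum borel_measurable_times_ennreal assms) auto
  also have "\<dots> = (\<Sum>k\<in>A. w k * (\<integral>\<^sup>+\<omega>. f k \<omega> \<partial>M))"
    by (intro sum.cong refl nn_integral_cmult assms)
  finally show ?thesis .
qed

lemmas avg_meas =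
  avg_measurable[OF hxi_measurable] avg_measurable[OF heta_measurable]
  avg_measurable[OF hcov_measurable] avg_measurable[OF hnoise_measurable]

lemma avg_sq_measurable:
  "1 \<le> k \<Longrightarrow> (\<lambda>\<omega>. ennreal ((avg n (hxi k) \<omega>)\<^sup>2)) \<in> borel_measurable M"
  "1 \<le> j \<Longrightarrow> (\<lambda>\<omega>. ennreal ((avg n (heta j) \<omega>)\<^sup>2)) \<in> borel_measurable M"
  "1 \<le> l \<Longrightarrow> 1 \<le> j \<Longrightarrow> (\<lambda>\<omega>. ennreal ((avg n (hcov l j) \<omega>)\<^sup>2)) \<in> borel_measurable M"
  "1 \<le> j \<Longrightarrow> 1 \<le> k \<Longrightarrow> (\<lambda>\<omega>. ennreal ((avg n (hnoise j k) \<omega>)\<^sup>2)) \<in> borel_measurable M"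
  by (intro measurable_compose[OF _ measurable_ennreal] borel_measurable_power avg_meas; simp)+

lemma Ucol_measurable [measurable]: "1 \<le> j \<Longrightarrow> Ucol n j \<in> borel_measurable M"
  unfolding Ucol_def[abs_def]
  by (intro borel_measurable_suminf_order borel_measurable_times_ennreal avg_sq_measurable) auto

lemma V_measurable:
  "Vcov n \<in> borel_measurable M" "Vmean n \<in> borel_measurable M" "Vnoise n \<in> borel_measurable M"
  "Vnoise_mean n \<in> borel_measurable M" "Veigen n m \<in> borel_measurable M"
  "Vnoise_coef n m \<in> borel_measurable M" "Vmean_coef n m \<in> borel_measurable M"
  unfolding Vcov_def[abs_def] Vmean_def[abs_def] Vnoise_def[abs_def] Vnoise_mean_def[abs_def]
    Veigen_def[abs_def] Vnoise_coef_def[abs_def] Vmean_coef_def[abs_def]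
  by (intro borel_measurable_times_ennreal borel_measurable_suminf_order borel_measurable_sum
      borel_measurable_const avg_sq_measurable Ucol_measurable; simp)+

lemma sum_kappa_le: "(\<Sum>k. ennreal (\<kappa> (Suc k))) \<le> ennreal (C1 * zeta_sum \<alpha>)"
proof -
  have "(\<Sum>k. ennreal (\<kappa> (Suc k))) \<le> (\<Sum>k. ennreal (C1 * real (Suc k) powr (- \<alpha>)))"
    by (intro suminf_le ennreal_leI decay) auto
  also have "\<dots> = ennreal (C1 * zeta_sum \<alpha>)"
    unfolding zeta_sum_def using C1 alpha zeta_sum_summable[of \<alpha>]
    by (subst suminf_ennreal2) (auto simp: suminf_mult intro: summable_mult)
  finally show ?thesis .
qed

lemma nn_Vcov:
  assumes n: "1 \<le> n"
  shows "(\<integral>\<^sup>+\<omega>. Vcov n \<omega> \<partial>M) \<le> ennreal (C1 * (C1 * zeta_sum \<alpha>)\<^sup>2)"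
proof -
  have "(\<integral>\<^sup>+\<omega>. Vcov n \<omega> \<partial>M)
      = (\<Sum>j. \<Sum>l. ennreal (real n) * (\<integral>\<^sup>+\<omega>. ennreal ((avg n (hcov (Suc l) (Suc j)) \<omega>)\<^sup>2) \<partial>M))"
  proof -
    have "(\<integral>\<^sup>+\<omega>. Vcov n \<omega> \<partial>M)
        = (\<Sum>j. ennreal (real n) * (\<integral>\<^sup>+\<omega>. (\<Sum>l. ennreal ((avg n (hcov (Suc l) (Suc j)) \<omega>)\<^sup>2)) \<partial>M))"
      unfolding Vcov_def
      by (intro nn_integral_cmult_suminf borel_measurable_suminf_order avg_sq_measurable) auto
    also have "\<dots> = (\<Sum>j. \<integral>\<^sup>+\<omega>. ennreal (real n) * (\<Sum>l. ennreal ((avg n (hcov (Suc l) (Suc j)) \<omega>)\<^sup>2)) \<partial>M)"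
      by (intro suminf_cong nn_integral_cmult[symmetric] borel_measurable_suminf_order avg_sq_measurable) auto
    also have "\<dots> = (\<Sum>j. \<Sum>l. ennreal (real n) * (\<integral>\<^sup>+\<omega>. ennreal ((avg n (hcov (Suc l) (Suc j)) \<omega>)\<^sup>2) \<partial>M))"
      by (intro suminf_cong nn_integral_cmult_suminf avg_sq_measurable) auto
    finally show ?thesis .
  qed
  also have "\<dots> \<le> (\<Sum>j. \<Sum>l. ennreal (C1 * (\<kappa> (Suc l) * \<kappa> (Suc j))))"
    by (intro suminf_le nn_avg_hcov n) auto
  also have "\<dots> = (\<Sum>j. \<Sum>l. ennreal (C1 * \<kappa> (Suc j)) * ennreal (\<kappa> (Suc l)))"
    using C1 pos by (intro suminf_cong) (simp add: ennreal_mult[symmetric] less_imp_le mult_ac)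
  also have "\<dots> = (\<Sum>j. ennreal (C1 * \<kappa> (Suc j))) * (\<Sum>l. ennreal (\<kappa> (Suc l)))"
    by (simp add: ennreal_suminf_cmult ennreal_suminf_multc)
  also have "(\<Sum>j. ennreal (C1 * \<kappa> (Suc j))) = ennreal C1 * (\<Sum>j. ennreal (\<kappa> (Suc j)))"
    using C1 pos by (subst ennreal_suminf_cmult[symmetric]) (simp add: ennreal_mult less_imp_le)
  also have "ennreal C1 * (\<Sum>j. ennreal (\<kappa> (Suc j))) * (\<Sum>l. ennreal (\<kappa> (Suc l)))
      \<le> ennreal C1 * ennreal (C1 * zeta_sum \<alpha>) * ennreal (C1 * zeta_sum \<alpha>)"
    by (intro mult_mono sum_kappa_le) auto
  also have "\<dots> = ennreal (C1 * (C1 * zeta_sum \<alpha>)\<^sup>2)"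
    using C1 zeta_sum_nonneg[OF alpha] by (simp add: ennreal_mult[symmetric] power2_eq_square mult_ac)
  finally show ?thesis .
qed

lemma nn_Vmean:
  assumes n: "1 \<le> n"
  shows "(\<integral>\<^sup>+\<omega>. Vmean n \<omega> \<partial>M) \<le> ennreal (C1 * zeta_sum \<alpha>)"
proof -
  have "(\<integral>\<^sup>+\<omega>. Vmean n \<omega> \<partial>M)
      = (\<Sum>k. ennreal (real n) * (\<integral>\<^sup>+\<omega>. ennreal ((avg n (hxi (Suc k)) \<omega>)\<^sup>2) \<partial>M))"
    unfolding Vmean_def by (intro nn_integral_cmult_suminf avg_sq_measurable) auto
  also have "\<dots> = (\<Sum>k. ennreal (\<kappa> (Suc k)))" by (intro suminf_cong nn_avg_hxi n) simp
  finally show ?thesis using sum_kappa_le by simp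
qed

lemma nn_Vnoise:
  assumes n: "1 \<le> n"
  shows "(\<integral>\<^sup>+\<omega>. Vnoise n \<omega> \<partial>M) \<le> ennreal (C1 * (C1 * zeta_sum \<alpha>))"
proof -
  have "(\<integral>\<^sup>+\<omega>. Vnoise n \<omega> \<partial>M)
      = (\<Sum>k. ennreal (real n) * (\<Sum>j. \<integral>\<^sup>+\<omega>. ennreal ((avg n (hnoise (Suc j) (Suc k)) \<omega>)\<^sup>2) \<partial>M))"
  proof -
    have "(\<integral>\<^sup>+\<omega>. Vnoise n \<omega> \<partial>M)
        = (\<Sum>k. ennreal (real n) * (\<integral>\<^sup>+\<omega>. (\<Sum>j. ennreal ((avg n (hnoise (Suc j) (Suc k)) \<omega>)\<^sup>2)) \<partial>M))"
      unfolding Vnoise_def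
      by (intro nn_integral_cmult_suminf borel_measurable_suminf_order avg_sq_measurable) auto
    also have "(\<lambda>k. \<integral>\<^sup>+\<omega>. (\<Sum>j. ennreal ((avg n (hnoise (Suc j) (Suc k)) \<omega>)\<^sup>2)) \<partial>M)
        = (\<lambda>k. \<Sum>j. \<integral>\<^sup>+\<omega>. ennreal ((avg n (hnoise (Suc j) (Suc k)) \<omega>)\<^sup>2) \<partial>M)"
      by (intro ext nn_integral_suminf avg_sq_measurable) auto
    finally show ?thesis .
  qed
  also have "\<dots> \<le> (\<Sum>k. ennreal (C1 * \<kappa> (Suc k)))" by (intro suminf_le nn_avg_hnoise n) auto
  also have "\<dots> = ennreal C1 * (\<Sum>j. ennreal (\<kappa> (Suc j)))"
    using C1 pos by (subst ennreal_suminf_cmult[symmetric]) (simp add: ennreal_mult less_imp_le)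
  also have "\<dots> \<le> ennreal C1 * ennreal (C1 * zeta_sum \<alpha>)" by (intro mult_left_mono sum_kappa_le) simp
  finally show ?thesis using C1 zeta_sum_nonneg[OF alpha] by (simp add: ennreal_mult)
qed

lemma nn_Vnoise_mean:
  assumes n: "1 \<le> n"
  shows "(\<integral>\<^sup>+\<omega>. Vnoise_mean n \<omega> \<partial>M) \<le> ennreal C1"
proof -
  have "(\<integral>\<^sup>+\<omega>. Vnoise_mean n \<omega> \<partial>M)
      = (\<Sum>j. ennreal (real n) * (\<integral>\<^sup>+\<omega>. ennreal ((avg n (heta (Suc j)) \<omega>)\<^sup>2) \<partial>M))"
    unfolding Vnoise_mean_def by (intro nn_integral_cmult_suminf avg_sq_measurable) auto
  also have "\<dots> = ennreal (real n) * (\<Sum>j. \<integral>\<^sup>+\<omega>. ennreal ((avg n (heta (Suc j)) \<omega>)\<^sup>2) \<partial>M)"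
    by (rule ennreal_suminf_cmult)
  finally have "(\<integral>\<^sup>+\<omega>. Vnoise_mean n \<omega> \<partial>M)
      = ennreal (real n) * (\<Sum>j. \<integral>\<^sup>+\<omega>. ennreal ((avg n (heta (Suc j)) \<omega>)\<^sup>2) \<partial>M)" .
  with nn_avg_heta[OF n] show ?thesis by simp
qed

lemma suminf_ennreal_le_const:
  assumes "\<And>N. (\<Sum>k<N. f k) \<le> B"
  shows "(\<Sum>k. f k) \<le> (B :: ennreal)"
  unfolding suminf_eq_SUP using assms by (intro SUP_least)

text \<open>Term by term the expectation is the variance of a covariance entry divided by a squared gap, so
  that \<open>weight_sum_le\<close> applies.\<close>
lemma nn_Ucol:
  assumes n: "1 \<le> n" and j: "1 \<le> j"
  shows "ennreal (real n) * (\<integral>\<^sup>+\<omega>. Ucol n j \<omega> \<partial>M) \<le> ennreal (C1 * weight_const * (real j)\<^sup>2)"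
proof -
  have "ennreal (real n) * (\<integral>\<^sup>+\<omega>. Ucol n j \<omega> \<partial>M)
      = (\<Sum>l. ennreal (gap_weight (Suc l) j) * (ennreal (real n) * (\<integral>\<^sup>+\<omega>. ennreal ((avg n (hcov (Suc l) j) \<omega>)\<^sup>2) \<partial>M)))"
  proof -
    have "(\<integral>\<^sup>+\<omega>. Ucol n j \<omega> \<partial>M)
        = (\<Sum>l. \<integral>\<^sup>+\<omega>. ennreal (gap_weight (Suc l) j) * ennreal ((avg n (hcov (Suc l) j) \<omega>)\<^sup>2) \<partial>M)"
      unfolding Ucol_def using j
      by (intro nn_integral_suminf borel_measurable_times_ennreal avg_sq_measurable) auto
    also have "\<dots> = (\<Sum>l. ennreal (gap_weight (Suc l) j) * (\<integral>\<^sup>+\<omega>. ennreal ((avg n (hcov (Suc l) j) \<omega>)\<^sup>2) \<partial>M))"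
      using j by (intro suminf_cong nn_integral_cmult avg_sq_measurable) auto
    finally show ?thesis
      by (simp only: ennreal_suminf_cmult[symmetric] mult.left_commute[of "ennreal (real n)"])
  qed
  also have "\<dots> \<le> (\<Sum>l. ennreal (gap_weight (Suc l) j) * ennreal (C1 * (\<kappa> (Suc l) * \<kappa> j)))"
    using j by (intro suminf_le mult_left_mono nn_avg_hcov n) auto
  also have "\<dots> \<le> ennreal (C1 * weight_const * (real j)\<^sup>2)"
  proof (rule suminf_ennreal_le_const)
    fix N
    have nn: "0 \<le> gap_weight l j" for l by (simp add: gap_weight_def)
    have nonneg: "0 \<le> gap_weight l j * (C1 * (\<kappa> l * \<kappa> j))" if "1 \<le> l" for l
      using nn C1 pos[OF that] pos[OF j] by (intro mult_nonneg_nonneg) auto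
    have "(\<Sum>l<N. ennreal (gap_weight (Suc l) j) * ennreal (C1 * (\<kappa> (Suc l) * \<kappa> j)))
        = (\<Sum>l<N. ennreal (gap_weight (Suc l) j * (C1 * (\<kappa> (Suc l) * \<kappa> j))))"
      using nn C1 pos j by (intro sum.cong refl ennreal_mult[symmetric]) (auto simp: less_imp_le)
    also have "\<dots> = ennreal (\<Sum>l<N. gap_weight (Suc l) j * (C1 * (\<kappa> (Suc l) * \<kappa> j)))"
      by (rule sum_ennreal) (use nonneg in auto)
    also have "(\<Sum>l<N. gap_weight (Suc l) j * (C1 * (\<kappa> (Suc l) * \<kappa> j)))
        = (\<Sum>l=1..N. gap_weight l j * (C1 * (\<kappa> l * \<kappa> j)))"
      by (simp add: sum.atLeast1_atMost_eq)
    also have "\<dots> = (\<Sum>l\<in>{1..N} - {j}. C1 * (\<kappa> l * \<kappa> j / (\<kappa> l - \<kappa> j)\<^sup>2))"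
      by (rule sum.mono_neutral_cong_right) (auto simp: gap_weight_def)
    also have "\<dots> \<le> C1 * (weight_const * (real j)\<^sup>2)"
      unfolding sum_distrib_left[symmetric] using C1 by (intro mult_left_mono weight_sum_le j) auto
    finally show "(\<Sum>l<N. ennreal (gap_weight (Suc l) j) * ennreal (C1 * (\<kappa> (Suc l) * \<kappa> j)))
        \<le> ennreal (C1 * weight_const * (real j)\<^sup>2)" by (simp add: mult.assoc ennreal_leI)
  qed
  finally show ?thesis .
qed

lemma nn_Veigen:
  assumes n: "1 \<le> n" and m: "1 \<le> m"
  shows "(\<integral>\<^sup>+\<omega>. Veigen n m \<omega> \<partial>M) \<le> ennreal (C1 * weight_const)"
proof -
  have split: "ennreal (real n / real m) = ennreal (1 / real m) * ennreal (real n)"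
    by (simp add: ennreal_mult[symmetric])
  have "(\<integral>\<^sup>+\<omega>. Veigen n m \<omega> \<partial>M)
      = ennreal (real n / real m) * (\<Sum>j=1..m. ennreal (1 / (real j)\<^sup>2) * (\<integral>\<^sup>+\<omega>. Ucol n j \<omega> \<partial>M))"
    unfolding Veigen_def by (intro nn_integral_cmult_sum Ucol_measurable) auto
  also have "\<dots> = ennreal (1 / real m) * (\<Sum>j=1..m. ennreal (1 / (real j)\<^sup>2) * (ennreal (real n) * (\<integral>\<^sup>+\<omega>. Ucol n j \<omega> \<partial>M)))"
    unfolding split mult.assoc sum_distrib_left by (intro sum.cong refl) (simp only: ac_simps)
  also have "\<dots> \<le> ennreal (1 / real m) * (\<Sum>j=1..m. ennreal (1 / (real j)\<^sup>2) * ennreal (C1 * weight_const * (real j)\<^sup>2))"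
    by (intro mult_left_mono sum_mono nn_Ucol n) auto
  also have "(\<Sum>j=1..m. ennreal (1 / (real j)\<^sup>2) * ennreal (C1 * weight_const * (real j)\<^sup>2)) = (\<Sum>j=1..m. ennreal (C1 * weight_const))"
    using C1 weight_const_nonneg by (intro sum.cong refl) (simp add: ennreal_mult[symmetric])
  also have "\<dots> = ennreal (real m * (C1 * weight_const))"
    using C1 weight_const_nonneg by (simp add: ennreal_of_nat_eq_real_of_nat ennreal_mult[symmetric])
  also have "ennreal (1 / real m) * \<dots> = ennreal (C1 * weight_const)"
    using m C1 weight_const_nonneg by (simp add: ennreal_mult[symmetric])
  finally show ?thesis .
qed

lemma sum_inverse_kappa_le:
  assumes "1 \<le> m"
  shows "real m powr (- \<alpha> - 1) * (\<Sum>k=1..m. 1 / \<kappa> k) \<le> 2 * \<alpha> * C1"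
proof -
  have "(\<Sum>k=1..m. 1 / \<kappa> k) \<le> (\<Sum>k=1..m. 2 * \<alpha> * C1 * real m powr \<alpha>)"
  proof (rule sum_mono)
    fix k assume k: "k \<in> {1..m}"
    have "1 / \<kappa> k \<le> 2 * \<alpha> * C1 * real k powr \<alpha>" using k by (intro inverse_kappa_le) auto
    also have "\<dots> \<le> 2 * \<alpha> * C1 * real m powr \<alpha>"
      using k alpha C1 by (intro mult_left_mono powr_mono2) auto
    finally show "1 / \<kappa> k \<le> 2 * \<alpha> * C1 * real m powr \<alpha>" .
  qed
  also have "\<dots> = 2 * \<alpha> * C1 * real m powr (\<alpha> + 1)" using assms by (simp add: powr_add)
  finally have "real m powr (- \<alpha> - 1) * (\<Sum>k=1..m. 1 / \<kappa> k)
      \<le> real m powr (- \<alpha> - 1) * (2 * \<alpha> * C1 * real m powr (\<alpha> + 1))"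
    by (intro mult_left_mono) auto
  also have "\<dots> = 2 * \<alpha> * C1 * (real m powr (- \<alpha> - 1) * real m powr (\<alpha> + 1))" by simp
  also have "real m powr (- \<alpha> - 1) * real m powr (\<alpha> + 1) = 1"
    using assms by (simp add: powr_add[symmetric])
  finally show ?thesis by simp
qed

lemma nn_coef_sum:
  assumes n: "1 \<le> n" and m: "1 \<le> m" and c: "0 \<le> c"
    and G: "\<And>k. 1 \<le> k \<Longrightarrow> G k \<in> borel_measurable M"
      "\<And>k. 1 \<le> k \<Longrightarrow> ennreal (real n) * (\<integral>\<^sup>+\<omega>. G k \<omega> \<partial>M) \<le> ennreal (c * \<kappa> k)"
  shows "(\<integral>\<^sup>+\<omega>. ennreal (real n * real m powr (- \<alpha> - 1)) * (\<Sum>k=1..m. ennreal (1 / (\<kappa> k)\<^sup>2) * G k \<omega>) \<partial>M)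
    \<le> ennreal (c * (2 * \<alpha> * C1))"
proof -
  let ?p = "real m powr (- \<alpha> - 1)"
  have split: "ennreal (real n * ?p) = ennreal ?p * ennreal (real n)"
    by (simp add: ennreal_mult[symmetric] mult.commute)
  have "(\<integral>\<^sup>+\<omega>. ennreal (real n * ?p) * (\<Sum>k=1..m. ennreal (1 / (\<kappa> k)\<^sup>2) * G k \<omega>) \<partial>M)
      = ennreal (real n * ?p) * (\<Sum>k=1..m. ennreal (1 / (\<kappa> k)\<^sup>2) * (\<integral>\<^sup>+\<omega>. G k \<omega> \<partial>M))"
    by (intro nn_integral_cmult_sum G(1)) auto
  also have "\<dots> = ennreal ?p * (\<Sum>k=1..m. ennreal (1 / (\<kappa> k)\<^sup>2) * (ennreal (real n) * (\<integral>\<^sup>+\<omega>. G k \<omega> \<partial>M)))"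
    unfolding split mult.assoc sum_distrib_left by (intro sum.cong refl) (simp only: ac_simps)
  also have "\<dots> \<le> ennreal ?p * (\<Sum>k=1..m. ennreal (1 / (\<kappa> k)\<^sup>2) * ennreal (c * \<kappa> k))"
    using G(2) by (intro mult_left_mono sum_mono) auto
  also have "(\<Sum>k=1..m. ennreal (1 / (\<kappa> k)\<^sup>2) * ennreal (c * \<kappa> k)) = (\<Sum>k=1..m. ennreal (c * (1 / \<kappa> k)))"
  proof (intro sum.cong refl)
    fix k assume "k \<in> {1..m}"
    then have "0 < \<kappa> k" using pos by simp
    then show "ennreal (1 / (\<kappa> k)\<^sup>2) * ennreal (c * \<kappa> k) = ennreal (c * (1 / \<kappa> k))"
      using c by (simp add: ennreal_mult[symmetric] power2_eq_square)
  qed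
  also have "\<dots> = ennreal (\<Sum>k=1..m. c * (1 / \<kappa> k))"
    using c pos by (intro sum_ennreal) (simp add: less_imp_le)
  also have "ennreal ?p * \<dots> = ennreal (c * (?p * (\<Sum>k=1..m. 1 / \<kappa> k)))"
    using c pos
    by (subst ennreal_mult[symmetric]) (auto simp: sum_distrib_left mult_ac less_imp_le intro!: sum_nonneg)
  also have "\<dots> \<le> ennreal (c * (2 * \<alpha> * C1))"
    using c m by (intro ennreal_leI mult_left_mono sum_inverse_kappa_le)
  finally show ?thesis .
qed

lemma nn_Vnoise_coef:
  assumes "1 \<le> n" "1 \<le> m"
  shows "(\<integral>\<^sup>+\<omega>. Vnoise_coef n m \<omega> \<partial>M) \<le> ennreal (C1 * (2 * \<alpha> * C1))"
  unfolding Vnoise_coef_def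
proof (rule nn_coef_sum[OF assms])
  fix k :: nat assume k: "1 \<le> k"
  show "(\<lambda>\<omega>. \<Sum>j. ennreal ((avg n (hnoise (Suc j) k) \<omega>)\<^sup>2)) \<in> borel_measurable M"
    using k by (intro borel_measurable_suminf_order avg_sq_measurable) auto
  show "ennreal (real n) * (\<integral>\<^sup>+\<omega>. (\<Sum>j. ennreal ((avg n (hnoise (Suc j) k) \<omega>)\<^sup>2)) \<partial>M) \<le> ennreal (C1 * \<kappa> k)"
    using nn_avg_hnoise[OF assms(1) k] k avg_sq_measurable(4)
    by (subst nn_integral_suminf) auto
qed (use C1 in simp)

lemma nn_Vmean_coef:
  assumes "1 \<le> n" "1 \<le> m"
  shows "(\<integral>\<^sup>+\<omega>. Vmean_coef n m \<omega> \<partial>M) \<le> ennreal (1 * (2 * \<alpha> * C1))"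
  unfolding Vmean_coef_def
proof (rule nn_coef_sum[OF assms])
  fix k :: nat assume k: "1 \<le> k"
  show "(\<lambda>\<omega>. ennreal ((avg n (hxi k) \<omega>)\<^sup>2)) \<in> borel_measurable M" by (rule avg_sq_measurable(1)[OF k])
  show "ennreal (real n) * (\<integral>\<^sup>+\<omega>. ennreal ((avg n (hxi k) \<omega>)\<^sup>2) \<partial>M) \<le> ennreal (1 * \<kappa> k)"
    by (simp add: nn_avg_hxi[OF assms(1) k])
qed simp

text \<open>One statistic for all, so that a single application of Markov's inequality controls everything
  simultaneously.\<close>
definition V :: "nat \<Rightarrow> nat \<Rightarrow> nat \<Rightarrow> 'w \<Rightarrow> ennreal" where
  "V n m1 m2 \<omega> = Vcov n \<omega> + Vmean n \<omega> + Vnoise n \<omega> + Vnoise_mean n \<omega> + Veigen n m1 \<omega> + Veigen n m2 \<omega>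
     + Vnoise_coef n m2 \<omega> + Vmean_coef n m2 \<omega>"

definition V_const :: real where
  "V_const = C1 * (C1 * zeta_sum \<alpha>)\<^sup>2 + C1 * zeta_sum \<alpha> + C1 * (C1 * zeta_sum \<alpha>) + C1
     + C1 * weight_const + C1 * weight_const + C1 * (2 * \<alpha> * C1) + 1 * (2 * \<alpha> * C1)"

lemma nn_V:
  assumes "1 \<le> n" "1 \<le> m1" "1 \<le> m2"
  shows "(\<integral>\<^sup>+\<omega>. V n m1 m2 \<omega> \<partial>M) \<le> ennreal V_const"
proof -
  note [measurable] = V_measurable
  have "(\<integral>\<^sup>+\<omega>. V n m1 m2 \<omega> \<partial>M) = (\<integral>\<^sup>+\<omega>. Vcov n \<omega> \<partial>M) + (\<integral>\<^sup>+\<omega>. Vmean n \<omega> \<partial>M) + (\<integral>\<^sup>+\<omega>. Vnoise n \<omega> \<partial>M)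
      + (\<integral>\<^sup>+\<omega>. Vnoise_mean n \<omega> \<partial>M) + (\<integral>\<^sup>+\<omega>. Veigen n m1 \<omega> \<partial>M) + (\<integral>\<^sup>+\<omega>. Veigen n m2 \<omega> \<partial>M)
      + (\<integral>\<^sup>+\<omega>. Vnoise_coef n m2 \<omega> \<partial>M) + (\<integral>\<^sup>+\<omega>. Vmean_coef n m2 \<omega> \<partial>M)"
    unfolding V_def by (simp add: nn_integral_add)
  also have "\<dots> \<le> ennreal (C1 * (C1 * zeta_sum \<alpha>)\<^sup>2) + ennreal (C1 * zeta_sum \<alpha>) + ennreal (C1 * (C1 * zeta_sum \<alpha>))
      + ennreal C1 + ennreal (C1 * weight_const) + ennreal (C1 * weight_const)
      + ennreal (C1 * (2 * \<alpha> * C1)) + ennreal (1 * (2 * \<alpha> * C1))"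
    using assms
    by (intro add_mono nn_Vcov nn_Vmean nn_Vnoise nn_Vnoise_mean nn_Veigen nn_Vnoise_coef nn_Vmean_coef)
  also have "\<dots> = ennreal V_const"
    unfolding V_const_def using C1 alpha zeta_sum_nonneg[OF alpha] weight_const_nonneg
    by (simp add: ennreal_plus[symmetric] del: ennreal_plus)
  finally show ?thesis .
qed

lemma V_const_pos: "0 < V_const"
  unfolding V_const_def using C1 alpha zeta_sum_nonneg[OF alpha] weight_const_nonneg
  by (intro add_nonneg_pos add_nonneg_nonneg) auto

lemma V_tail:
  assumes "1 \<le> n" "1 \<le> m1" "1 \<le> m2" and L: "0 < L"
  shows "{\<omega> \<in> space M. \<not> V n m1 m2 \<omega> \<le> ennreal L} \<in> sets M"
    and "measure M {\<omega> \<in> space M. \<not> V n m1 m2 \<omega> \<le> ennreal L} \<le> V_const / L"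
proof -
  have [measurable]: "V n m1 m2 \<in> borel_measurable M"
    unfolding V_def[abs_def] by (intro borel_measurable_add V_measurable)
  show meas: "{\<omega> \<in> space M. \<not> V n m1 m2 \<omega> \<le> ennreal L} \<in> sets M" by measurable
  have "emeasure M {\<omega> \<in> space M. \<not> V n m1 m2 \<omega> \<le> ennreal L}
      \<le> emeasure M {\<omega> \<in> space M. 1 \<le> ennreal (1 / L) * V n m1 m2 \<omega>}"
  proof (intro emeasure_mono subsetI)
    fix \<omega> assume "\<omega> \<in> {\<omega> \<in> space M. \<not> V n m1 m2 \<omega> \<le> ennreal L}"
    then have \<omega>: "\<omega> \<in> space M" "ennreal L \<le> V n m1 m2 \<omega>" by auto
    have "1 = ennreal (1 / L) * ennreal L" using L by (simp add: ennreal_mult[symmetric])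
    also have "\<dots> \<le> ennreal (1 / L) * V n m1 m2 \<omega>" using \<omega> by (intro mult_left_mono) auto
    finally show "\<omega> \<in> {\<omega> \<in> space M. 1 \<le> ennreal (1 / L) * V n m1 m2 \<omega>}" using \<omega> by simp
  qed measurable
  also have "\<dots> \<le> ennreal (1 / L) * (\<integral>\<^sup>+\<omega>. V n m1 m2 \<omega> * indicator (space M) \<omega> \<partial>M)"
    by (rule nn_integral_Markov_inequality) auto
  also have "(\<integral>\<^sup>+\<omega>. V n m1 m2 \<omega> * indicator (space M) \<omega> \<partial>M) = (\<integral>\<^sup>+\<omega>. V n m1 m2 \<omega> \<partial>M)"
    by (intro nn_integral_cong) simp
  also have "ennreal (1 / L) * \<dots> \<le> ennreal (1 / L) * ennreal V_const"
    using assms by (intro mult_left_mono nn_V) auto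
  also have "\<dots> = ennreal (V_const / L)"
    using L V_const_pos by (simp add: ennreal_mult[symmetric])
  finally show "measure M {\<omega> \<in> space M. \<not> V n m1 m2 \<omega> \<le> ennreal L} \<le> V_const / L"
    using L V_const_pos by (simp add: emeasure_eq_measure)
qed

end

section \<open>The stochastic bound\<close>

lemma ennreal_mult_le_imp_le_divide:
  assumes "ennreal a * ennreal x \<le> ennreal L" "0 < a" "0 \<le> x" "0 \<le> L"
  shows "x \<le> L / a"
proof -
  have "ennreal (a * x) \<le> ennreal L" using assms by (simp add: ennreal_mult)
  then have "a * x \<le> L" using assms by (simp add: ennreal_le_iff)
  then show ?thesis using assms by (simp add: pos_le_divide_eq mult.commute)
qed

lemma ennreal_add_leD:
  assumes "a + b \<le> (c :: ennreal)"
  shows "a \<le> c" "b \<le> c"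
  using assms by (auto intro: order_trans[rotated])

lemma finite_ennreal_lincomb:
  assumes "ennreal a * (\<Sum>j\<in>A. ennreal (w j) * u j) \<le> ennreal L" "0 < a" "finite A" "j \<in> A" "0 < w j"
  shows "u j < top"
proof (rule ccontr)
  assume "\<not> u j < top"
  then have "ennreal (w j) * u j = top" using assms by (simp add: less_top[symmetric] ennreal_mult_top)
  moreover have "ennreal (w j) * u j \<le> (\<Sum>j\<in>A. ennreal (w j) * u j)"
    using assms by (intro member_le_sum) auto
  ultimately have "(\<Sum>j\<in>A. ennreal (w j) * u j) = top"
    by (simp only: top_unique)
  then have "ennreal a * (\<Sum>j\<in>A. ennreal (w j) * u j) = top"
    using assms(2) by (simp only: ennreal_mult_top) simp
  with assms(1) show False by (simp add: top_unique)
qed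

context flr_sample
begin

lemma functional_sample_at:
  "\<omega> \<in> space M \<Longrightarrow> 1 \<le> n \<Longrightarrow> functional_sample n (\<lambda>i. Xs i \<omega>) (\<lambda>i. Ys i \<omega>) mX mY b"
  using L2_random_variable_in_L2[OF rvXs] L2_random_variable_in_L2[OF rvYs]
  by unfold_locales (auto intro: mX mY b_L2)

text \<open>The event on which \<open>V\<close> is bounded is measurable although the empirical eigenfunctions, being
  chosen separately for every sample point, need not be: on this event the deterministic bound
  holds for whichever eigenfunctions were chosen.  The proof translates the coordinates of \<open>V\<close> back
  into norms by Parseval's identity.\<close>
lemma risk_bound_at:
  assumes \<omega>: "\<omega> \<in> space M" and n: "1 \<le> n" and m: "1 \<le> m1" "1 \<le> m2"
    and L: "0 < L" and VL: "V n m1 m2 \<omega> \<le> ennreal L"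
    and small: "sqrt (L / real n) + L / real n \<le> real (max m1 m2) powr (- \<alpha> - 1) / (4 * C1)"
    and spec': "spectral_expansion unit_I (sample_cov n (\<lambda>i. Xs i \<omega>)) \<kappa>' \<phi>'"
    and beta: "3 / 2 < \<beta>" and gamma: "3 / 2 < \<gamma>"
    and b_decay: "\<And>j k. 1 \<le> j \<Longrightarrow> 1 \<le> k \<Longrightarrow>
      \<bar>l2inner unit_I2 b (tensor (\<phi> j) (\<phi> k))\<bar> \<le> C1 * real j powr (- \<gamma>) * real k powr (- \<beta>)"
  shows "(l2norm unit_I2 (\<lambda>p. b_tilde n m1 m2 (\<lambda>i. Xs i \<omega>) (\<lambda>i. Ys i \<omega>) \<kappa>' \<phi>' d p - b p))\<^sup>2
    \<le> risk_const \<alpha> \<beta> \<gamma> C1 L * ((real m1 + real m2 powr (\<alpha> + 1)) / real n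
        + real m1 powr (- 2 * \<gamma> + 1) + real m2 powr (- 2 * \<beta> + 1))"
proof -
  interpret FS: functional_sample n "\<lambda>i. Xs i \<omega>" "\<lambda>i. Ys i \<omega>" mX mY b
    by (rule functional_sample_at[OF \<omega> n])
  interpret ES: estimator_setting \<kappa> \<alpha> C1 n "\<lambda>i. Xs i \<omega>" "\<lambda>i. Ys i \<omega>" mX mY b "cov_kernel M X" \<phi> \<phi>' \<kappa>' \<beta> \<gamma>
    by unfold_locales (use K_L2 K_spec spec' beta gamma b_decay in auto)
  have n0: "0 < real n" using n by simp
  have hxi_at: "hxi k (W i \<omega>) = l2inner unit_I (FS.xc i) (\<phi> k)"
    and heta_at: "heta k (W i \<omega>) = l2inner unit_I (FS.eps i) (\<phi> k)" for i k
    by (simp_all add: hxi_def heta_def FS.xc_def FS.eps_def regression_residual_def)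
  have avg_hxi: "avg n (hxi k) \<omega> = l2inner unit_I FS.xbar (\<phi> k)" if "1 \<le> k" for k
    using that by (simp add: avg_def hxi_at FS.l2inner_xbar phi)
  have avg_heta: "avg n (heta j) \<omega> = l2inner unit_I FS.ebar (\<phi> j)" if "1 \<le> j" for j
    using that by (simp add: avg_def heta_at FS.l2inner_ebar phi)
  have avg_hnoise: "avg n (hnoise j k) \<omega> = l2inner unit_I2 FS.S0 (tensor (\<phi> j) (\<phi> k))" if "1 \<le> j" "1 \<le> k" for j k
    using that by (simp add: avg_def hnoise_def hxi_at heta_at FS.l2inner_S0 phi)
  let ?D = "\<lambda>p. FS.C0 p - cov_kernel M X p"
  have D_L2: "?D \<in> L2 unit_I2" by (intro L2_diff FS.C0 K_L2)
  have avg_hcov: "avg n (hcov l j) \<omega> = l2inner unit_I2 ?D (tensor (\<phi> l) (\<phi> j))" if "1 \<le> l" "1 \<le> j" for l j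
  proof -
    have "l2inner unit_I2 ?D (tensor (\<phi> l) (\<phi> j))
        = (\<Sum>i=1..n. hxi l (W i \<omega>) * hxi j (W i \<omega>)) / real n - (if l = j then \<kappa> j else 0)"
      using that
      by (simp add: l2inner_diff_left FS.C0 K_L2 tensor_in_L2 sfI phi FS.l2inner_C0 cov_kernel_coef hxi_at)
    also have "\<dots> = avg n (hcov l j) \<omega>"
      using n by (simp add: avg_def hcov_def sum_subtractf diff_divide_distrib)
    finally show ?thesis ..
  qed
  have slice_S0: "slice unit_I FS.S0 (\<phi> k) \<in> L2 unit_I" if "1 \<le> k" for k
    by (intro slice_in_L2 sfI FS.S0 phi that)
  have slice_norm: "(\<Sum>j. ennreal ((avg n (hnoise (Suc j) k) \<omega>)\<^sup>2)) = ennreal ((l2norm unit_I (slice unit_I FS.S0 (\<phi> k)))\<^sup>2)"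
    if k: "1 \<le> k" for k
    using L2_onb_Parseval_ennreal[OF onb slice_S0[OF k]] k
    by (simp add: l2inner_slice[OF sfI sfI FS.S0] phi avg_hnoise)
  have comps: "Vcov n \<omega> \<le> ennreal L" "Vmean n \<omega> \<le> ennreal L" "Vnoise n \<omega> \<le> ennreal L"
    "Vnoise_mean n \<omega> \<le> ennreal L" "Veigen n m1 \<omega> \<le> ennreal L" "Veigen n m2 \<omega> \<le> ennreal L"
    "Vnoise_coef n m2 \<omega> \<le> ennreal L" "Vmean_coef n m2 \<omega> \<le> ennreal L"
    using VL unfolding V_def by (meson ennreal_add_leD)+
  define U where "U j = enn2real (Ucol n j \<omega>)" for j
  have eigen: "(\<forall>j\<in>{1..m}. Ucol n j \<omega> = ennreal (U j)) \<and> (\<Sum>j=1..m. U j / (real j)\<^sup>2) \<le> L * real m / real n"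
    if m': "1 \<le> m" and le: "Veigen n m \<omega> \<le> ennreal L" for m
  proof -
    have fin: "Ucol n j \<omega> = ennreal (U j)" if "j \<in> {1..m}" for j
      using finite_ennreal_lincomb[OF le[unfolded Veigen_def] _ _ that] n m' that
      by (simp add: U_def)
    have "(\<Sum>j=1..m. ennreal (1 / (real j)\<^sup>2) * Ucol n j \<omega>) = (\<Sum>j=1..m. ennreal (U j / (real j)\<^sup>2))"
    proof (intro sum.cong refl)
      fix j assume "j \<in> {1..m}"
      from fin[OF this] have "ennreal (1 / (real j)\<^sup>2) * Ucol n j \<omega> = ennreal (1 / (real j)\<^sup>2) * ennreal (U j)" by simp
      also have "\<dots> = ennreal (1 / (real j)\<^sup>2 * U j)" by (rule ennreal_mult[symmetric]) (simp_all add: U_def)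
      finally show "ennreal (1 / (real j)\<^sup>2) * Ucol n j \<omega> = ennreal (U j / (real j)\<^sup>2)" by simp
    qed
    also have "\<dots> = ennreal (\<Sum>j=1..m. U j / (real j)\<^sup>2)"
      by (rule sum_ennreal) (simp add: U_def)
    finally have "ennreal (real n / real m) * ennreal (\<Sum>j=1..m. U j / (real j)\<^sup>2) \<le> ennreal L"
      using le by (simp add: Veigen_def)
    from ennreal_mult_le_imp_le_divide[OF this] n m' L
    have "(\<Sum>j=1..m. U j / (real j)\<^sup>2) \<le> L / (real n / real m)"
      by (simp add: U_def sum_nonneg)
    then show ?thesis using fin by simp
  qed
  have powr_inv: "L / (real n * real m2 powr (- \<alpha> - 1)) = L * real m2 powr (\<alpha> + 1) / real n"
  proof -
    have "real m2 powr (- \<alpha> - 1) = inverse (real m2 powr (\<alpha> + 1))"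
      by (simp add: powr_minus[symmetric])
    then show ?thesis by (simp add: divide_inverse)
  qed
  have coefs: "(\<Sum>k=1..m2. G k / (\<kappa> k)\<^sup>2) \<le> L * real m2 powr (\<alpha> + 1) / real n"
    if G: "\<And>k. 1 \<le> k \<Longrightarrow> 0 \<le> G k"
      and le: "ennreal (real n * real m2 powr (- \<alpha> - 1)) * (\<Sum>k=1..m2. ennreal (1 / (\<kappa> k)\<^sup>2) * ennreal (G k)) \<le> ennreal L" for G
  proof -
    have "(\<Sum>k=1..m2. ennreal (1 / (\<kappa> k)\<^sup>2) * ennreal (G k)) = (\<Sum>k=1..m2. ennreal (G k / (\<kappa> k)\<^sup>2))"
      using G by (intro sum.cong refl) (simp add: ennreal_mult[symmetric])
    also have "\<dots> = ennreal (\<Sum>k=1..m2. G k / (\<kappa> k)\<^sup>2)"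
      using G by (intro sum_ennreal) simp
    finally have "ennreal (real n * real m2 powr (- \<alpha> - 1)) * ennreal (\<Sum>k=1..m2. G k / (\<kappa> k)\<^sup>2) \<le> ennreal L"
      using le by simp
    moreover have "0 \<le> (\<Sum>k=1..m2. G k / (\<kappa> k)\<^sup>2)" using G by (intro sum_nonneg) auto
    ultimately have "(\<Sum>k=1..m2. G k / (\<kappa> k)\<^sup>2) \<le> L / (real n * real m2 powr (- \<alpha> - 1))"
      using n m L by (intro ennreal_mult_le_imp_le_divide) auto
    then show ?thesis by (simp only: powr_inv)
  qed
  show ?thesis
  proof (rule ES.risk_bound[where U = U])
    show "0 < L" "1 \<le> m1" "1 \<le> m2" by fact+
    have "(\<Sum>j. \<Sum>l. ennreal ((avg n (hcov (Suc l) (Suc j)) \<omega>)\<^sup>2)) = ennreal ((l2norm unit_I2 ?D)\<^sup>2)"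
      using L2_onb_tensor_Parseval_ennreal(2)[OF sfI sfI onb onb D_L2] by (simp add: avg_hcov)
    then show "(l2norm unit_I2 ?D)\<^sup>2 \<le> L / real n"
      using comps(1) L n0 unfolding Vcov_def by (intro ennreal_mult_le_imp_le_divide) auto
    have "(\<Sum>k. ennreal ((avg n (hxi (Suc k)) \<omega>)\<^sup>2)) = ennreal ((l2norm unit_I FS.xbar)\<^sup>2)"
      using L2_onb_Parseval_ennreal[OF onb FS.xbar] by (simp add: avg_hxi)
    then show "(l2norm unit_I FS.xbar)\<^sup>2 \<le> L / real n"
      using comps(2) L n0 unfolding Vmean_def by (intro ennreal_mult_le_imp_le_divide) auto
    have "(\<Sum>k. \<Sum>j. ennreal ((avg n (hnoise (Suc j) (Suc k)) \<omega>)\<^sup>2)) = ennreal ((l2norm unit_I2 FS.S0)\<^sup>2)"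
      using L2_onb_tensor_Parseval_ennreal(2)[OF sfI sfI onb onb FS.S0] by (simp add: avg_hnoise)
    then show "(l2norm unit_I2 FS.S0)\<^sup>2 \<le> L / real n"
      using comps(3) L n0 unfolding Vnoise_def by (intro ennreal_mult_le_imp_le_divide) auto
    have "(\<Sum>j. ennreal ((avg n (heta (Suc j)) \<omega>)\<^sup>2)) = ennreal ((l2norm unit_I FS.ebar)\<^sup>2)"
      using L2_onb_Parseval_ennreal[OF onb FS.ebar] by (simp add: avg_heta)
    then show "(l2norm unit_I FS.ebar)\<^sup>2 \<le> L / real n"
      using comps(4) L n0 unfolding Vnoise_mean_def by (intro ennreal_mult_le_imp_le_divide) auto
    show "(\<Sum>j=1..m. U j / (real j)\<^sup>2) \<le> L * real m / real n" if "m = m1 \<or> m = m2" for m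
      using that eigen[OF m(1) comps(5)] eigen[OF m(2) comps(6)] by auto
    show "(\<Sum>l\<in>{1..N} - {j}. (l2inner unit_I2 ?D (tensor (\<phi> l) (\<phi> j)))\<^sup>2 / (\<kappa> l - \<kappa> j)\<^sup>2) \<le> U j"
      if j: "1 \<le> j" "j \<le> max m1 m2" for j N
    proof -
      have Uj: "Ucol n j \<omega> = ennreal (U j)"
        using j eigen[OF m(1) comps(5)] eigen[OF m(2) comps(6)] by (auto simp: le_max_iff_disj)
      have "(\<Sum>l\<in>{1..N} - {j}. (l2inner unit_I2 ?D (tensor (\<phi> l) (\<phi> j)))\<^sup>2 / (\<kappa> l - \<kappa> j)\<^sup>2)
          = (\<Sum>l=1..N. gap_weight l j * (avg n (hcov l j) \<omega>)\<^sup>2)"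
        using j by (intro sum.mono_neutral_cong_left) (auto simp: gap_weight_def avg_hcov)
      also have "\<dots> = (\<Sum>l<N. gap_weight (Suc l) j * (avg n (hcov (Suc l) j) \<omega>)\<^sup>2)"
        by (simp add: sum.atLeast1_atMost_eq)
      finally have "ennreal (\<Sum>l\<in>{1..N} - {j}. (l2inner unit_I2 ?D (tensor (\<phi> l) (\<phi> j)))\<^sup>2 / (\<kappa> l - \<kappa> j)\<^sup>2)
          = ennreal (\<Sum>l<N. gap_weight (Suc l) j * (avg n (hcov (Suc l) j) \<omega>)\<^sup>2)" by simp
      also have "\<dots> = (\<Sum>l<N. ennreal (gap_weight (Suc l) j * (avg n (hcov (Suc l) j) \<omega>)\<^sup>2))"
        by (rule sum_ennreal[symmetric]) (simp add: gap_weight_def)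
      also have "\<dots> = (\<Sum>l<N. ennreal (gap_weight (Suc l) j) * ennreal ((avg n (hcov (Suc l) j) \<omega>)\<^sup>2))"
        by (intro sum.cong refl ennreal_mult) (auto simp: gap_weight_def)
      also have "\<dots> \<le> ennreal (U j)"
        unfolding Uj[symmetric] Ucol_def by (intro sum_le_suminf) auto
      finally show ?thesis by (simp add: ennreal_le_iff U_def)
    qed
    have "ennreal (real n * real m2 powr (- \<alpha> - 1)) * (\<Sum>k=1..m2. ennreal (1 / (\<kappa> k)\<^sup>2)
        * ennreal ((l2norm unit_I (slice unit_I FS.S0 (\<phi> k)))\<^sup>2)) = Vnoise_coef n m2 \<omega>"
      unfolding Vnoise_coef_def
      by (intro arg_cong2[where f="(*)"] refl sum.cong slice_norm[symmetric]) auto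
    then show "(\<Sum>k=1..m2. (l2norm unit_I (slice unit_I FS.S0 (\<phi> k)))\<^sup>2 / (\<kappa> k)\<^sup>2) \<le> L * real m2 powr (\<alpha> + 1) / real n"
      using comps(7) by (intro coefs) auto
    have "ennreal (real n * real m2 powr (- \<alpha> - 1)) * (\<Sum>k=1..m2. ennreal (1 / (\<kappa> k)\<^sup>2)
        * ennreal ((l2inner unit_I FS.xbar (\<phi> k))\<^sup>2)) = Vmean_coef n m2 \<omega>"
      unfolding Vmean_coef_def by (intro arg_cong2[where f="(*)"] refl sum.cong) (auto simp: avg_hxi)
    then show "(\<Sum>k=1..m2. (l2inner unit_I FS.xbar (\<phi> k))\<^sup>2 / (\<kappa> k)\<^sup>2) \<le> L * real m2 powr (\<alpha> + 1) / real n"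
      using comps(8) by (intro coefs) auto
    show "sqrt (L / real n) + L / real n \<le> real (max m1 m2) powr (- \<alpha> - 1) / (4 * C1)" by fact
  qed
qed

text \<open>Here the restriction on the truncation levels is used: it makes the \<open>1 / sqrt n\<close> error of the
  empirical covariance negligible compared with the smallest relevant eigenvalue gap.\<close>
lemma eventually_small:
  assumes m: "\<And>n. 1 \<le> n \<Longrightarrow> 1 \<le> m n" and L: "0 < L"
    and o: "(\<lambda>n. real (m n)) \<in> o(\<lambda>n. real n powr (1 / (2 * \<alpha> + 2)))"
  shows "\<forall>\<^sub>F n in sequentially. sqrt (L / real n) + L / real n \<le> real (m n) powr (- \<alpha> - 1) / (4 * C1)"
proof -
  define s where "s = sqrt L + L"
  have s: "0 < s" using L by (simp add: s_def add_pos_pos)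
  \<comment> \<open>for this \<open>c\<close> the bound \<open>m n \<le> c * n powr (1 / (2 * \<alpha> + 2))\<close> gives exactly the claim\<close>
  define c where "c = (1 / (4 * C1 * s)) powr (1 / (\<alpha> + 1))"
  have "0 < 1 / (4 * C1 * s)" using C1 s by simp
  then have "0 < q \<Longrightarrow> (q powr (1 / (\<alpha> + 1))) powr (\<alpha> + 1) = q" for q
    using alpha by (simp add: powr_powr)
  then have c: "0 < c" "c powr (\<alpha> + 1) = 1 / (4 * C1 * s)"
    unfolding c_def using C1 s by auto
  have ev: "\<forall>\<^sub>F n in sequentially. norm (real (m n)) \<le> c * norm (real n powr (1 / (2 * \<alpha> + 2)))"
    using o c(1) by (rule landau_o.smallD)
  show ?thesis
    using ev eventually_ge_at_top[of 1]
  proof eventually_elim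
    case (elim n)
    have n0: "1 \<le> real n" using elim by simp
    have m0: "0 < real (m n)" using m[of n] elim by simp
    have "real (m n) powr (\<alpha> + 1) \<le> (c * real n powr (1 / (2 * \<alpha> + 2))) powr (\<alpha> + 1)"
      using elim alpha by (intro powr_mono2) auto
    also have "\<dots> = c powr (\<alpha> + 1) * real n powr (1 / (2 * \<alpha> + 2) * (\<alpha> + 1))"
      using c by (simp add: powr_mult powr_powr)
    also have "1 / (2 * \<alpha> + 2) * (\<alpha> + 1) = 1 / 2"
      using alpha by (simp add: field_simps)
    finally have up: "real (m n) powr (\<alpha> + 1) \<le> sqrt (real n) / (4 * C1 * s)"
      using n0 by (simp add: c powr_half_sqrt)
    have "L / real n \<le> L / sqrt (real n)"
    proof (rule divide_left_mono)
      show "sqrt (real n) \<le> real n"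
        using n0 by (intro real_le_lsqrt) (auto intro: self_le_power)
    qed (use n0 L in auto)
    then have "sqrt (L / real n) + L / real n \<le> s / sqrt (real n)"
      by (simp add: s_def real_sqrt_divide add_divide_distrib)
    also have "\<dots> = 1 / (sqrt (real n) / (4 * C1 * s)) / (4 * C1)"
      using C1 by simp
    also have "\<dots> \<le> 1 / (real (m n) powr (\<alpha> + 1)) / (4 * C1)"
      using up m0 C1 s n0 by (intro divide_right_mono divide_left_mono) (auto intro!: mult_pos_pos divide_pos_pos)
    also have "1 / (real (m n) powr (\<alpha> + 1)) = real (m n) powr (- \<alpha> - 1)"
      using powr_minus_divide[of "real (m n)" "\<alpha> + 1"] by simp
    finally show ?case .
  qed
qed

lemma risk_bigO_P:
  fixes m1 m2 :: "nat \<Rightarrow> nat"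
  assumes m: "\<And>n. 1 \<le> n \<Longrightarrow> 1 \<le> m1 n" "\<And>n. 1 \<le> n \<Longrightarrow> 1 \<le> m2 n"
    and o: "(\<lambda>n. real (max (m1 n) (m2 n))) \<in> o(\<lambda>n. real n powr (1 / (2 * \<alpha> + 2)))"
    and spec': "\<And>n \<omega>. 1 \<le> n \<Longrightarrow> \<omega> \<in> space M \<Longrightarrow>
      spectral_expansion unit_I (sample_cov n (\<lambda>i. Xs i \<omega>)) (hkap n \<omega>) (hphi n \<omega>)"
    and beta: "3 / 2 < \<beta>" and gamma: "3 / 2 < \<gamma>"
    and b_decay: "\<And>j k. 1 \<le> j \<Longrightarrow> 1 \<le> k \<Longrightarrow>
      \<bar>l2inner unit_I2 b (tensor (\<phi> j) (\<phi> k))\<bar> \<le> C1 * real j powr (- \<gamma>) * real k powr (- \<beta>)"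
  shows "bigO_P M
          (\<lambda>n \<omega>. (l2norm unit_I2 (\<lambda>p. b_tilde n (m1 n) (m2 n) (\<lambda>i. Xs i \<omega>) (\<lambda>i. Ys i \<omega>)
                                        (hkap n \<omega>) (hphi n \<omega>) d p - b p))\<^sup>2)
          (\<lambda>n. (real (m1 n) + real (m2 n) powr (\<alpha> + 1)) / real n
               + real (m1 n) powr (-2 * \<gamma> + 1) + real (m2 n) powr (-2 * \<beta> + 1))"
  unfolding bigO_P_def
proof (intro allI impI)
  fix \<epsilon> :: real assume \<epsilon>: "0 < \<epsilon>"
  define L where "L = V_const / \<epsilon>"
  have L: "0 < L" using \<epsilon> V_const_pos by (simp add: L_def)
  let ?Z = "\<lambda>n \<omega>. (l2norm unit_I2 (\<lambda>p. b_tilde n (m1 n) (m2 n) (\<lambda>i. Xs i \<omega>) (\<lambda>i. Ys i \<omega>)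
                                        (hkap n \<omega>) (hphi n \<omega>) d p - b p))\<^sup>2"
  let ?a = "\<lambda>n. (real (m1 n) + real (m2 n) powr (\<alpha> + 1)) / real n
               + real (m1 n) powr (-2 * \<gamma> + 1) + real (m2 n) powr (-2 * \<beta> + 1)"
  show "\<exists>C. \<forall>\<^sub>F n in sequentially. \<exists>A\<in>sets M. {\<omega> \<in> space M. C * ?a n < \<bar>?Z n \<omega>\<bar>} \<subseteq> A \<and> measure M A \<le> \<epsilon>"
  proof (rule exI[of _ "risk_const \<alpha> \<beta> \<gamma> C1 L"])
    have "\<forall>\<^sub>F n in sequentially. sqrt (L / real n) + L / real n \<le> real (max (m1 n) (m2 n)) powr (- \<alpha> - 1) / (4 * C1)"
      using m L o by (intro eventually_small) (auto simp: le_max_iff_disj)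
    then show "\<forall>\<^sub>F n in sequentially. \<exists>A\<in>sets M.
        {\<omega> \<in> space M. risk_const \<alpha> \<beta> \<gamma> C1 L * ?a n < \<bar>?Z n \<omega>\<bar>} \<subseteq> A \<and> measure M A \<le> \<epsilon>"
      using eventually_ge_at_top[of 1]
    proof eventually_elim
      case (elim n)
      let ?A = "{\<omega> \<in> space M. \<not> V n (m1 n) (m2 n) \<omega> \<le> ennreal L}"
      note tail = V_tail[OF elim(2) m(1)[OF elim(2)] m(2)[OF elim(2)] L]
      have "{\<omega> \<in> space M. risk_const \<alpha> \<beta> \<gamma> C1 L * ?a n < \<bar>?Z n \<omega>\<bar>} \<subseteq> ?A"
      proof
        fix \<omega> assume \<omega>: "\<omega> \<in> {\<omega> \<in> space M. risk_const \<alpha> \<beta> \<gamma> C1 L * ?a n < \<bar>?Z n \<omega>\<bar>}"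
        have "\<not> V n (m1 n) (m2 n) \<omega> \<le> ennreal L"
        proof
          assume "V n (m1 n) (m2 n) \<omega> \<le> ennreal L"
          from risk_bound_at[OF _ elim(2) m(1)[OF elim(2)] m(2)[OF elim(2)] L this elim(1) spec'[OF elim(2)] beta gamma b_decay, of d]
          have "?Z n \<omega> \<le> risk_const \<alpha> \<beta> \<gamma> C1 L * ?a n" using \<omega> by simp
          with \<omega> show False by simp
        qed
        with \<omega> show "\<omega> \<in> ?A" by simp
      qed
      moreover have "measure M ?A \<le> \<epsilon>"
        using tail(2) \<epsilon> V_const_pos by (simp add: L_def)
      ultimately show ?case using tail(1) by blast
    qed
  qed
qed

end

section \<open>Choice of the truncation levels\<close>

lemma bigO_P_mono:
  assumes Z: "bigO_P M Z a" and le: "\<forall>\<^sub>F n in sequentially. a n \<le> c * a' n"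
    and nonneg: "\<And>n. 0 \<le> a n"
  shows "bigO_P M Z a'"
  unfolding bigO_P_def
proof (intro allI impI)
  fix \<epsilon> :: real assume "0 < \<epsilon>"
  with Z obtain C where C: "\<forall>\<^sub>F n in sequentially. \<exists>A\<in>sets M. {\<omega> \<in> space M. C * a n < \<bar>Z n \<omega>\<bar>} \<subseteq> A \<and> measure M A \<le> \<epsilon>"
    unfolding bigO_P_def by blast
  show "\<exists>C. \<forall>\<^sub>F n in sequentially. \<exists>A\<in>sets M. {\<omega> \<in> space M. C * a' n < \<bar>Z n \<omega>\<bar>} \<subseteq> A \<and> measure M A \<le> \<epsilon>"
  proof (rule exI[of _ "max C 0 * c"])
    show "\<forall>\<^sub>F n in sequentially. \<exists>A\<in>sets M. {\<omega> \<in> space M. max C 0 * c * a' n < \<bar>Z n \<omega>\<bar>} \<subseteq> A \<and> measure M A \<le> \<epsilon>"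
      using C le
    proof eventually_elim
      case (elim n)
      have "C * a n \<le> max C 0 * a n" using nonneg by (intro mult_right_mono) auto
      also have "\<dots> \<le> max C 0 * (c * a' n)" using elim(2) by (intro mult_left_mono) auto
      finally have "{\<omega> \<in> space M. max C 0 * c * a' n < \<bar>Z n \<omega>\<bar>} \<subseteq> {\<omega> \<in> space M. C * a n < \<bar>Z n \<omega>\<bar>}"
        by (auto simp: mult.assoc)
      with elim(1) show ?case by blast
    qed
  qed
qed

context
  fixes \<alpha> \<beta> \<gamma> :: real and m1 m2 :: "nat \<Rightarrow> nat"
  assumes \<alpha>: "1 < \<alpha>" and \<beta>: "\<alpha> / 2 + 1 < \<beta>" and \<gamma>: "\<alpha> / 2 + 1 < \<gamma>"
    and m: "\<And>n. 1 \<le> n \<Longrightarrow> 1 \<le> m1 n" "\<And>n. 1 \<le> n \<Longrightarrow> 1 \<le> m2 n"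
    and \<Theta>1: "(\<lambda>n. real (m1 n)) \<in> \<Theta>(\<lambda>n. min (real n powr (1 / (2 * \<gamma>)))
                                       ((real n / ln (real n)) powr (1 / (2 * \<alpha> + 2))))"
    and \<Theta>2: "(\<lambda>n. real (m2 n)) \<in> \<Theta>(\<lambda>n. real n powr (1 / (\<alpha> + 2 * \<beta>)))"
begin

lemma levels_small:
  "(\<lambda>n. real (max (m1 n) (m2 n))) \<in> o(\<lambda>n. real n powr (1 / (2 * \<alpha> + 2)))"
proof -
  let ?e = "1 / (2 * \<alpha> + 2)"
  let ?q = "\<lambda>n. (real n / ln (real n)) powr ?e"
  have e: "0 < ?e" using \<alpha> by simp
  have "(\<lambda>n. real (m1 n)) \<in> O(\<lambda>n. min (real n powr (1 / (2 * \<gamma>))) (?q n))"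
    using \<Theta>1 by (rule bigthetaD1)
  also have "(\<lambda>n. min (real n powr (1 / (2 * \<gamma>))) (?q n)) \<in> O(?q)"
    by (intro landau_o.big_mono always_eventually allI) auto
  also have "?q \<in> o(\<lambda>n. real n powr ?e)" using e by real_asymp
  finally have o1: "(\<lambda>n. real (m1 n)) \<in> o(\<lambda>n. real n powr ?e)" .
  have "(\<lambda>n. real (m2 n)) \<in> O(\<lambda>n. real n powr (1 / (\<alpha> + 2 * \<beta>)))" using \<Theta>2 by (rule bigthetaD1)
  also have "(\<lambda>n. real n powr (1 / (\<alpha> + 2 * \<beta>))) \<in> o(\<lambda>n. real n powr ?e)"
  proof -
    have "0 < 1 / (\<alpha> + 2 * \<beta>)" "1 / (\<alpha> + 2 * \<beta>) < ?e"
      using \<alpha> \<beta> by (auto intro!: divide_strict_left_mono mult_pos_pos)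
    then show ?thesis by real_asymp
  qed
  finally have o2: "(\<lambda>n. real (m2 n)) \<in> o(\<lambda>n. real n powr ?e)" .
  have "(\<lambda>n. real (max (m1 n) (m2 n))) \<in> O(\<lambda>n. real (m1 n) + real (m2 n))"
    by (intro landau_o.big_mono always_eventually allI) auto
  also have "(\<lambda>n. real (m1 n) + real (m2 n)) \<in> o(\<lambda>n. real n powr ?e)"
    using o1 o2 by (rule sum_in_smallo)
  finally show ?thesis .
qed

text \<open>The chosen levels balance the two terms that depend on each of them, unless the
  restriction on the first level becomes active, which costs the logarithmic rate.\<close>

lemma rate_at_levels:
  "\<exists>c. \<forall>\<^sub>F n in sequentially.
     (real (m1 n) + real (m2 n) powr (\<alpha> + 1)) / real n
       + real (m1 n) powr (-2 * \<gamma> + 1) + real (m2 n) powr (-2 * \<beta> + 1)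
     \<le> c * Max {(real n / ln (real n)) powr (- (2 * \<gamma> - 1) / (2 * \<alpha> + 2)),
                real n powr (- (2 * \<gamma> - 1) / (2 * \<gamma>)),
                real n powr (- (2 * \<beta> - 1) / (\<alpha> + 2 * \<beta>))}"
proof -
  let ?q = "\<lambda>n. real n / ln (real n)"
  let ?r1 = "\<lambda>n. min (real n powr (1 / (2 * \<gamma>))) (?q n powr (1 / (2 * \<alpha> + 2)))"
  let ?r2 = "\<lambda>n. real n powr (1 / (\<alpha> + 2 * \<beta>))"
  let ?t1 = "\<lambda>n. ?q n powr (- (2 * \<gamma> - 1) / (2 * \<alpha> + 2))"
  let ?t2 = "\<lambda>n. real n powr (- (2 * \<gamma> - 1) / (2 * \<gamma>))"
  let ?t3 = "\<lambda>n. real n powr (- (2 * \<beta> - 1) / (\<alpha> + 2 * \<beta>))"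
  have pos: "0 < \<beta>" "0 < \<gamma>" "0 < \<alpha> + 2 * \<beta>" using \<alpha> \<beta> \<gamma> by auto
  from bigthetaD1[OF \<Theta>1] obtain u1 where u1: "0 < u1"
    "\<forall>\<^sub>F n in sequentially. norm (real (m1 n)) \<le> u1 * norm (?r1 n)" by (elim landau_o.bigE)
  from bigthetaD2[OF \<Theta>1] obtain l1 where l1: "0 < l1"
    "\<forall>\<^sub>F n in sequentially. norm (real (m1 n)) \<ge> l1 * norm (?r1 n)" by (elim landau_omega.bigE)
  from bigthetaD1[OF \<Theta>2] obtain u2 where u2: "0 < u2"
    "\<forall>\<^sub>F n in sequentially. norm (real (m2 n)) \<le> u2 * norm (?r2 n)" by (elim landau_o.bigE)
  from bigthetaD2[OF \<Theta>2] obtain l2 where l2: "0 < l2"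
    "\<forall>\<^sub>F n in sequentially. norm (real (m2 n)) \<ge> l2 * norm (?r2 n)" by (elim landau_omega.bigE)
  define c where "c = u1 + u2 powr (\<alpha> + 1) + l1 powr (1 - 2 * \<gamma>) + l2 powr (1 - 2 * \<beta>)"
  show ?thesis
  proof (rule exI[of _ c])
    show "\<forall>\<^sub>F n in sequentially.
       (real (m1 n) + real (m2 n) powr (\<alpha> + 1)) / real n
         + real (m1 n) powr (-2 * \<gamma> + 1) + real (m2 n) powr (-2 * \<beta> + 1) \<le> c * Max {?t1 n, ?t2 n, ?t3 n}"
      using u1(2) l1(2) u2(2) l2(2) eventually_ge_at_top[of 3]
    proof eventually_elim
      case (elim n)
      define T where "T = Max {?t1 n, ?t2 n, ?t3 n}"
      have T: "?t1 n \<le> T" "?t2 n \<le> T" "?t3 n \<le> T" by (simp_all add: T_def)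
      have n: "1 < real n" using elim(5) by simp
      have lnn: "0 < ln (real n)" using n by simp
      have q: "0 < ?q n" using n lnn by simp
      have r1: "0 < ?r1 n" using q n by simp
      have r2: "0 < ?r2 n" using n by simp
      have "real (m1 n) / real n \<le> u1 * real n powr (1 / (2 * \<gamma>)) / real n"
        using elim(1) r1 u1(1) n
        by (intro divide_right_mono) (auto intro: order_trans[OF _ mult_left_mono[of "?r1 n"]])
      also have "\<dots> = u1 * (real n powr (1 / (2 * \<gamma>)) / real n powr 1)" using n by simp
      also have "real n powr (1 / (2 * \<gamma>)) / real n powr 1 = ?t2 n"
        using pos by (subst powr_diff[symmetric]) (simp add: field_simps)
      finally have 1: "real (m1 n) / real n \<le> u1 * T"
        by (rule order_trans[OF _ mult_left_mono[OF T(2)]]) (use u1(1) in simp)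
      have "real (m2 n) powr (\<alpha> + 1) / real n \<le> (u2 * ?r2 n) powr (\<alpha> + 1) / real n"
        using elim(3) r2 n \<alpha> by (intro divide_right_mono powr_mono2) auto
      also have "\<dots> = u2 powr (\<alpha> + 1) * (real n powr (1 / (\<alpha> + 2 * \<beta>) * (\<alpha> + 1)) / real n powr 1)"
        using n u2(1) by (simp add: powr_mult powr_powr)
      also have "real n powr (1 / (\<alpha> + 2 * \<beta>) * (\<alpha> + 1)) / real n powr 1 = ?t3 n"
        using pos by (subst powr_diff[symmetric]) (simp add: field_simps)
      finally have 2: "real (m2 n) powr (\<alpha> + 1) / real n \<le> u2 powr (\<alpha> + 1) * T"
        by (rule order_trans[OF _ mult_left_mono[OF T(3)]]) simp
      have "real (m1 n) powr (1 - 2 * \<gamma>) \<le> (l1 * ?r1 n) powr (1 - 2 * \<gamma>)"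
        using elim(2) r1 l1(1) \<gamma> \<alpha> by (intro powr_mono2') auto
      also have "\<dots> = l1 powr (1 - 2 * \<gamma>) * ?r1 n powr (1 - 2 * \<gamma>)"
        using r1 l1(1) by (simp add: powr_mult)
      also have "?r1 n powr (1 - 2 * \<gamma>) \<le> T"
      proof (cases "real n powr (1 / (2 * \<gamma>)) \<le> ?q n powr (1 / (2 * \<alpha> + 2))")
        case True
        then have "?r1 n powr (1 - 2 * \<gamma>) = real n powr (1 / (2 * \<gamma>) * (1 - 2 * \<gamma>))"
          by (simp add: powr_powr min_def)
        also have "1 / (2 * \<gamma>) * (1 - 2 * \<gamma>) = - (2 * \<gamma> - 1) / (2 * \<gamma>)" by simp
        finally show ?thesis using T(2) by simp
      next
        case False
        then have "?r1 n powr (1 - 2 * \<gamma>) = ?q n powr (1 / (2 * \<alpha> + 2) * (1 - 2 * \<gamma>))"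
          by (simp only: min_def if_False powr_powr)
        also have "1 / (2 * \<alpha> + 2) * (1 - 2 * \<gamma>) = - (2 * \<gamma> - 1) / (2 * \<alpha> + 2)" by simp
        finally show ?thesis using T(1) by simp
      qed
      finally have 3: "real (m1 n) powr (1 - 2 * \<gamma>) \<le> l1 powr (1 - 2 * \<gamma>) * T"
        by (simp add: mult_left_mono)
      have "real (m2 n) powr (1 - 2 * \<beta>) \<le> (l2 * ?r2 n) powr (1 - 2 * \<beta>)"
        using elim(4) r2 l2(1) \<beta> \<alpha> by (intro powr_mono2') auto
      also have "\<dots> = l2 powr (1 - 2 * \<beta>) * real n powr (1 / (\<alpha> + 2 * \<beta>) * (1 - 2 * \<beta>))"
        using n l2(1) by (simp add: powr_mult powr_powr)
      also have "1 / (\<alpha> + 2 * \<beta>) * (1 - 2 * \<beta>) = - (2 * \<beta> - 1) / (\<alpha> + 2 * \<beta>)" by simp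
      finally have 4: "real (m2 n) powr (1 - 2 * \<beta>) \<le> l2 powr (1 - 2 * \<beta>) * T"
        by (rule order_trans[OF _ mult_left_mono[OF T(3)]]) simp
      have "(real (m1 n) + real (m2 n) powr (\<alpha> + 1)) / real n
         + real (m1 n) powr (-2 * \<gamma> + 1) + real (m2 n) powr (-2 * \<beta> + 1)
         = real (m1 n) / real n + real (m2 n) powr (\<alpha> + 1) / real n
         + real (m1 n) powr (1 - 2 * \<gamma>) + real (m2 n) powr (1 - 2 * \<beta>)"
        by (simp add: add_divide_distrib)
      also have "\<dots> \<le> u1 * T + u2 powr (\<alpha> + 1) * T + l1 powr (1 - 2 * \<gamma>) * T + l2 powr (1 - 2 * \<beta>) * T"
        using 1 2 3 4 by linarith
      also have "\<dots> = c * T" by (simp only: c_def distrib_right)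
      finally show ?case by (simp only: T_def)
    qed
  qed
qed

end

section \<open>Rates of convergence of the double-truncation estimator\<close>

theorem theorem2:
  fixes M :: "'w measure"
    and X Y EYX :: "'w \<Rightarrow> real \<Rightarrow> real"
    and Xs Ys :: "nat \<Rightarrow> 'w \<Rightarrow> real \<Rightarrow> real"
    and b :: "real \<times> real \<Rightarrow> real"
    and \<kappa> :: "nat \<Rightarrow> real" and \<phi> :: "nat \<Rightarrow> real \<Rightarrow> real"
    and hkap :: "nat \<Rightarrow> 'w \<Rightarrow> nat \<Rightarrow> real" and hphi :: "nat \<Rightarrow> 'w \<Rightarrow> nat \<Rightarrow> real \<Rightarrow> real"
    and \<alpha> \<beta> \<gamma> C1 d :: real
  assumes prob: "prob_space M"
    and rvX: "L2_random_variable M X" and rvY: "L2_random_variable M Y"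
    and X2: "integrable M (\<lambda>\<omega>. (l2norm unit_I (X \<omega>))\<^sup>2)"
    and Y2: "integrable M (\<lambda>\<omega>. (l2norm unit_I (Y \<omega>))\<^sup>2)"
    and b_L2: "b \<in> L2 unit_I2"
    and cond_exp: "is_L2_cond_exp M (sigma_gen M X) Y EYX"
    and model: "AE \<omega> in M. AE s in unit_I.
      EYX \<omega> s = mean_fun M Y s + (\<integral>t. b (s, t) * (X \<omega> t - mean_fun M X t) \<partial>unit_I)"
    and K_inj: "int_op_injective unit_I (cov_kernel M X)"
    and K_spec: "spectral_expansion unit_I (cov_kernel M X) \<kappa> \<phi>"
    and kappa_pos: "\<And>k. k \<ge> 1 \<Longrightarrow> \<kappa> k > 0"
    and rvXs: "\<And>i. i \<ge> 1 \<Longrightarrow> L2_random_variable M (Xs i)"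
    and rvYs: "\<And>i. i \<ge> 1 \<Longrightarrow> L2_random_variable M (Ys i)"
    and indep: "prob_space.indep_vars M (\<lambda>_. L2_borel unit_I \<Otimes>\<^sub>M L2_borel unit_I)
      (\<lambda>i \<omega>. (Xs i \<omega>, Ys i \<omega>)) {1..}"
    and ident: "\<And>i. i \<ge> 1 \<Longrightarrow>
      distr M (L2_borel unit_I \<Otimes>\<^sub>M L2_borel unit_I) (\<lambda>\<omega>. (Xs i \<omega>, Ys i \<omega>)) =
      distr M (L2_borel unit_I \<Otimes>\<^sub>M L2_borel unit_I) (\<lambda>\<omega>. (X \<omega>, Y \<omega>))"
    and hK_spec: "\<And>n \<omega>. n \<ge> 1 \<Longrightarrow> \<omega> \<in> space M \<Longrightarrow>
      spectral_expansion unit_I (sample_cov n (\<lambda>i. Xs i \<omega>)) (hkap n \<omega>) (hphi n \<omega>)"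
    and hkap_nonneg: "\<And>n \<omega> k. n \<ge> 1 \<Longrightarrow> \<omega> \<in> space M \<Longrightarrow> k \<ge> 1 \<Longrightarrow> hkap n \<omega> k \<ge> 0"
    and params: "\<alpha> > 1" "\<beta> > \<alpha> / 2 + 1" "\<gamma> > 1 / 2" "C1 > 1"
    and error_bound: "AE \<omega> in M.
      real_cond_exp M (sigma_gen M X) (\<lambda>\<omega>'. (l2norm unit_I (\<lambda>s. Y \<omega>' s - EYX \<omega>' s))\<^sup>2) \<omega> \<le> C1"
    and xi4: "\<And>k. k \<ge> 1 \<Longrightarrow> integrable M (\<lambda>\<omega>. (score M X (\<phi> k) \<omega>) ^ 4)"
      "\<And>k. k \<ge> 1 \<Longrightarrow> (\<integral>\<omega>. (score M X (\<phi> k) \<omega>) ^ 4 \<partial>M) \<le> C1 * (\<kappa> k)\<^sup>2"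
    and kappa_decay: "\<And>k. k \<ge> 1 \<Longrightarrow> \<kappa> k \<le> C1 * real k powr (-\<alpha>)"
    and kappa_gap: "\<And>k. k \<ge> 1 \<Longrightarrow> \<kappa> k - \<kappa> (Suc k) \<ge> inverse C1 * real k powr (-\<alpha> - 1)"
    and b_decay: "\<And>j k. j \<ge> 1 \<Longrightarrow> k \<ge> 1 \<Longrightarrow>
      \<bar>l2inner unit_I2 b (tensor (\<phi> j) (\<phi> k))\<bar> \<le> C1 * real j powr (-\<gamma>) * real k powr (-\<beta>)"
    and gamma: "\<gamma> > \<alpha> / 2 + 1"
  shows
    "(\<forall>m1 m2 :: nat \<Rightarrow> nat.
        (\<forall>n\<ge>1. m1 n \<ge> 1 \<and> m2 n \<ge> 1) \<and>
        filterlim m1 at_top sequentially \<and> filterlim m2 at_top sequentially \<and>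
        (\<lambda>n. real (max (m1 n) (m2 n))) \<in> o(\<lambda>n. real n powr (1 / (2 * \<alpha> + 2))) \<longrightarrow>
        bigO_P M
          (\<lambda>n \<omega>. (l2norm unit_I2 (\<lambda>p. b_tilde n (m1 n) (m2 n) (\<lambda>i. Xs i \<omega>) (\<lambda>i. Ys i \<omega>)
                                        (hkap n \<omega>) (hphi n \<omega>) d p - b p))\<^sup>2)
          (\<lambda>n. (real (m1 n) + real (m2 n) powr (\<alpha> + 1)) / real n
               + real (m1 n) powr (-2 * \<gamma> + 1) + real (m2 n) powr (-2 * \<beta> + 1))) \<and>
     (\<forall>m1 m2 :: nat \<Rightarrow> nat.
        (\<forall>n\<ge>1. m1 n \<ge> 1 \<and> m2 n \<ge> 1) \<and>
        (\<lambda>n. real (m1 n)) \<in> \<Theta>(\<lambda>n. min (real n powr (1 / (2 * \<gamma>)))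
                                       ((real n / ln (real n)) powr (1 / (2 * \<alpha> + 2)))) \<and>
        (\<lambda>n. real (m2 n)) \<in> \<Theta>(\<lambda>n. real n powr (1 / (\<alpha> + 2 * \<beta>))) \<longrightarrow>
        bigO_P M
          (\<lambda>n \<omega>. (l2norm unit_I2 (\<lambda>p. b_tilde n (m1 n) (m2 n) (\<lambda>i. Xs i \<omega>) (\<lambda>i. Ys i \<omega>)
                                        (hkap n \<omega>) (hphi n \<omega>) d p - b p))\<^sup>2)
          (\<lambda>n. Max {(real n / ln (real n)) powr (- (2 * \<gamma> - 1) / (2 * \<alpha> + 2)),
                    real n powr (- (2 * \<gamma> - 1) / (2 * \<gamma>)),
                    real n powr (- (2 * \<beta> - 1) / (\<alpha> + 2 * \<beta>))}))"
proof -
  interpret flr_sample M X Y EYX b C1 \<kappa> \<alpha> \<phi> Xs Ys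
    by (intro flr_sample.intro functional_linear_model.intro functional_linear_model_axioms.intro
        polynomial_spectrum.intro flr_sample_axioms.intro prob rvX rvY X2 Y2 b_L2 cond_exp model
        error_bound params(1,4) kappa_pos kappa_decay kappa_gap K_spec rvXs rvYs indep ident xi4)
      (use params(4) in auto)
  have beta: "3 / 2 < \<beta>" and gamma': "3 / 2 < \<gamma>" using params(1,2) gamma by auto
  note risk = risk_bigO_P[OF _ _ _ hK_spec beta gamma' b_decay]
  show ?thesis
  proof (intro conjI allI impI; elim conjE)
    fix m1 m2 :: "nat \<Rightarrow> nat"
    assume m: "\<forall>n\<ge>1. m1 n \<ge> 1 \<and> m2 n \<ge> 1"
      and o: "(\<lambda>n. real (max (m1 n) (m2 n))) \<in> o(\<lambda>n. real n powr (1 / (2 * \<alpha> + 2)))"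
    show "bigO_P M
          (\<lambda>n \<omega>. (l2norm unit_I2 (\<lambda>p. b_tilde n (m1 n) (m2 n) (\<lambda>i. Xs i \<omega>) (\<lambda>i. Ys i \<omega>)
                                        (hkap n \<omega>) (hphi n \<omega>) d p - b p))\<^sup>2)
          (\<lambda>n. (real (m1 n) + real (m2 n) powr (\<alpha> + 1)) / real n
               + real (m1 n) powr (-2 * \<gamma> + 1) + real (m2 n) powr (-2 * \<beta> + 1))"
      by (rule risk) (use m o in auto)
  next
    fix m1 m2 :: "nat \<Rightarrow> nat"
    assume m: "\<forall>n\<ge>1. m1 n \<ge> 1 \<and> m2 n \<ge> 1"
      and \<Theta>: "(\<lambda>n. real (m1 n)) \<in> \<Theta>(\<lambda>n. min (real n powr (1 / (2 * \<gamma>)))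
                                       ((real n / ln (real n)) powr (1 / (2 * \<alpha> + 2))))"
        "(\<lambda>n. real (m2 n)) \<in> \<Theta>(\<lambda>n. real n powr (1 / (\<alpha> + 2 * \<beta>)))"
    have m12: "1 \<le> m1 n" "1 \<le> m2 n" if "1 \<le> n" for n using m that by auto
    obtain c where c: "\<forall>\<^sub>F n in sequentially.
        (real (m1 n) + real (m2 n) powr (\<alpha> + 1)) / real n
          + real (m1 n) powr (-2 * \<gamma> + 1) + real (m2 n) powr (-2 * \<beta> + 1)
        \<le> c * Max {(real n / ln (real n)) powr (- (2 * \<gamma> - 1) / (2 * \<alpha> + 2)),
                real n powr (- (2 * \<gamma> - 1) / (2 * \<gamma>)),
                real n powr (- (2 * \<beta> - 1) / (\<alpha> + 2 * \<beta>))}"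
      using rate_at_levels[OF params(1,2) gamma m12 \<Theta>] by blast
    show "bigO_P M
          (\<lambda>n \<omega>. (l2norm unit_I2 (\<lambda>p. b_tilde n (m1 n) (m2 n) (\<lambda>i. Xs i \<omega>) (\<lambda>i. Ys i \<omega>)
                                        (hkap n \<omega>) (hphi n \<omega>) d p - b p))\<^sup>2)
          (\<lambda>n. Max {(real n / ln (real n)) powr (- (2 * \<gamma> - 1) / (2 * \<alpha> + 2)),
                    real n powr (- (2 * \<gamma> - 1) / (2 * \<gamma>)),
                    real n powr (- (2 * \<beta> - 1) / (\<alpha> + 2 * \<beta>))})"
    proof (rule bigO_P_mono[OF risk c])
      show "(\<lambda>n. real (max (m1 n) (m2 n))) \<in> o(\<lambda>n. real n powr (1 / (2 * \<alpha> + 2)))"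
        by (rule levels_small[OF params(1,2) gamma m12 \<Theta>])
    qed (use m12 in auto)
  qed
qed

end
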